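(* Let $K$ be a fixed graph. Let $n\to\infty$, let $d=d(n)$ be positive integers with $dn$ even and $p:=d/n$ satisfying $n^{-1}\log\log n\ll p\ll 1$. Let $W=W(n)$ be a block graphon on $k=k(n)=O(1)$ blocks satisfying Conditions (1)–(10) below. Then \[-\log\left(\Pr\left[\mathrm{Hom}(K,G_n^d)\geq (1-o(1))\mathrm{Hom}(K,W)n^{v(K)}\right]\right)\leq \left(\frac{1}{2}+o(1)\right)I_p(W)n^2\] as $n\to\infty$.
   Context: $G_n^d$ is a uniformly random $d$-regular graph on $[n]$; $\mathrm{Hom}(K,G)$ counts maps $V(K)\to V(G)$ sending edges to edges. A graphon is a symmetric measurable $W:[0,1]^2\to[0,1]$; $\mathrm{Hom}(K,W)=\int\prod_{uv\in E(K)}W(x_u,x_v)\prod_v dx_v$ (also used for symmetric $W$ with real values, e.g. $W+p$). $I_p(x)=x\log\frac xp+(1-x)\log\frac{1-x}{1-p}$ ($0\log0=0$), $I_p(W)=\int I_p(W(x,y))dxdy$. $W$ is a block graphon on the partition $[0,1]=S_1\cup\dots\cup S_k$ into intervals if $W\equiv w_{ij}$ on $S_i\times S_j$; $m$ is Lebesgue measure. A $K$-block is a map $B:V(K)\to[k]$; $\mathrm{Hom}_B(K,W)$ is the integral defining $\mathrm{Hom}(K,W)$ restricted to $x_v\in S_{B(v)}$ for all $v$; $B$ is negligible if $\mathrm{Hom}_B(K,W)=o(p^{e(K)})$. All asymptotics are as $n\to\infty$. Conditions: (1) $W$ is $p$-regular: $\int_0^1W(x,y)dy=p$ for all $x$.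 (2) $m(S_k)\ge1-p$. (3) $\mathrm{Hom}(K,W)\ge(1+\Omega(1))p^{e(K)}$. (4) $n^{-1}\log n\ll I_p(W)\ll p^{2e(K)}n$. (5) $m(S_i)\gg n^{-1}$ for all $i$. (6) For all $i,j\le k-1$: $w_{ij}\ge p$, and either $w_{ij}=p$ or $m(S_i)m(S_j)w_{ij}\ll(\log\log\log\frac1p)^{-1}I_p(W)$. A block $(i,j)$ is important if $i,j\le k-1$ and $m(S_i)m(S_j)w_{ij}\ll(\log\log\log\frac1p)^{-1}I_p(W)$, unimportant otherwise; an important block is somewhat important if $w_{ij}<1$ and very important if $w_{ij}=1$. (7) For every non-negligible $K$-block $B$, the edges $uv\in E(K)$ with $(B(u),B(v))$ somewhat important are pairwise disjoint. (8) If $B$ is a non-negligible $K$-block and $(i,j)$ is an unimportant block with $(B(u),B(v))=(i,j)$ for some edge $uv$, then $m(S_i)m(S_j)\ge(1+o(1))p^{-1}I_p(W)$ and $w_{ij}=p+o(p)$. (9) $w_{ij}m(S_i)\gg n^{-1}\log n$ for every important $(i,j)$. (10) $\mathrm{Hom}(K,W+p)=O(p^{e(K)})$. *)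

theory Defs
  imports "HOL-Probability.Probability" "HOL-Library.Landau_Symbols"
begin

section \<open>Simple graphs, homomorphism counts, random regular graphs\<close>

definition simple_graph :: "'v set \<Rightarrow> 'v set set \<Rightarrow> bool" where
  "simple_graph V E \<longleftrightarrow> finite V \<and> (\<forall>e\<in>E. e \<subseteq> V \<and> card e = 2)"

definition hom_count :: "'v set \<Rightarrow> 'v set set \<Rightarrow> 'a set \<Rightarrow> 'a set set \<Rightarrow> nat" where
  "hom_count V E V' E' = card {f \<in> V \<rightarrow>\<^sub>E V'. \<forall>e\<in>E. f ` e \<in> E'}"

definition regular_graphs :: "nat \<Rightarrow> nat \<Rightarrow> nat set set set" where
  "regular_graphs n d =
     {G. simple_graph {1..n} G \<and> (\<forall>v\<in>{1..n}. card {e \<in> G. v \<in> e} = d)}"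

text \<open>The uniform distribution is only meaningful if a \<open>d\<close>-regular graph on \<open>n\<close> vertices exists,
  that is, if \<open>d < n\<close> and \<open>d n\<close> is even; \<^const>\<open>pmf_of_set\<close> is unspecified on the empty set.\<close>

definition random_regular_graph :: "nat \<Rightarrow> nat \<Rightarrow> nat set set pmf" where
  "random_regular_graph n d = pmf_of_set (regular_graphs n d)"


section \<open>Graphons\<close>

definition graphon :: "(real \<Rightarrow> real \<Rightarrow> real) \<Rightarrow> bool" where
  "graphon W \<longleftrightarrow>
     (\<lambda>z. W (fst z) (snd z)) \<in> borel_measurable (restrict_space borel ({0..1} \<times> {0..1})) \<and>
     (\<forall>x\<in>{0..1}. \<forall>y\<in>{0..1}. W x y = W y x \<and> W x y \<in> {0..1})"

text \<open>An arbitrary ordering of the two ends of an edge. For symmetric \<open>W\<close> the value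
  \<open>W (x u) (x v)\<close> does not depend on it.\<close>

definition edge_ends :: "'v set \<Rightarrow> 'v \<times> 'v" where
  "edge_ends e = (SOME (u, v). e = {u, v})"

definition hom_weight ::
    "'v set set \<Rightarrow> (real \<Rightarrow> real \<Rightarrow> real) \<Rightarrow> ('v \<Rightarrow> real) \<Rightarrow> real" where
  "hom_weight E W x = (\<Prod>e\<in>E. W (x (fst (edge_ends e))) (x (snd (edge_ends e))))"

definition hom_density :: "'v set \<Rightarrow> 'v set set \<Rightarrow> (real \<Rightarrow> real \<Rightarrow> real) \<Rightarrow> real" where
  "hom_density V E W = (LINT x : V \<rightarrow>\<^sub>E {0..1} | Pi\<^sub>M V (\<lambda>_. lborel). hom_weight E W x)"

text \<open>The convention \<open>0 log 0 = 0\<close> is automatic.\<close>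

definition rel_ent :: "real \<Rightarrow> real \<Rightarrow> real" where
  "rel_ent p x = x * ln (x / p) + (1 - x) * ln ((1 - x) / (1 - p))"

definition graphon_ent :: "real \<Rightarrow> (real \<Rightarrow> real \<Rightarrow> real) \<Rightarrow> real" where
  "graphon_ent p W = (LINT z : {0..1} \<times> {0..1} | lborel. rel_ent p (W (fst z) (snd z)))"


section \<open>Block graphons\<close>

text \<open>The blocks are indexed by \<open>{1..num B}\<close>; \<open>part\<close> and \<open>wt\<close> are irrelevant at other indices.\<close>

record block_data =
  num :: nat
  part :: "nat \<Rightarrow> real set"
  wt :: "nat \<Rightarrow> nat \<Rightarrow> real"
  fn :: "real \<Rightarrow> real \<Rightarrow> real"

definition block_graphon :: "block_data \<Rightarrow> bool" where
  "block_graphon W \<longleftrightarrow>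
     graphon (fn W) \<and>
     (\<forall>i\<in>{1..num W}. is_interval (part W i) \<and> part W i \<noteq> {}) \<and>
     disjoint_family_on (part W) {1..num W} \<and>
     (\<Union>i\<in>{1..num W}. part W i) = {0..1} \<and>
     (\<forall>i\<in>{1..num W}. \<forall>j\<in>{1..num W}. \<forall>x\<in>part W i. \<forall>y\<in>part W j. fn W x y = wt W i j)"

definition mS :: "block_data \<Rightarrow> nat \<Rightarrow> real" where
  "mS W i = measure lborel (part W i)"

definition hom_density_block :: "'v set \<Rightarrow> 'v set set \<Rightarrow> block_data \<Rightarrow> ('v \<Rightarrow> nat) \<Rightarrow> real" where
  "hom_density_block V E W B =
     (LINT x : (\<Pi>\<^sub>E v\<in>V. part W (B v)) | Pi\<^sub>M V (\<lambda>_. lborel). hom_weight E (fn W) x)"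


section \<open>Asymptotic classification of blocks\<close>

text \<open>In what follows \<open>n\<close> tends to infinity through a set \<open>N\<close>, and \<open>p\<close>, \<open>W\<close> depend on \<open>n\<close>.\<close>

abbreviation along :: "nat set \<Rightarrow> nat filter" where
  "along N \<equiv> inf sequentially (principal N)"

text \<open>The number of blocks may vary with \<open>n\<close>. A fixed index, pair of indices or \<open>K\<close>-block
  denotes a sequence defined at those \<open>n\<close> at which it makes sense, and asymptotic statements
  about it refer to these \<open>n\<close> only. As the number of blocks is bounded, there are finitely many
  of them, so the asymptotics are uniform over all blocks.\<close>

definition index_at :: "nat set \<Rightarrow> (nat \<Rightarrow> block_data) \<Rightarrow> nat \<Rightarrow> nat set" where
  "index_at N W i = {n \<in> N. 1 \<le> i \<and> i \<le> num (W n)}"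

text \<open>The \<open>n\<close> with \<open>i, j \<le> k - 1\<close>.\<close>

definition inner_at :: "nat set \<Rightarrow> (nat \<Rightarrow> block_data) \<Rightarrow> nat \<Rightarrow> nat \<Rightarrow> nat set" where
  "inner_at N W i j = {n \<in> N. 1 \<le> i \<and> i < num (W n) \<and> 1 \<le> j \<and> j < num (W n)}"

definition Kblock_at :: "nat set \<Rightarrow> (nat \<Rightarrow> block_data) \<Rightarrow> 'v set \<Rightarrow> ('v \<Rightarrow> nat) \<Rightarrow> nat set" where
  "Kblock_at N W V B = {n \<in> N. \<forall>v\<in>V. B v \<in> {1..num (W n)}}"

definition negligible_Kblock ::
    "'v set \<Rightarrow> 'v set set \<Rightarrow> nat set \<Rightarrow> (nat \<Rightarrow> real) \<Rightarrow> (nat \<Rightarrow> block_data) \<Rightarrow> ('v \<Rightarrow> nat) \<Rightarrow> bool" where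
  "negligible_Kblock V E N p W B \<longleftrightarrow>
     (\<lambda>n. hom_density_block V E (W n) B) \<in> o[along (Kblock_at N W V B)](\<lambda>n. p n ^ card E)"

definition small_block ::
    "nat set \<Rightarrow> (nat \<Rightarrow> real) \<Rightarrow> (nat \<Rightarrow> block_data) \<Rightarrow> nat \<Rightarrow> nat \<Rightarrow> bool" where
  "small_block N p W i j \<longleftrightarrow>
     (\<lambda>n. mS (W n) i * mS (W n) j * wt (W n) i j)
       \<in> o[along (inner_at N W i j)](\<lambda>n. inverse (ln (ln (ln (1 / p n)))) * graphon_ent (p n) (fn (W n)))"

definition important ::
    "nat set \<Rightarrow> (nat \<Rightarrow> real) \<Rightarrow> (nat \<Rightarrow> block_data) \<Rightarrow> nat \<Rightarrow> nat \<Rightarrow> nat \<Rightarrow> bool" where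
  "important N p W i j n \<longleftrightarrow> n \<in> inner_at N W i j \<and> small_block N p W i j"

definition somewhat_important ::
    "nat set \<Rightarrow> (nat \<Rightarrow> real) \<Rightarrow> (nat \<Rightarrow> block_data) \<Rightarrow> nat \<Rightarrow> nat \<Rightarrow> nat \<Rightarrow> bool" where
  "somewhat_important N p W i j n \<longleftrightarrow> important N p W i j n \<and> wt (W n) i j < 1"


section \<open>The conditions\<close>

definition cond1 :: "nat set \<Rightarrow> (nat \<Rightarrow> real) \<Rightarrow> (nat \<Rightarrow> block_data) \<Rightarrow> bool" where
  "cond1 N p W \<longleftrightarrow>
     (\<forall>\<^sub>F n in along N. \<forall>x\<in>{0..1}. (LINT y : {0..1} | lborel. fn (W n) x y) = p n)"

definition cond2 :: "nat set \<Rightarrow> (nat \<Rightarrow> real) \<Rightarrow> (nat \<Rightarrow> block_data) \<Rightarrow> bool" where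
  "cond2 N p W \<longleftrightarrow> (\<forall>\<^sub>F n in along N. mS (W n) (num (W n)) \<ge> 1 - p n)"

definition cond3 ::
    "'v set \<Rightarrow> 'v set set \<Rightarrow> nat set \<Rightarrow> (nat \<Rightarrow> real) \<Rightarrow> (nat \<Rightarrow> block_data) \<Rightarrow> bool" where
  "cond3 V E N p W \<longleftrightarrow>
     (\<exists>c>0. \<forall>\<^sub>F n in along N. hom_density V E (fn (W n)) \<ge> (1 + c) * p n ^ card E)"

definition cond4 :: "'v set set \<Rightarrow> nat set \<Rightarrow> (nat \<Rightarrow> real) \<Rightarrow> (nat \<Rightarrow> block_data) \<Rightarrow> bool" where
  "cond4 E N p W \<longleftrightarrow>
     (\<lambda>n. graphon_ent (p n) (fn (W n))) \<in> \<omega>[along N](\<lambda>n. ln (real n) / real n) \<and>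
     (\<lambda>n. graphon_ent (p n) (fn (W n))) \<in> o[along N](\<lambda>n. p n ^ (2 * card E) * real n)"

definition cond5 :: "nat set \<Rightarrow> (nat \<Rightarrow> block_data) \<Rightarrow> bool" where
  "cond5 N W \<longleftrightarrow> (\<forall>i. (\<lambda>n. mS (W n) i) \<in> \<omega>[along (index_at N W i)](\<lambda>n. 1 / real n))"

definition cond6 :: "nat set \<Rightarrow> (nat \<Rightarrow> real) \<Rightarrow> (nat \<Rightarrow> block_data) \<Rightarrow> bool" where
  "cond6 N p W \<longleftrightarrow>
     (\<forall>i j. (\<forall>\<^sub>F n in along (inner_at N W i j). wt (W n) i j \<ge> p n) \<and>
            ((\<forall>\<^sub>F n in along (inner_at N W i j). wt (W n) i j = p n) \<or> small_block N p W i j))"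

definition cond7 ::
    "'v set \<Rightarrow> 'v set set \<Rightarrow> nat set \<Rightarrow> (nat \<Rightarrow> real) \<Rightarrow> (nat \<Rightarrow> block_data) \<Rightarrow> bool" where
  "cond7 V E N p W \<longleftrightarrow>
     (\<forall>B. \<not> negligible_Kblock V E N p W B \<longrightarrow>
        (\<forall>\<^sub>F n in along (Kblock_at N W V B).
           pairwise disjnt {e \<in> E. \<exists>u v. e = {u, v} \<and> somewhat_important N p W (B u) (B v) n}))"

definition cond8 ::
    "'v set \<Rightarrow> 'v set set \<Rightarrow> nat set \<Rightarrow> (nat \<Rightarrow> real) \<Rightarrow> (nat \<Rightarrow> block_data) \<Rightarrow> bool" where
  "cond8 V E N p W \<longleftrightarrow>
     (\<forall>B u v i j. \<not> negligible_Kblock V E N p W B \<and> {u, v} \<in> E \<and> (B u, B v) = (i, j) \<longrightarrow>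
        (let F = along {n \<in> Kblock_at N W V B. \<not> important N p W i j n} in
           (\<exists>\<epsilon>. (\<epsilon> \<longlongrightarrow> 0) F \<and>
              (\<forall>\<^sub>F n in F. mS (W n) i * mS (W n) j
                            \<ge> (1 + \<epsilon> n) * (inverse (p n) * graphon_ent (p n) (fn (W n))))) \<and>
           (\<lambda>n. wt (W n) i j - p n) \<in> o[F](p)))"

definition cond9 :: "nat set \<Rightarrow> (nat \<Rightarrow> real) \<Rightarrow> (nat \<Rightarrow> block_data) \<Rightarrow> bool" where
  "cond9 N p W \<longleftrightarrow>
     (\<forall>i j. (\<lambda>n. wt (W n) i j * mS (W n) i)
              \<in> \<omega>[along {n. important N p W i j n}](\<lambda>n. ln (real n) / real n))"

definition cond10 ::
    "'v set \<Rightarrow> 'v set set \<Rightarrow> nat set \<Rightarrow> (nat \<Rightarrow> real) \<Rightarrow> (nat \<Rightarrow> block_data) \<Rightarrow> bool" where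
  "cond10 V E N p W \<longleftrightarrow>
     (\<lambda>n. hom_density V E (\<lambda>x y. fn (W n) x y + p n)) \<in> O[along N](\<lambda>n. p n ^ card E)"

end

theory Submission
  imports Defs
begin

text \<open>
  Round the block sizes \<open>m(S\<^sub>i) n\<close> and the edge counts \<open>w\<^sub>i\<^sub>j m(S\<^sub>i) m(S\<^sub>j) n\<^sup>2\<close> to integers, and let \<open>S\<close> be the set of
  \<open>d\<close>-regular graphs in which every vertex of block \<open>i\<close> has the average number of neighbours in
  block \<open>j\<close>, up to one. Among all degree matrices with given block sums the number of graphs is
  maximal at the balanced one, because moving an edge from a vertex of larger degree to one of
  smaller degree does not decrease it. As there are only \<open>exp(O(n log n))\<close> degree matrices and
  \<open>n log n = o(I\<^sub>p(W) n\<^sup>2)\<close>, the set \<open>S\<close> has, to the required precision, the size given by the entropy of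
  the block densities; dividing by the number of all \<open>d\<close>-regular graphs gives \<open>exp(-(1/2+o(1)) I\<^sub>p(W) n\<^sup>2)\<close>.

  It then suffices that the mean of \<open>Hom(K,G)\<close> over \<open>S\<close> is at least \<open>(1-o(1)) Hom(K,W) n\<^bsup>v(K)\<^esup>\<close>: since
  \<open>Hom(K,G) \<le> n\<^bsup>v(K)\<^esup>\<close>, a polynomially small fraction of \<open>S\<close> then attains almost the mean. For a
  non-negligible \<open>K\<close>-block, edges in very important blocks are always present, those in somewhat
  important blocks form a matching, whose copies can be counted in every graph of \<open>S\<close>, and each
  edge in an unimportant block is present with conditional probability at least \<open>(1-o(1)) w\<^sub>i\<^sub>j\<close>, by a
  switching argument that works because \<open>w\<^sub>i\<^sub>j = o(1)\<close>.
\<close>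

section \<open>Graphs with a prescribed block degree matrix\<close>


text \<open>No asymptotic enumeration of graphs with given degrees enters: the family is bounded
  below by a pigeonhole over degree matrices, and all d-regular graphs are bounded above by the
  graphs with d n / 2 edges. Both bounds are binomial coefficients up to a factor exp(O(n log n)),
  so a weak form of Stirling's formula suffices. Three obstacles shape the details. A very important
  block has to come out complete, not merely dense; therefore edge counts are rounded down by less
  than one edge, and the last block, larger than d, absorbs every correction including parity. In
  somewhat important blocks w may be close to 1, so switchings are of no use there and copies of the
  matching are counted in each graph separately. In unimportant blocks the bound must hold
  conditionally on any bounded set of edges being present, because the edges of a copy are added one
  at a time. At fixed accuracy \<eta> every asymptotic condition is used as an inequality with a
  constant \<Lambda>; the o(1) terms arise only at the end, by a diagonal choice of \<eta>.\<close>

definition pairs :: "'a set \<Rightarrow> 'a set set" where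
  "pairs A = {e. e \<subseteq> A \<and> card e = 2}"

definition nb :: "'a set set \<Rightarrow> 'a \<Rightarrow> 'a set" where
  "nb G u = {x. {u, x} \<in> G}"

definition nbrs :: "('a \<Rightarrow> 'b) \<Rightarrow> 'a set set \<Rightarrow> 'a \<Rightarrow> 'b \<Rightarrow> 'a set" where
  "nbrs \<beta> G u j = {x. {u, x} \<in> G \<and> \<beta> x = j}"

definition deg_graphs ::
    "'a set \<Rightarrow> 'b set \<Rightarrow> ('a \<Rightarrow> 'b) \<Rightarrow> ('a \<Rightarrow> 'b \<Rightarrow> nat) \<Rightarrow> 'a set set set" where
  "deg_graphs A J \<beta> D = {G. G \<subseteq> pairs A \<and> (\<forall>u\<in>A. \<forall>j\<in>J. card (nbrs \<beta> G u j) = D u j)}"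

lemma finite_pairs: "finite A \<Longrightarrow> finite (pairs A)"
  unfolding pairs_def by (rule finite_subset[of _ "Pow A"]) auto

lemma finite_deg_graphs: "finite A \<Longrightarrow> finite (deg_graphs A J \<beta> D)"
  unfolding deg_graphs_def by (rule finite_subset[of _ "Pow (pairs A)"]) (auto simp: finite_pairs)

lemma pairsI: "u \<in> A \<Longrightarrow> v \<in> A \<Longrightarrow> u \<noteq> v \<Longrightarrow> {u, v} \<in> pairs A"
  by (auto simp: pairs_def)

lemma pairsD: "G \<subseteq> pairs A \<Longrightarrow> {u, v} \<in> G \<Longrightarrow> u \<in> A \<and> v \<in> A \<and> u \<noteq> v"
  by (cases "u = v") (auto simp: pairs_def)

lemma card_pairs: "finite A \<Longrightarrow> card (pairs A) = card A choose 2"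
  unfolding pairs_def by (rule n_subsets)

lemma nbrs_subset: "G \<subseteq> pairs A \<Longrightarrow> nbrs \<beta> G u j \<subseteq> A"
  unfolding nbrs_def by (auto dest: pairsD)

lemma finite_nbrs: "finite A \<Longrightarrow> G \<subseteq> pairs A \<Longrightarrow> finite (nbrs \<beta> G u j)"
  using nbrs_subset finite_subset by metis

lemma nbrs_nb: "nbrs \<beta> G u j = {x \<in> nb G u. \<beta> x = j}"
  by (auto simp: nbrs_def nb_def)

text \<open>In the class of z one neighbour leaves and one enters; the other classes are untouched.
  This is the degree bookkeeping at a vertex whose neighbour is exchanged: at x in the edge move, at
  all six vertices in the switching.\<close>

lemma card_nbrs_swap:
  assumes "finite (nb G w)" and eq: "nb G' w = insert z' (nb G w - {z})"
    and z: "z \<in> nb G w" "z' \<notin> nb G w" and b: "\<beta> z = \<beta> z'"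
  shows "card (nbrs \<beta> G' w l) = card (nbrs \<beta> G w l)"
proof (cases "\<beta> z = l")
  case True
  then have "nbrs \<beta> G' w l = insert z' (nbrs \<beta> G w l - {z})"
    unfolding nbrs_nb eq using b by auto
  moreover have f: "finite (nbrs \<beta> G w l)" using assms(1) by (simp add: nbrs_nb)
  moreover have m: "z \<in> nbrs \<beta> G w l" "z' \<notin> nbrs \<beta> G w l" using True z by (simp_all add: nbrs_nb)
  moreover have "card (nbrs \<beta> G w l) > 0" using f m card_gt_0_iff by blast
  ultimately show ?thesis by simp
next
  case False
  then have "nbrs \<beta> G' w l = nbrs \<beta> G w l" unfolding nbrs_nb eq using b by auto
  then show ?thesis by simp
qed

text \<open>Effect on the degree matrix of replacing an edge ux by vx with x in block i. It is used
  with \<open>D v i < D u i\<close>, so the truncated subtraction is a genuine one.\<close>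

definition shift :: "('a \<Rightarrow> 'b \<Rightarrow> nat) \<Rightarrow> 'a \<Rightarrow> 'a \<Rightarrow> 'b \<Rightarrow> 'a \<Rightarrow> 'b \<Rightarrow> nat" where
  "shift D u v i = (\<lambda>w l. if l = i \<and> w = u then D u i - 1 else if l = i \<and> w = v then D v i + 1 else D w l)"

text \<open>Moving an edge \<open>ux\<close> to \<open>vx\<close> relates the two families of graphs; a graph of the first family
  has at least as many forward moves as each of its images has backward moves.\<close>

lemma card_deg_graphs_shift:
  assumes A: "finite A" and u: "u \<in> A" and v: "v \<in> A" and uv: "u \<noteq> v" and b: "\<beta> u = \<beta> v"
    and i: "i \<in> J" and D: "D v i < D u i"
  shows "card (deg_graphs A J \<beta> D) \<le> card (deg_graphs A J \<beta> (shift D u v i))"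
proof -
  define S where "S = deg_graphs A J \<beta> D"
  define S' where "S' = deg_graphs A J \<beta> (shift D u v i)"
  \<comment> \<open>The vertices x for which ux can be moved to vx; v is removed because uv would
    become a loop. \<open>Y\<close> exchanges the roles of u and v, so it lists the backward
    moves.\<close>
  define X where "X G = (nbrs \<beta> G u i - {v}) - (nbrs \<beta> G v i - {u})" for G
  define Y where "Y G = (nbrs \<beta> G v i - {u}) - (nbrs \<beta> G u i - {v})" for G
  define \<phi> where "\<phi> = (\<lambda>(G, x). (insert {v, x} (G - {{u, x}}), x))"
  have fS: "finite S" "finite S'" unfolding S_def S'_def using A by (auto intro: finite_deg_graphs)
  have sub: "G \<subseteq> pairs A" if "G \<in> S \<or> G \<in> S'" for G
    using that unfolding S_def S'_def deg_graphs_def by auto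
  have fin: "finite (nbrs \<beta> G w l)" if "G \<subseteq> pairs A" for G w l
    using finite_nbrs[OF A that] .
  have fX: "finite (X G)" "finite (Y G)" if "G \<subseteq> pairs A" for G
    using fin[OF that] by (auto simp: X_def Y_def)
  \<comment> \<open>The two one-sided differences of finite sets differ in size as the sets do, and
    the edge uv is deleted from both neighbourhoods or from neither.\<close>
  have bal: "card (X G) = card (Y G) + (D u i - D v i)" if G: "G \<in> S" for G
  proof -
    note f = fin[OF sub, of G] 
    have cu: "card (nbrs \<beta> G u i) = D u i" and cv: "card (nbrs \<beta> G v i) = D v i"
      using G i u v by (auto simp: S_def deg_graphs_def)
    have iff: "v \<in> nbrs \<beta> G u i \<longleftrightarrow> u \<in> nbrs \<beta> G v i"
      using b by (auto simp: nbrs_def insert_commute)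
    let ?P = "nbrs \<beta> G u i - {v}" and ?Q = "nbrs \<beta> G v i - {u}"
    have fPQ: "finite ?P" "finite ?Q" using f G by auto
    have diff: "card (P - Q) + card Q = card (P \<union> Q)" if "finite P" "finite Q" for P Q :: "'a set"
      using card_Un_disjoint[of "P - Q" Q] that by (simp add: Int_commute)
    have "card (?P - ?Q) + card ?Q = card (?P \<union> ?Q)" "card (?Q - ?P) + card ?P = card (?P \<union> ?Q)"
      using diff[OF fPQ] diff[OF fPQ(2,1)] by (simp_all add: Un_commute)
    moreover have "card ?P + D v i = card ?Q + D u i"
    proof (cases "v \<in> nbrs \<beta> G u i")
      case True
      then have "card (nbrs \<beta> G u i) > 0" "card (nbrs \<beta> G v i) > 0"
        using iff f G card_gt_0_iff by blast+
      then show ?thesis using True iff f G cu cv by simp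
    next
      case False
      then show ?thesis using iff cu cv by simp
    qed
    ultimately show ?thesis unfolding X_def Y_def using D by linarith
  qed
  have step: "fst (\<phi> (G, x)) \<in> S'" "Y (fst (\<phi> (G, x))) = insert x (Y G)" "x \<notin> Y G"
    if G: "G \<in> S" and x: "x \<in> X G" for G x
  proof -
    let ?H = "insert {v, x} (G - {{u, x}})"
    have GA: "G \<subseteq> pairs A" using G sub by auto
    have ux: "{u, x} \<in> G" "\<beta> x = i" "x \<noteq> v" using x by (auto simp: X_def nbrs_def)
    then have xA: "x \<in> A" "x \<noteq> u" using pairsD[OF GA] by auto
    have vx: "{v, x} \<notin> G" using x xA ux by (auto simp: X_def nbrs_def)
    have HA: "?H \<subseteq> pairs A" using GA pairsI[OF v xA(1)] ux by auto
    have card: "card (nbrs \<beta> ?H w l) = shift D u v i w l" if w: "w \<in> A" and l: "l \<in> J" for w l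
    proof -
      have base: "card (nbrs \<beta> G w l) = D w l" using G w l by (auto simp: S_def deg_graphs_def)
      have fw: "finite (nbrs \<beta> G w l)" using fin GA by auto
      consider "w = u" | "w = v" | "w = x" | "w \<notin> {u, v, x}" by auto
      then show ?thesis
      proof cases
        case 1
        then have "nbrs \<beta> ?H w l = nbrs \<beta> G w l - (if l = i then {x} else {})"
          using uv ux xA by (auto simp: nbrs_def doubleton_eq_iff)
        moreover have "x \<in> nbrs \<beta> G w i" using 1 ux by (auto simp: nbrs_def)
        ultimately show ?thesis using base fw 1 by (auto simp: shift_def)
      next
        case 2
        then have "nbrs \<beta> ?H w l = nbrs \<beta> G w l \<union> (if l = i then {x} else {})"
          using uv ux xA by (auto simp: nbrs_def doubleton_eq_iff)
        moreover have "x \<notin> nbrs \<beta> G w i" using 2 vx by (auto simp: nbrs_def)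
        ultimately show ?thesis using base fw 2 uv by (auto simp: shift_def)
      next
        case 3
        have fnb: "finite (nb G x)" using GA A by (auto intro!: finite_subset[of _ A] simp: nb_def dest: pairsD)
        have "card (nbrs \<beta> ?H x l) = card (nbrs \<beta> G x l)"
        proof (rule card_nbrs_swap[OF fnb, of _ v u])
          show "nb ?H x = insert v (nb G x - {u})"
            using uv ux xA vx by (auto simp: nb_def doubleton_eq_iff)
          show "u \<in> nb G x" "v \<notin> nb G x" using ux vx by (auto simp: nb_def insert_commute)
        qed (use b in simp)
        then show ?thesis using 3 base xA ux by (auto simp: shift_def)
      next
        case 4
        then have "nbrs \<beta> ?H w l = nbrs \<beta> G w l"
          by (auto simp: nbrs_def doubleton_eq_iff)
        then show ?thesis using base 4 by (auto simp: shift_def)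
      qed
    qed
    show "fst (\<phi> (G, x)) \<in> S'" using HA card by (simp add: \<phi>_def S'_def deg_graphs_def)
    show "Y (fst (\<phi> (G, x))) = insert x (Y G)"
      using uv ux xA vx by (auto simp: \<phi>_def Y_def nbrs_def doubleton_eq_iff)
    show "x \<notin> Y G" using vx by (auto simp: Y_def nbrs_def)
  qed
  have inj: "inj_on \<phi> (Sigma S X)"
  proof (rule inj_onI, clarsimp simp: \<phi>_def)
    fix G x H assume "G \<in> S" "x \<in> X G" "H \<in> S" "x \<in> X H"
      and eq: "insert {v, x} (G - {{u, x}}) = insert {v, x} (H - {{u, x}})"
    moreover have "{u, x} \<in> G \<and> {v, x} \<notin> G" if "x \<in> X G" "G \<in> S" for G
      using that pairsD[OF sub, of G u x] by (auto simp: X_def nbrs_def)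
    ultimately have *: "{u, x} \<in> G" "{v, x} \<notin> G" "{u, x} \<in> H" "{v, x} \<notin> H" by auto
    then have "G - {{u, x}} = H - {{u, x}}" using eq by (subst (asm) insert_ident) simp_all
    then show "G = H" using * by (metis insert_Diff)
  qed
  \<comment> \<open>Weighted double count. Each G spreads mass 1 evenly over its forward moves. A
    move from G to H carries \<open>1 / card (X G)\<close>, at most \<open>1 / card (Y H)\<close>,
    and H has \<open>card (Y H)\<close> backward moves, so it collects at most 1.\<close>
  have "real (card S) = (\<Sum>G\<in>S. \<Sum>x\<in>X G. 1 / real (card (X G)))"
  proof -
    have "card (X G) > 0" if "G \<in> S" for G using bal[OF that] D by simp
    then have "(\<Sum>x\<in>X G. 1 / real (card (X G))) = 1" if "G \<in> S" for G using that by fastforce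
    then show ?thesis by simp
  qed
  also have "\<dots> = (\<Sum>(G, x)\<in>Sigma S X. 1 / real (card (X G)))"
    using fS fX sub by (subst sum.Sigma) auto
  also have "\<dots> \<le> (\<Sum>z\<in>Sigma S X. 1 / real (card (Y (fst (\<phi> z)))))"
  proof (rule sum_mono, clarify)
    fix G x assume *: "G \<in> S" "x \<in> X G"
    have "card (Y (fst (\<phi> (G, x)))) = card (Y G) + 1"
      using step[OF *] fX sub * by simp
    moreover have "card (X G) \<ge> card (Y G) + 1" using bal[OF *(1)] D by simp
    ultimately show "1 / real (card (X G)) \<le> 1 / real (card (Y (fst (\<phi> (G, x)))))"
      by (simp add: frac_le)
  qed
  also have "\<dots> = (\<Sum>z\<in>\<phi> ` Sigma S X. 1 / real (card (Y (fst z))))"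
    by (simp add: sum.reindex[OF inj])
  also have "\<dots> \<le> (\<Sum>z\<in>Sigma S' Y. 1 / real (card (Y (fst z))))"
  proof (rule sum_mono2)
    show "finite (Sigma S' Y)" using fS fX sub by auto
    show "\<phi> ` Sigma S X \<subseteq> Sigma S' Y"
    proof
      fix z assume "z \<in> \<phi> ` Sigma S X"
      then obtain G x where z: "z = \<phi> (G, x)" and *: "G \<in> S" "x \<in> X G" by auto
      then have "z = (fst (\<phi> (G, x)), x)" by (simp add: \<phi>_def)
      then show "z \<in> Sigma S' Y" using step[OF *] by simp
    qed
  qed auto
  also have "\<dots> = (\<Sum>G\<in>S'. \<Sum>x\<in>Y G. 1 / real (card (Y G)))"
    using fS fX sub by (subst sum.Sigma) (auto simp: case_prod_unfold)
  also have "\<dots> \<le> (\<Sum>G\<in>S'. 1)"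
    by (intro sum_mono) simp
  finally show ?thesis unfolding S_def S'_def by simp
qed

lemma sum_eq_imp_crossing:
  fixes f g :: "'a \<Rightarrow> nat"
  assumes "finite S" "sum f S = sum g S" "w \<in> S" "f w \<noteq> g w"
  obtains u v where "u \<in> S" "v \<in> S" "f u > g u" "f v < g v"
proof -
  have "\<exists>u\<in>S. f u > g u"
  proof (rule ccontr)
    assume "\<not> ?thesis"
    then have "\<forall>u\<in>S. f u \<le> g u" "f w < g w" using assms by (auto simp: not_less le_neq_implies_less)
    then have "sum f S < sum g S" using assms by (intro sum_strict_mono_ex1) auto
    then show False using assms by simp
  qed
  moreover have "\<exists>u\<in>S. g u > f u"
  proof (rule ccontr)
    assume "\<not> ?thesis"
    then have "\<forall>u\<in>S. g u \<le> f u" "g w < f w" using assms by (auto simp: not_less le_neq_implies_less)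
    then have "sum g S < sum f S" using assms by (intro sum_strict_mono_ex1) auto
    then show False using assms by simp
  qed
  ultimately show ?thesis using that by blast
qed

text \<open>Induction on the distance of D from T, where |D u j - T u j| is written as the sum of
  both truncated differences. Equal block sums give, in a column where D and T differ, an overfull u
  and an underfull v in the same cell; moving one edge from u to v lowers the distance and does not
  lower the count.\<close>

lemma card_deg_graphs_le_balanced:
  fixes T D :: "'a \<Rightarrow> 'b \<Rightarrow> nat" and q :: "'b \<Rightarrow> 'b \<Rightarrow> nat"
  assumes A: "finite A" and J: "finite J" and \<beta>: "\<beta> ` A \<subseteq> J"
    and bal: "\<And>u j. u \<in> A \<Longrightarrow> j \<in> J \<Longrightarrow> T u j \<in> {q (\<beta> u) j, q (\<beta> u) j + 1}"
    and sums: "\<And>i j. i \<in> J \<Longrightarrow> j \<in> J \<Longrightarrow>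
       (\<Sum>u | u \<in> A \<and> \<beta> u = i. D u j) = (\<Sum>u | u \<in> A \<and> \<beta> u = i. T u j)"
  shows "card (deg_graphs A J \<beta> D) \<le> card (deg_graphs A J \<beta> T)"
  using sums
proof (induction "\<Sum>u\<in>A. \<Sum>j\<in>J. (D u j - T u j) + (T u j - D u j)" arbitrary: D rule: less_induct)
  case less
  show ?case
  proof (cases "\<forall>u\<in>A. \<forall>j\<in>J. D u j = T u j")
    case True
    then have "deg_graphs A J \<beta> D = deg_graphs A J \<beta> T" by (auto simp: deg_graphs_def)
    then show ?thesis by simp
  next
    case False
    then obtain w j where w: "w \<in> A" "j \<in> J" "D w j \<noteq> T w j" by blast
    define i where "i = \<beta> w"
    have i: "i \<in> J" using \<beta> w i_def by auto
    obtain u v where u: "u \<in> A" "\<beta> u = i" "D u j > T u j" and v: "v \<in> A" "\<beta> v = i" "D v j < T v j"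
    proof (rule sum_eq_imp_crossing[of "{u \<in> A. \<beta> u = i}" "\<lambda>u. D u j" "\<lambda>u. T u j" w])
    qed (use A w i_def less.prems[OF i w(2)] in auto)
    have uv: "u \<noteq> v" using u v by auto
    \<comment> \<open>On the cell T takes only the values q and q + 1, so D u j \<ge> q + 1 > q
      \<ge> D v j. This is where the balance of T enters.\<close>
    have lt: "D v j < D u j"
      using bal[OF u(1) w(2)] bal[OF v(1) w(2)] u v by auto
    define D' where "D' = shift D u v j"
    define c where "c D = (\<lambda>(u, j). (D u j - T u j) + (T u j - D u j))" for D
    have "sum (c D') (A \<times> J) < sum (c D) (A \<times> J)"
    proof (rule sum_strict_mono_ex1)
      show "\<forall>z\<in>A \<times> J. c D' z \<le> c D z"
        using u v uv by (auto simp: c_def D'_def shift_def)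
      show "\<exists>z\<in>A \<times> J. c D' z < c D z"
        using u w by (intro bexI[of _ "(u, j)"]) (auto simp: c_def D'_def shift_def)
    qed (use A J in auto)
    then have dec: "(\<Sum>u\<in>A. \<Sum>j\<in>J. (D' u j - T u j) + (T u j - D' u j))
        < (\<Sum>u\<in>A. \<Sum>j\<in>J. (D u j - T u j) + (T u j - D u j))"
      by (simp add: sum.cartesian_product c_def)
    have sum': "(\<Sum>u | u \<in> A \<and> \<beta> u = a. D' u b) = (\<Sum>u | u \<in> A \<and> \<beta> u = a. T u b)"
      if ab: "a \<in> J" "b \<in> J" for a b
    proof -
      let ?S = "{u \<in> A. \<beta> u = a}"
      have "(\<Sum>u\<in>?S. D' u b) = (\<Sum>u\<in>?S. D u b)"
      proof (cases "a = i \<and> b = j")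
        case True
        then have "u \<in> ?S" "v \<in> ?S - {u}" using u v uv by auto
        then have split: "sum f ?S = f u + (f v + sum f (?S - {u} - {v}))" for f :: "'a \<Rightarrow> nat"
          using A by (simp add: sum.remove)
        have "(\<Sum>w\<in>?S - {u} - {v}. D' w b) = (\<Sum>w\<in>?S - {u} - {v}. D w b)"
          by (intro sum.cong) (auto simp: D'_def shift_def)
        then show ?thesis unfolding split[of "\<lambda>u. D' u b"] split[of "\<lambda>u. D u b"]
          using True u uv by (auto simp: D'_def shift_def)
      next
        case False
        then show ?thesis using u v by (intro sum.cong) (auto simp: D'_def shift_def)
      qed
      then show ?thesis using less.prems[OF ab] by simp
    qed
    have "card (deg_graphs A J \<beta> D) \<le> card (deg_graphs A J \<beta> D')"
      unfolding D'_def using u v uv w lt A by (intro card_deg_graphs_shift) auto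
    also have "\<dots> \<le> card (deg_graphs A J \<beta> T)"
      using less.hyps[OF dec sum'] .
    finally show ?thesis .
  qed
qed


section \<open>Edges between two cells: ordered and unordered counts\<close>

definition adj :: "('a \<Rightarrow> 'b) \<Rightarrow> 'a set set \<Rightarrow> 'b \<Rightarrow> 'b \<Rightarrow> ('a \<times> 'a) set" where
  "adj \<beta> G i j = {(u, x). {u, x} \<in> G \<and> \<beta> u = i \<and> \<beta> x = j}"

definition blk :: "'a set \<Rightarrow> ('a \<Rightarrow> 'b) \<Rightarrow> 'b \<Rightarrow> 'b \<Rightarrow> 'a set set" where
  "blk A \<beta> i j = {e \<in> pairs A. \<exists>u x. e = {u, x} \<and> \<beta> u = i \<and> \<beta> x = j}"

definition cell :: "'a set \<Rightarrow> ('a \<Rightarrow> 'b) \<Rightarrow> 'b \<Rightarrow> 'a set" where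
  "cell A \<beta> i = {u \<in> A. \<beta> u = i}"

lemma finite_cell: "finite A \<Longrightarrow> finite (cell A \<beta> i)"
  by (simp add: cell_def)

lemma adj_subset: "G \<subseteq> pairs A \<Longrightarrow> adj \<beta> G i j \<subseteq> cell A \<beta> i \<times> cell A \<beta> j"
  by (auto simp: adj_def cell_def dest: pairsD)

lemma card_adj:
  assumes A: "finite A" and G: "G \<subseteq> pairs A"
  shows "card (adj \<beta> G i j) = (\<Sum>u\<in>cell A \<beta> i. card (nbrs \<beta> G u j))"
proof -
  have "adj \<beta> G i j = Sigma (cell A \<beta> i) (\<lambda>u. nbrs \<beta> G u j)"
    using pairsD[OF G] by (auto simp: adj_def nbrs_def cell_def)
  then show ?thesis using finite_nbrs[OF A G] finite_cell[OF A] by (metis card_SigmaI)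
qed

lemma card_adj_sym: "card (adj \<beta> G i j) = card (adj \<beta> G j i)"
proof (rule bij_betw_same_card[of prod.swap])
  show "bij_betw prod.swap (adj \<beta> G i j) (adj \<beta> G j i)"
    by (rule bij_betwI[of _ _ _ prod.swap]) (auto simp: adj_def insert_commute)
qed

text \<open>An edge inside a cell arises from two ordered pairs, an edge between two cells from one.
  Ordered pairs match the degree sums; hence diagonal counts are even and are halved wherever edges
  are counted.\<close>

lemma card_adj_blk:
  assumes A: "finite A" and G: "G \<subseteq> pairs A"
  shows "card (adj \<beta> G i j) = (if i = j then 2 else 1) * card (G \<inter> blk A \<beta> i j)"
proof -
  define R where "R e = {z. {fst z, snd z} = e \<and> \<beta> (fst z) = i \<and> \<beta> (snd z) = j}" for e
  have "adj \<beta> G i j = (\<Union>e\<in>G \<inter> blk A \<beta> i j. R e)"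
    using G by (auto simp: adj_def R_def blk_def; blast)
  moreover have R: "finite (R e) \<and> card (R e) = (if i = j then 2 else 1)" if "e \<in> blk A \<beta> i j" for e
  proof -
    obtain u x where e: "e = {u, x}" "\<beta> u = i" "\<beta> x = j" "e \<in> pairs A"
      using \<open>e \<in> blk A \<beta> i j\<close> by (auto simp: blk_def)
    then have "u \<noteq> x" by (auto simp: pairs_def)
    then have "R e = (if i = j then {(u, x), (x, u)} else {(u, x)})"
      using e by (auto simp: R_def doubleton_eq_iff)
    then show ?thesis using \<open>u \<noteq> x\<close> by auto
  qed
  moreover have "finite (G \<inter> blk A \<beta> i j)"
    using G finite_pairs[OF A] finite_subset by auto
  moreover have "R e \<inter> R f = {}" if "e \<noteq> f" for e f using that by (auto simp: R_def)
  ultimately have "card (adj \<beta> G i j) = (\<Sum>e\<in>G \<inter> blk A \<beta> i j. card (R e))"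
    by (simp add: card_UN_disjoint)
  also have "\<dots> = (\<Sum>e\<in>G \<inter> blk A \<beta> i j. if i = j then 2 else 1)"
    using R by (intro sum.cong) auto
  finally show ?thesis by simp
qed

text \<open>The preceding count for the complete graph on A, whose ordered pairs fill the product of
  the cells except for the diagonal when i = j.\<close>

lemma card_blk:
  assumes A: "finite A"
  shows "(if i = j then 2 else 1) * card (blk A \<beta> i j) =
    (if i = j then card (cell A \<beta> i) * (card (cell A \<beta> i) - 1) else card (cell A \<beta> i) * card (cell A \<beta> j))"
proof -
  let ?S = "cell A \<beta>"
  have "adj \<beta> (pairs A) i j = (if i = j then ?S i \<times> ?S i - (\<lambda>u. (u, u)) ` ?S i else ?S i \<times> ?S j)"
    by (auto simp: adj_def cell_def pairs_def card_2_iff doubleton_eq_iff)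
  moreover have "card (?S i \<times> ?S i - (\<lambda>u. (u, u)) ` ?S i) = card (?S i) * card (?S i) - card (?S i)"
    by (subst card_Diff_subset)
      (auto simp: finite_cell[OF A] card_cartesian_product card_image inj_on_def)
  moreover have "pairs A \<inter> blk A \<beta> i j = blk A \<beta> i j" by (auto simp: blk_def)
  ultimately show ?thesis using card_adj_blk[OF A subset_refl, of \<beta> i j]
    by (auto simp: card_cartesian_product algebra_simps diff_mult_distrib2)
qed

text \<open>Choices on disjoint pieces are independent. With the pieces \<open>blk\<close> this
  counts the graphs with a given number of edges in each block, before any condition on single
  degrees.\<close>

lemma card_prescribed_intersections:
  assumes "finite C" "\<And>c. c \<in> C \<Longrightarrow> finite (P c)" "disjoint_family_on P C"
  shows "card {G. G \<subseteq> (\<Union>c\<in>C. P c) \<and> (\<forall>c\<in>C. card (G \<inter> P c) = e c)} = (\<Prod>c\<in>C. card (P c) choose e c)"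
  using assms
proof (induction C rule: finite_induct)
  case empty
  then show ?case by simp
next
  case (insert c C)
  let ?U = "\<Union>c\<in>C. P c"
  let ?F = "{G. G \<subseteq> ?U \<and> (\<forall>c\<in>C. card (G \<inter> P c) = e c)}"
  let ?H = "{H. H \<subseteq> P c \<and> card H = e c}"
  have dis: "P c \<inter> P c' = {}" if "c' \<in> C" for c'
    using insert.prems(2) insert.hyps(2) that by (auto simp: disjoint_family_on_def)
  have "bij_betw (\<lambda>(G, H). G \<union> H) (?F \<times> ?H)
      {G. G \<subseteq> (\<Union>c\<in>insert c C. P c) \<and> (\<forall>c\<in>insert c C. card (G \<inter> P c) = e c)}"
  proof (rule bij_betwI[of _ _ _ "\<lambda>G. (G \<inter> ?U, G \<inter> P c)"], goal_cases)
    case 1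
    have *: "G \<inter> P c = {}" if "G \<subseteq> ?U" for G using that dis by auto
    have **: "H \<inter> P c' = {}" if "H \<subseteq> P c" "c' \<in> C" for H c' using that dis by auto
    show ?case
    proof (rule funcsetI)
      fix z assume "z \<in> ?F \<times> ?H"
      then obtain G H where z: "z = (G, H)"
        and a: "G \<subseteq> ?U" "H \<subseteq> P c" "\<forall>c\<in>C. card (G \<inter> P c) = e c" "card H = e c" by auto
      have "(G \<union> H) \<inter> P c = H" using a *[of G] by auto
      moreover have "(G \<union> H) \<inter> P c' = G \<inter> P c'" if "c' \<in> C" for c'
        using a **[of H c'] that by auto
      ultimately show "(case z of (G, H) \<Rightarrow> G \<union> H)
          \<in> {G. G \<subseteq> (\<Union>c\<in>insert c C. P c) \<and> (\<forall>c\<in>insert c C. card (G \<inter> P c) = e c)}"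
        using a z by auto
    qed
  next
    case 2
    show ?case
    proof (rule funcsetI)
      fix G assume "G \<in> {G. G \<subseteq> (\<Union>c\<in>insert c C. P c) \<and> (\<forall>c\<in>insert c C. card (G \<inter> P c) = e c)}"
      moreover have "G \<inter> ?U \<inter> P c' = G \<inter> P c'" if "c' \<in> C" for c' using that by auto
      ultimately show "(G \<inter> ?U, G \<inter> P c) \<in> ?F \<times> ?H" by simp
    qed
  next
    case (3 x) then show ?case using dis by (auto simp: disjoint_iff) 
  next
    case (4 G) then show ?case by auto
  qed
  then have "card {G. G \<subseteq> (\<Union>c\<in>insert c C. P c) \<and> (\<forall>c\<in>insert c C. card (G \<inter> P c) = e c)}
      = card ?F * card ?H"
    by (simp add: bij_betw_same_card[symmetric] card_cartesian_product)
  also have "card ?F = (\<Prod>c\<in>C. card (P c) choose e c)"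
    using insert by (intro insert.IH) (auto simp: disjoint_family_on_def)
  also have "card ?H = (card (P c) choose e c)"
    using insert.prems by (intro n_subsets) auto
  finally show ?case using insert.hyps by (simp add: mult.commute)
qed

text \<open>Hermite's identity at the fraction y / s, with r reversed to s - 1 - r. In the
  induction, raising y by one shifts the window of numerators and trades y div s for (y + s) div
  s.\<close>

lemma sum_div_shift:
  fixes y s :: nat
  assumes "s > 0"
  shows "(\<Sum>r<s. (y + s - 1 - r) div s) = y"
proof -
  have "(\<Sum>r<s. (y + r) div s) = y"
  proof (induction y)
    case (Suc y)
    have "(\<Sum>r<s. (Suc y + r) div s) + y div s = (\<Sum>r<Suc s. (y + r) div s)"
      by (subst sum.lessThan_Suc_shift) simp
    also have "\<dots> = y + (y + s) div s" using Suc by simp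
    finally show ?case using assms by simp
  qed simp
  moreover have "(\<Sum>r<s. (y + r) div s) = (\<Sum>r<s. (y + s - 1 - r) div s)"
    by (subst sum.nat_diff_reindex[symmetric]) (intro sum.cong, auto intro: arg_cong[where f = "\<lambda>x. x div s"])
  ultimately show ?thesis by simp
qed

text \<open>Distribute \<open>s d\<close> consecutive half-edges, grouped by the target \<open>j\<close>, cyclically among the
  \<open>s\<close> vertices.\<close>

lemma balanced_rows:
  fixes S :: "'a set" and M :: "nat \<Rightarrow> nat"
  assumes S: "finite S" "S \<noteq> {}" and M: "(\<Sum>j=1..k. M j) = card S * d"
  shows "\<exists>T. (\<forall>u\<in>S. (\<Sum>j=1..k. T u j) = d) \<and> (\<forall>j\<in>{1..k}. (\<Sum>u\<in>S. T u j) = M j) \<and>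
    (\<forall>u\<in>S. \<forall>j\<in>{1..k}. T u j \<in> {M j div card S, M j div card S + 1})"
proof -
  define s where "s = card S"
  have s: "s > 0" using S by (simp add: s_def card_gt_0_iff)
  obtain h where h: "bij_betw h S {..<s}"
    using ex_bij_betw_finite_nat[OF S(1)] by (auto simp: s_def atLeast0LessThan)
  \<comment> \<open>The half-edges are numbered, those with target j starting at \<open>E j\<close>,
    and vertex number r receives the numbers congruent to r modulo s. So \<open>g r j\<close>, which
    is (E j - r) / s rounded up, counts those of them below \<open>E j\<close>, and \<open>T\<close>
    is an increment of \<open>g\<close>.\<close>
  define E where "E j = (\<Sum>l=1..<j. M l)" for j
  define g where "g r j = (E j + s - 1 - r) div s" for r j
  define T where "T u j = g (h u) (Suc j) - g (h u) j" for u j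
  have E: "E (Suc j) = E j + M j" if "j \<ge> 1" for j using that by (simp add: E_def)
  have mono: "g r j \<le> g r (Suc j)" if "j \<ge> 1" for r j
    unfolding g_def using E[OF that] by (intro div_le_mono) simp
  have hs: "h u < s" if "u \<in> S" for u using h that by (auto simp: bij_betw_def)
  have tele: "(\<Sum>j=1..l. g r (Suc j) - g r j) + g r 1 = g r (Suc l)" for r l
  proof (induction l)
    case (Suc l)
    then show ?case using mono[of "Suc l" r] by simp
  qed simp
  have E1: "E (Suc 0) = 0" by (simp add: E_def)
  have Ek: "E (Suc k) = s * d" using M by (simp add: E_def s_def atLeastLessThanSuc_atLeastAtMost)
  have "(\<Sum>j=1..k. T u j) = d" if "u \<in> S" for u
  proof -
    have "g (h u) 1 = 0" using hs[OF that] by (simp add: g_def E1)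
    moreover have "g (h u) (Suc k) = d"
    proof -
      have "s * d + s - 1 - h u = (s - 1 - h u) + d * s" using hs[OF that] by (simp add: mult.commute)
      moreover have "(s - 1 - h u + d * s) div s = d + (s - 1 - h u) div s"
        using s by (intro div_mult_self1) simp
      moreover have "(s - 1 - h u) div s = 0" using s by (intro div_less) simp
      ultimately show ?thesis unfolding g_def Ek by simp
    qed
    ultimately show ?thesis using tele[of "h u" k] by (simp add: T_def)
  qed
  moreover have "(\<Sum>u\<in>S. T u j) = M j" if "j \<in> {1..k}" for j
  proof -
    have "(\<Sum>u\<in>S. T u j) = (\<Sum>r<s. g r (Suc j) - g r j)"
      unfolding T_def using sum.reindex_bij_betw[OF h, of "\<lambda>r. g r (Suc j) - g r j"] by simp
    also have "\<dots> = (\<Sum>r<s. g r (Suc j)) - (\<Sum>r<s. g r j)"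
      using mono that by (intro sum_subtractf_nat) auto
    also have "\<dots> = M j" unfolding g_def sum_div_shift[OF s] using E that by simp
    finally show ?thesis .
  qed
  moreover have "T u j \<in> {M j div s, M j div s + 1}" if "u \<in> S" "j \<in> {1..k}" for u j
  proof -
    define y where "y = E j + s - 1 - h u"
    have "E (Suc j) + s - 1 - h u = y + M j" using E[of j] hs[OF that(1)] that by (simp add: y_def)
    then have "T u j = (y + M j) div s - y div s" by (simp add: T_def g_def y_def)
    moreover have "(y + M j) div s = y div s + M j div s + (y mod s + M j mod s) div s"
      by (rule div_add1_eq)
    moreover have "(y mod s + M j mod s) div s \<le> 1"
    proof -
      have "y mod s + M j mod s < 2 * s" using s by (simp add: add_strict_mono mult_2)
      then show ?thesis using less_mult_imp_div_less[of _ 2 s] by fastforce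
    qed
    ultimately show ?thesis by auto
  qed
  ultimately show ?thesis unfolding s_def by (intro exI[of _ T]) blast
qed


text \<open>The product on the left counts the graphs with the prescribed number of edges in every
  block. They are sorted by degree matrix: its entries lie in \<open>{0..card A}\<close>, which
  gives the factor on the right, and no matrix occurs more often than the balanced T.\<close>

lemma prod_choose_le_deg_graphs:
  fixes A :: "'a set" and \<beta> :: "'a \<Rightarrow> nat" and M :: "nat \<Rightarrow> nat \<Rightarrow> nat"
  assumes A: "finite A" and \<beta>: "\<beta> ` A \<subseteq> {1..k}"
    and ne: "\<And>i. i \<in> {1..k} \<Longrightarrow> cell A \<beta> i \<noteq> {}"
    and sym: "\<And>i j. i \<in> {1..k} \<Longrightarrow> j \<in> {1..k} \<Longrightarrow> M i j = M j i"
    and ev: "\<And>i. i \<in> {1..k} \<Longrightarrow> even (M i i)"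
    and rows: "\<And>i. i \<in> {1..k} \<Longrightarrow> (\<Sum>j=1..k. M i j) = card (cell A \<beta> i) * d"
  obtains T where "\<And>u. u \<in> A \<Longrightarrow> (\<Sum>j=1..k. T u j) = d"
    and "\<And>i j. i \<in> {1..k} \<Longrightarrow> j \<in> {1..k} \<Longrightarrow> (\<Sum>u\<in>cell A \<beta> i. T u j) = M i j"
    and "\<And>u j. u \<in> A \<Longrightarrow> j \<in> {1..k} \<Longrightarrow>
      T u j \<in> {M (\<beta> u) j div card (cell A \<beta> (\<beta> u)), M (\<beta> u) j div card (cell A \<beta> (\<beta> u)) + 1}"
    and "(\<Prod>(i, j)\<in>{(i, j). 1 \<le> i \<and> i \<le> j \<and> j \<le> k}.
        card (blk A \<beta> i j) choose (if i = j then M i j div 2 else M i j))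
      \<le> (card A + 1) ^ (card A * k) * card (deg_graphs A {1..k} \<beta> T)"
proof -
  let ?S = "cell A \<beta>" and ?J = "{1..k}"
  have "\<forall>i\<in>?J. \<exists>T. (\<forall>u\<in>?S i. (\<Sum>j=1..k. T u j) = d) \<and> (\<forall>j\<in>?J. (\<Sum>u\<in>?S i. T u j) = M i j) \<and>
    (\<forall>u\<in>?S i. \<forall>j\<in>?J. T u j \<in> {M i j div card (?S i), M i j div card (?S i) + 1})"
    using balanced_rows[OF finite_cell[OF A] ne rows] by blast
  then obtain T0 where T0: "\<And>i u. i \<in> ?J \<Longrightarrow> u \<in> ?S i \<Longrightarrow> (\<Sum>j=1..k. T0 i u j) = d"
    "\<And>i j. i \<in> ?J \<Longrightarrow> j \<in> ?J \<Longrightarrow> (\<Sum>u\<in>?S i. T0 i u j) = M i j"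
    "\<And>i u j. i \<in> ?J \<Longrightarrow> u \<in> ?S i \<Longrightarrow> j \<in> ?J \<Longrightarrow>
      T0 i u j \<in> {M i j div card (?S i), M i j div card (?S i) + 1}"
    unfolding bchoice_iff by blast
  define T where "T u j = T0 (\<beta> u) u j" for u j
  have in_cell: "\<beta> u \<in> ?J \<and> u \<in> ?S (\<beta> u)" if "u \<in> A" for u
    using \<beta> that by (auto simp: cell_def)
  have T1: "(\<Sum>j=1..k. T u j) = d" if "u \<in> A" for u
    using T0(1) in_cell[OF that] by (simp add: T_def)
  have T2: "(\<Sum>u\<in>?S i. T u j) = M i j" if "i \<in> ?J" "j \<in> ?J" for i j
  proof -
    have "(\<Sum>u\<in>?S i. T u j) = (\<Sum>u\<in>?S i. T0 i u j)"
      by (intro sum.cong) (auto simp: T_def cell_def)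
    then show ?thesis using T0(2) that by simp
  qed
  have T3: "T u j \<in> {M (\<beta> u) j div card (?S (\<beta> u)), M (\<beta> u) j div card (?S (\<beta> u)) + 1}"
    if "u \<in> A" "j \<in> ?J" for u j
    using T0(3) in_cell[OF that(1)] that(2) unfolding T_def by blast
  define C where "C = {(i, j). 1 \<le> i \<and> i \<le> j \<and> j \<le> k}"
  define P where "P = (\<lambda>(i, j). blk A \<beta> i j)"
  define e where "e = (\<lambda>(i, j). if i = j then M i j div 2 else M i j)"
  define \<G> where "\<G> = {G. G \<subseteq> (\<Union>c\<in>C. P c) \<and> (\<forall>c\<in>C. card (G \<inter> P c) = e c)}"
  have fC: "finite C"
    unfolding C_def by (rule finite_subset[of _ "?J \<times> ?J"]) auto
  have fP: "finite (P c)" for c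
    using finite_pairs[OF A] by (cases c) (auto simp: P_def blk_def)
  have dis: "disjoint_family_on P C"
    by (auto simp: disjoint_family_on_def P_def blk_def C_def doubleton_eq_iff)
  have U: "(\<Union>c\<in>C. P c) \<subseteq> pairs A" by (auto simp: P_def blk_def)
  have "(\<Prod>c\<in>C. card (P c) choose e c) = card \<G>"
    unfolding \<G>_def using card_prescribed_intersections[OF fC fP dis] by simp
  also have "\<dots> \<le> (card A + 1) ^ (card A * k) * card (deg_graphs A ?J \<beta> T)"
  proof -
    \<comment> \<open>Candidate matrices, realisable or not; the block sums M are all that the
      comparison with the balanced matrix asks for.\<close>
    define \<D> where "\<D> = {D \<in> A \<times> ?J \<rightarrow>\<^sub>E {0..card A}. \<forall>i\<in>?J. \<forall>j\<in>?J. (\<Sum>u\<in>?S i. D (u, j)) = M i j}"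
    have sub: "\<G> \<subseteq> (\<Union>D\<in>\<D>. deg_graphs A ?J \<beta> (curry D))"
    proof
      fix G assume G: "G \<in> \<G>"
      then have GA: "G \<subseteq> pairs A" using U by (auto simp: \<G>_def)
      define D where "D = restrict (\<lambda>(u, j). card (nbrs \<beta> G u j)) (A \<times> ?J)"
      have le: "card (nbrs \<beta> G u j) \<le> card A" for u j
        using nbrs_subset[OF GA] A card_mono by metis
      have M: "card (adj \<beta> G i j) = M i j" if "i \<in> ?J" "j \<in> ?J" "i \<le> j" for i j
      proof -
        have "card (G \<inter> P (i, j)) = e (i, j)" using G that by (auto simp: \<G>_def C_def)
        then show ?thesis using card_adj_blk[OF A GA, of \<beta> i j] ev[of i] that
          by (auto simp: P_def e_def)
      qed
      have M': "card (adj \<beta> G i j) = M i j" if "i \<in> ?J" "j \<in> ?J" for i j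
        using M[of i j] M[of j i] that sym[of i j] card_adj_sym[of \<beta> G i j] by (cases "i \<le> j") auto
      have "(\<Sum>u\<in>?S i. D (u, j)) = M i j" if "i \<in> ?J" "j \<in> ?J" for i j
      proof -
        have "(\<Sum>u\<in>?S i. D (u, j)) = (\<Sum>u\<in>?S i. card (nbrs \<beta> G u j))"
          using that by (intro sum.cong) (auto simp: D_def cell_def)
        then show ?thesis using M' that card_adj[OF A GA, of \<beta> i j] by simp
      qed
      then have "D \<in> \<D>" using le by (auto simp: \<D>_def D_def split: if_splits)
      moreover have "G \<in> deg_graphs A ?J \<beta> (curry D)"
        using GA by (auto simp: deg_graphs_def D_def)
      ultimately show "G \<in> (\<Union>D\<in>\<D>. deg_graphs A ?J \<beta> (curry D))" by blast
    qed
    have f\<D>: "finite (A \<times> ?J \<rightarrow>\<^sub>E {0..card A})" using A by (intro finite_PiE) auto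
    then have f\<D>': "finite \<D>" unfolding \<D>_def by simp
    have "card \<G> \<le> card (\<Union>D\<in>\<D>. deg_graphs A ?J \<beta> (curry D))"
      using f\<D>' finite_deg_graphs[OF A] by (intro card_mono sub) auto
    also have "\<dots> \<le> (\<Sum>D\<in>\<D>. card (deg_graphs A ?J \<beta> (curry D)))"
      using f\<D>' by (rule card_UN_le)
    also have "\<dots> \<le> (\<Sum>D\<in>\<D>. card (deg_graphs A ?J \<beta> T))"
    proof (rule sum_mono)
      fix D assume D: "D \<in> \<D>"
      show "card (deg_graphs A ?J \<beta> (curry D)) \<le> card (deg_graphs A ?J \<beta> T)"
      proof (rule card_deg_graphs_le_balanced[OF A _ \<beta>, where q = "\<lambda>i j. M i j div card (?S i)"])
        show "T u j \<in> {M (\<beta> u) j div card (?S (\<beta> u)), M (\<beta> u) j div card (?S (\<beta> u)) + 1}"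
          if "u \<in> A" "j \<in> ?J" for u j using T3[OF that] .
        show "(\<Sum>u | u \<in> A \<and> \<beta> u = i. curry D u j) = (\<Sum>u | u \<in> A \<and> \<beta> u = i. T u j)"
          if "i \<in> ?J" "j \<in> ?J" for i j
          using D T2[OF that] that by (auto simp: \<D>_def cell_def)
      qed simp
    qed
    also have "\<dots> = card \<D> * card (deg_graphs A ?J \<beta> T)" by simp
    also have "\<dots> \<le> (card A + 1) ^ (card A * k) * card (deg_graphs A ?J \<beta> T)"
    proof (rule mult_right_mono)
      have "card \<D> \<le> card (A \<times> ?J \<rightarrow>\<^sub>E {0..card A})"
        using f\<D> by (intro card_mono) (auto simp: \<D>_def)
      also have "\<dots> = (card A + 1) ^ (card A * k)"
        using A by (subst card_PiE) (auto simp: card_cartesian_product)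
      finally show "card \<D> \<le> (card A + 1) ^ (card A * k)" .
    qed simp
    finally show ?thesis .
  qed
  finally have "(\<Prod>(i, j)\<in>C. card (blk A \<beta> i j) choose (if i = j then M i j div 2 else M i j))
      \<le> (card A + 1) ^ (card A * k) * card (deg_graphs A {1..k} \<beta> T)"
    by (simp add: P_def e_def case_prod_unfold)
  then show ?thesis using that[of T] T1 T2 T3 unfolding C_def by blast
qed

lemma card_edges_at:
  assumes A: "finite A" and G: "G \<in> deg_graphs A J \<beta> T" and J: "finite J" "\<beta> ` A \<subseteq> J" and u: "u \<in> A"
  shows "card {e \<in> G. u \<in> e} = (\<Sum>j\<in>J. T u j)"
proof -
  have GA: "G \<subseteq> pairs A" using G by (simp add: deg_graphs_def)
  have "bij_betw (\<lambda>x. {u, x}) (nb G u) {e \<in> G. u \<in> e}"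
    unfolding bij_betw_def
  proof
    show "inj_on (\<lambda>x. {u, x}) (nb G u)" by (auto simp: inj_on_def doubleton_eq_iff)
    show "(\<lambda>x. {u, x}) ` nb G u = {e \<in> G. u \<in> e}"
    proof
      show "{e \<in> G. u \<in> e} \<subseteq> (\<lambda>x. {u, x}) ` nb G u"
      proof
        fix e assume e: "e \<in> {e \<in> G. u \<in> e}"
        then have "card e = 2" using GA by (auto simp: pairs_def)
        then obtain a b where "e = {a, b}" by (auto simp: card_2_iff)
        then have "e = {u, b} \<or> e = {u, a}" using e by auto
        then show "e \<in> (\<lambda>x. {u, x}) ` nb G u" using e by (auto simp: nb_def)
      qed
    qed (auto simp: nb_def)
  qed
  then have "card {e \<in> G. u \<in> e} = card (nb G u)" by (rule bij_betw_same_card[symmetric])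
  also have "nb G u = (\<Union>j\<in>J. nbrs \<beta> G u j)"
    using J(2) pairsD[OF GA] by (fastforce simp: nbrs_nb nb_def)
  also have "card \<dots> = (\<Sum>j\<in>J. card (nbrs \<beta> G u j))"
    using J finite_nbrs[OF A GA] by (intro card_UN_disjoint) (auto simp: nbrs_def)
  also have "\<dots> = (\<Sum>j\<in>J. T u j)" using G u by (intro sum.cong) (auto simp: deg_graphs_def)
  finally show ?thesis .
qed

section \<open>Switchings\<close>


lemma card_Sigma_ge:
  assumes "finite X" "\<And>x. x \<in> X \<Longrightarrow> finite (B x)" "c1 \<le> card X" "\<And>x. x \<in> X \<Longrightarrow> c2 \<le> card (B x)"
  shows "c1 * c2 \<le> card (Sigma X B)"
proof -
  have "c1 * c2 \<le> card X * c2" using assms by simp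
  also have "\<dots> \<le> (\<Sum>x\<in>X. card (B x))" using assms sum_mono[of X "\<lambda>_. c2" "\<lambda>x. card (B x)"] by simp
  also have "\<dots> = card (Sigma X B)" using assms by simp
  finally show ?thesis .
qed

text \<open>The switching removes \<open>ux\<close>, \<open>yv\<close>, \<open>ab\<close> and inserts \<open>uv\<close>, \<open>ax\<close>, \<open>yb\<close>. The third
  removed edge \<open>ab\<close> makes it unnecessary to control the edges between the neighbourhoods of \<open>u\<close>
  and \<open>v\<close>.\<close>

lemma card_switching:
  fixes A :: "'a set" and J :: "'b set" and \<beta> :: "'a \<Rightarrow> 'b" and T :: "'a \<Rightarrow> 'b \<Rightarrow> nat"
  defines "S \<equiv> deg_graphs A J \<beta> T"
  assumes A: "finite A" and u: "u \<in> A" "\<beta> u = i" and v: "v \<in> A" "\<beta> v = j" and uv: "u \<noteq> v"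
    and ij: "i \<in> J" "j \<in> J" and F: "finite F" "card F \<le> t"
    and \<Delta>1: "\<And>w. w \<in> cell A \<beta> i \<Longrightarrow> T w j \<le> \<Delta>1" and \<Delta>2: "\<And>w. w \<in> cell A \<beta> j \<Longrightarrow> T w i \<le> \<Delta>2"
    and M: "(\<Sum>w\<in>cell A \<beta> i. T w j) = M"
  shows "card {G \<in> S. F \<subseteq> G \<and> {u, v} \<notin> G} *
      ((T u j - t) * ((T v i - (t + 1)) * (M - (2 * t + 4 * \<Delta>1 + 4 * \<Delta>2 + 2 * \<Delta>1 * \<Delta>2))))
    \<le> card {G \<in> S. F \<subseteq> G \<and> {u, v} \<in> G} * (M * M)"
proof -
  define SA where "SA = {G \<in> S. F \<subseteq> G \<and> {u, v} \<notin> G}"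
  define SB where "SB = {G \<in> S. F \<subseteq> G \<and> {u, v} \<in> G}"
  have GA: "G \<subseteq> pairs A" if "G \<in> S" for G using that by (simp add: S_def deg_graphs_def)
  have deg: "card (nbrs \<beta> G w l) = T w l" if "G \<in> S" "w \<in> A" "l \<in> J" for G w l
    using that by (simp add: S_def deg_graphs_def)
  have fS: "finite S" unfolding S_def using A by (rule finite_deg_graphs)
  have fn: "finite (nbrs \<beta> G w l)" if "G \<in> S" for G w l using finite_nbrs[OF A GA[OF that]] .
  have fnb: "finite (nb G w)" if "G \<in> S" for G w
    using pairsD[OF GA[OF that]] by (intro finite_subset[OF _ A]) (auto simp: nb_def)
  have cadj: "card (adj \<beta> G i j) = M" "finite (adj \<beta> G i j)" if "G \<in> S" for G
  proof -
    have "card (adj \<beta> G i j) = (\<Sum>w\<in>cell A \<beta> i. T w j)"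
      unfolding card_adj[OF A GA[OF that]]
      using deg[OF that] ij by (intro sum.cong) (auto simp: cell_def)
    then show "card (adj \<beta> G i j) = M" using M by simp
    show "finite (adj \<beta> G i j)"
      using adj_subset[OF GA[OF that]] by (rule finite_subset) (simp add: finite_cell[OF A])
  qed
  \<comment> \<open>All three removed edges avoid F, so the switched graph still contains F.\<close>
  define X where "X G = {x \<in> nbrs \<beta> G u j. {u, x} \<notin> F}" for G
  define Y where "Y G x = {y \<in> nbrs \<beta> G v i. {v, y} \<notin> F \<and> y \<noteq> x}" for G x
  define Q where "Q G x y = {(a, b) \<in> adj \<beta> G i j. {a, b} \<notin> F \<and>
      a \<notin> {u, v, x, y} \<and> b \<notin> {u, v, x, y} \<and> {a, x} \<notin> G \<and> {y, b} \<notin> G}" for G x y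
  define Z where "Z G = Sigma (X G) (\<lambda>x. Sigma (Y G x) (\<lambda>y. Q G x y))" for G
  \<comment> \<open>The image keeps the two inserted edges ax and yb as ordered pairs in
    \<open>adj \<beta> H i j\<close>, a set of size M, where H is the new graph. Together with u and
    v they determine the removed edges and hence G, so each H arises at most M * M times.\<close>
  define \<psi> where "\<psi> = (\<lambda>(G, x, y, a, b).
      (insert {u, v} (insert {a, x} (insert {y, b} (G - {{u, x}, {v, y}, {a, b}}))), (a, x), (y, b)))"
  \<comment> \<open>At most t of the edges at a given vertex lie in F. For y one further choice is
    lost to y = x, which can happen when i = j.\<close>
  define cx where "cx = T u j - t"
  define cy where "cy = T v i - (t + 1)"
  \<comment> \<open>Losses among the pairs (a, b): 2 t from F, 4 \<Delta>1 and 4 \<Delta>2 with a or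
    b among u, v, x, y, and \<Delta>1 \<Delta>2 twice, for a adjacent to x and for b adjacent to y.
    These are the sets \<open>B0\<close> to \<open>B4\<close> below.\<close>
  define cq where "cq = M - (2 * t + 4 * \<Delta>1 + 4 * \<Delta>2 + 2 * \<Delta>1 * \<Delta>2)"
  have Zlow: "finite (Z G) \<and> cx * (cy * cq) \<le> card (Z G)" if G: "G \<in> SA" for G
  proof -
    have GS: "G \<in> S" using G by (simp add: SA_def)
    have near: "card {x \<in> N. {w, x} \<in> F} \<le> t" "finite {x \<in> N. {w, x} \<in> F}" for N :: "'a set" and w
    proof -
      have inj: "inj_on (\<lambda>x. {w, x}) {x \<in> N. {w, x} \<in> F}" by (auto simp: inj_on_def doubleton_eq_iff)
      have sub: "(\<lambda>x. {w, x}) ` {x \<in> N. {w, x} \<in> F} \<subseteq> F" by auto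
      show "card {x \<in> N. {w, x} \<in> F} \<le> t" using card_inj_on_le[OF inj sub F(1)] F(2) by simp
      show "finite {x \<in> N. {w, x} \<in> F}" using inj_on_finite[OF inj sub F(1)] .
    qed
    have cX: "finite (X G)" "cx \<le> card (X G)"
    proof -
      have "X G = nbrs \<beta> G u j - {x \<in> nbrs \<beta> G u j. {u, x} \<in> F}" by (auto simp: X_def)
      then have "card (nbrs \<beta> G u j) - card {x \<in> nbrs \<beta> G u j. {u, x} \<in> F} \<le> card (X G)"
        using diff_card_le_card_Diff[OF near(2)[of "nbrs \<beta> G u j" u], of "nbrs \<beta> G u j"] by simp
      then show "cx \<le> card (X G)" using near(1)[of "nbrs \<beta> G u j" u] deg[OF GS u(1) ij(2)] by (simp add: cx_def)
      show "finite (X G)" using fn[OF GS] by (simp add: X_def)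
    qed
    have cY: "finite (Y G x)" "cy \<le> card (Y G x)" for x
    proof -
      let ?N = "{y \<in> nbrs \<beta> G v i. {v, y} \<in> F}"
      have "Y G x = nbrs \<beta> G v i - insert x ?N" by (auto simp: Y_def)
      then have "card (nbrs \<beta> G v i) - card (insert x ?N) \<le> card (Y G x)"
        using diff_card_le_card_Diff[of "insert x ?N" "nbrs \<beta> G v i"] near(2)[of "nbrs \<beta> G v i" v] by simp
      moreover have "card (insert x ?N) \<le> t + 1"
        using near(1)[of "nbrs \<beta> G v i" v] near(2)[of "nbrs \<beta> G v i" v] by (simp add: card_insert_if)
      ultimately show "cy \<le> card (Y G x)" using deg[OF GS v(1) ij(1)] by (simp add: cy_def)
      show "finite (Y G x)" using fn[OF GS] by (simp add: Y_def)
    qed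
    have cQ: "finite (Q G x y)" "cq \<le> card (Q G x y)" if x: "x \<in> X G" and y: "y \<in> Y G x" for x y
    proof -
      let ?R = "adj \<beta> G i j"
      have xA: "x \<in> A" "\<beta> x = j" and yA: "y \<in> A" "\<beta> y = i"
        using x y pairsD[OF GA[OF GS]] by (auto simp: X_def Y_def nbrs_def)
      define B0 where "B0 = {(a, b). {a, b} \<in> F \<inter> G}"
      define B1 where "B1 = Sigma ({u, v, x, y} \<inter> cell A \<beta> i) (\<lambda>a. nbrs \<beta> G a j)"
      define B2 where "B2 = prod.swap ` Sigma ({u, v, x, y} \<inter> cell A \<beta> j) (\<lambda>b. nbrs \<beta> G b i)"
      define B3 where "B3 = Sigma (nbrs \<beta> G x i) (\<lambda>a. nbrs \<beta> G a j)"
      define B4 where "B4 = prod.swap ` Sigma (nbrs \<beta> G y j) (\<lambda>b. nbrs \<beta> G b i)"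
      have nA: "nbrs \<beta> G w l \<subseteq> cell A \<beta> l" for w l
        using pairsD[OF GA[OF GS]] by (auto simp: nbrs_def cell_def)
      have d1: "card (nbrs \<beta> G w j) \<le> \<Delta>1" if "w \<in> cell A \<beta> i" for w
        using that deg[OF GS _ ij(2)] \<Delta>1 by (auto simp: cell_def)
      have d2: "card (nbrs \<beta> G w i) \<le> \<Delta>2" if "w \<in> cell A \<beta> j" for w
        using that deg[OF GS _ ij(1)] \<Delta>2 by (auto simp: cell_def)
      have c4: "card ({u, v, x, y} \<inter> P) \<le> 4" for P
        by (rule order_trans[OF card_mono[of "{u, v, x, y}"]]) (auto simp: card_insert_if)
      have b0: "finite B0" "card B0 \<le> 2 * t"
      proof -
        have B0: "B0 = (\<Union>e\<in>F \<inter> G. {(a, b). {a, b} = e})" by (auto simp: B0_def)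
        have e2: "finite {(a, b). {a, b} = e} \<and> card {(a, b). {a, b} = e} \<le> 2" if "e \<in> F \<inter> G" for e
        proof -
          have "card e = 2" using that GA[OF GS] by (auto simp: pairs_def)
          then obtain a b where e: "e = {a, b}" by (auto simp: card_2_iff)
          have *: "{(a, b). {a, b} = e} = {(a, b), (b, a)}" by (auto simp: e doubleton_eq_iff)
          show ?thesis unfolding * by (cases "a = b") simp_all
        qed
        show "finite B0" unfolding B0 using F e2 by blast
        have "card B0 \<le> (\<Sum>e\<in>F \<inter> G. card {(a, b). {a, b} = e})"
          unfolding B0 using F by (intro card_UN_le) auto
        also have "\<dots> \<le> (\<Sum>e\<in>F \<inter> G. 2)" using e2 by (intro sum_mono) auto
        also have "\<dots> \<le> 2 * t" using F card_mono[of F "F \<inter> G"] by auto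
        finally show "card B0 \<le> 2 * t" .
      qed
      have le: "finite (Sigma P N) \<and> card (Sigma P N) \<le> p * q"
        if "finite P" "card P \<le> p" "\<And>w. w \<in> P \<Longrightarrow> finite (N w)" "\<And>w. w \<in> P \<Longrightarrow> card (N w) \<le> q"
        for P :: "'a set" and N :: "'a \<Rightarrow> 'a set" and p q
      proof -
        have "card (Sigma P N) = (\<Sum>w\<in>P. card (N w))" using that by simp
        also have "\<dots> \<le> (\<Sum>w\<in>P. q)" using that by (intro sum_mono) auto
        also have "\<dots> \<le> p * q" using that by simp
        finally show ?thesis using that by auto
      qed
      have b1: "finite B1 \<and> card B1 \<le> 4 * \<Delta>1"
        unfolding B1_def by (rule le[OF _ c4 fn[OF GS] d1]) auto
      have b2: "finite B2 \<and> card B2 \<le> 4 * \<Delta>2"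
        unfolding B2_def using le[of "{u, v, x, y} \<inter> cell A \<beta> j" 4 "\<lambda>b. nbrs \<beta> G b i" \<Delta>2] c4 d2 fn[OF GS]
        by (auto simp: card_image)
      have b3: "finite B3 \<and> card B3 \<le> \<Delta>2 * \<Delta>1"
        unfolding B3_def using d1 d2[of x] xA nA fn[OF GS] by (intro le) (auto simp: cell_def)
      have b4: "finite B4 \<and> card B4 \<le> \<Delta>1 * \<Delta>2"
        unfolding B4_def using le[of "nbrs \<beta> G y j" \<Delta>1 "\<lambda>b. nbrs \<beta> G b i" \<Delta>2] d1[of y] d2 nA yA fn[OF GS]
        by (auto simp: card_image cell_def)
      have Qsup: "?R - (B0 \<union> B1 \<union> B2 \<union> B3 \<union> B4) \<subseteq> Q G x y"
      proof
        fix z assume "z \<in> ?R - (B0 \<union> B1 \<union> B2 \<union> B3 \<union> B4)"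
        then obtain a b where z: "z = (a, b)" and ab: "(a, b) \<in> ?R"
          and n: "(a, b) \<notin> B0 \<union> B1 \<union> B2 \<union> B3 \<union> B4" by (cases z) auto
        have abG: "{a, b} \<in> G" "\<beta> a = i" "\<beta> b = j" "a \<in> A" "b \<in> A"
          using ab pairsD[OF GA[OF GS]] by (auto simp: adj_def)
        have "{a, b} \<notin> F" using n abG by (auto simp: B0_def)
        moreover have "a \<notin> {u, v, x, y}" using n abG by (auto simp: B1_def nbrs_def cell_def)
        moreover have "b \<notin> {u, v, x, y}"
        proof
          assume "b \<in> {u, v, x, y}"
          then have "(b, a) \<in> Sigma ({u, v, x, y} \<inter> cell A \<beta> j) (\<lambda>b. nbrs \<beta> G b i)"
            using abG by (auto simp: nbrs_def cell_def insert_commute)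
          then have "(a, b) \<in> B2" unfolding B2_def by force
          then show False using n by simp
        qed
        moreover have "{a, x} \<notin> G" using n abG by (auto simp: B3_def nbrs_def insert_commute)
        moreover have "{y, b} \<notin> G"
        proof
          assume "{y, b} \<in> G"
          then have "(b, a) \<in> Sigma (nbrs \<beta> G y j) (\<lambda>b. nbrs \<beta> G b i)"
            using abG by (auto simp: nbrs_def insert_commute)
          then have "(a, b) \<in> B4" unfolding B4_def by force
          then show False using n by simp
        qed
        ultimately show "z \<in> Q G x y" using ab unfolding z by (auto simp: Q_def)
      qed
      show fQ: "finite (Q G x y)"
        using cadj(2)[OF GS] by (rule finite_subset[rotated]) (auto simp: Q_def)
      have "card (B0 \<union> B1 \<union> B2 \<union> B3 \<union> B4) \<le> card B0 + card B1 + card B2 + card B3 + card B4"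
        using card_Un_le[of "B0 \<union> B1 \<union> B2 \<union> B3" B4] card_Un_le[of "B0 \<union> B1 \<union> B2" B3]
          card_Un_le[of "B0 \<union> B1" B2] card_Un_le[of B0 B1] by linarith
      also have "\<dots> \<le> 2 * t + 4 * \<Delta>1 + 4 * \<Delta>2 + 2 * \<Delta>1 * \<Delta>2"
        using b0 b1 b2 b3 b4 by (simp add: algebra_simps)
      finally have "cq \<le> card ?R - card (B0 \<union> B1 \<union> B2 \<union> B3 \<union> B4)"
        unfolding cq_def cadj(1)[OF GS] by simp
      also have "\<dots> \<le> card (?R - (B0 \<union> B1 \<union> B2 \<union> B3 \<union> B4))"
        using b0 b1 b2 b3 b4 by (intro diff_card_le_card_Diff) auto
      also have "\<dots> \<le> card (Q G x y)" using Qsup fQ by (intro card_mono)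
      finally show "cq \<le> card (Q G x y)" .
    qed
    show ?thesis
    proof
      show "cx * (cy * cq) \<le> card (Z G)"
        unfolding Z_def using cX cY cQ by (intro card_Sigma_ge) auto
      show "finite (Z G)" unfolding Z_def using cX cY cQ by auto
    qed
  qed
  have img: "\<psi> z \<in> Sigma SB (\<lambda>G. adj \<beta> G i j \<times> adj \<beta> G i j)"
    and inv: "z = (fst (\<psi> z) - {{u, v}, {a, x}, {y, b}} \<union> {{u, x}, {v, y}, {a, b}}, x, y, a, b)"
    if zeq: "z = (G, x, y, a, b)" and zin: "z \<in> Sigma SA Z" for z G x y a b
  proof -
    have G: "G \<in> SA" and x: "x \<in> X G" and y: "y \<in> Y G x" and q: "(a, b) \<in> Q G x y"
      using zeq zin by (auto simp: Z_def)
    have GS: "G \<in> S" "F \<subseteq> G" "{u, v} \<notin> G" using G by (auto simp: SA_def)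
    have e: "{u, x} \<in> G" "{v, y} \<in> G" "{a, b} \<in> G" "{a, x} \<notin> G" "{y, b} \<notin> G"
      and nF: "{u, x} \<notin> F" "{v, y} \<notin> F" "{a, b} \<notin> F"
      and \<beta>s: "\<beta> x = j" "\<beta> y = i" "\<beta> a = i" "\<beta> b = j"
      using x y q by (auto simp: X_def Y_def Q_def nbrs_def adj_def)
    have inA: "x \<in> A" "y \<in> A" "a \<in> A" "b \<in> A" "u \<noteq> x" "v \<noteq> y" "a \<noteq> b"
      using e pairsD[OF GA[OF GS(1)]] by auto
    \<comment> \<open>ux and vy are edges while uv is not, which excludes x = v and y = u; the other
      inequalities are built into \<open>Y\<close> and \<open>Q\<close>.\<close>
    have dist: "x \<noteq> v" "y \<noteq> u" "x \<noteq> y" "a \<noteq> u" "a \<noteq> v" "a \<noteq> x" "a \<noteq> y" "b \<noteq> u" "b \<noteq> v" "b \<noteq> x" "b \<noteq> y"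
      using GS(3) e y q by (auto simp: Y_def Q_def insert_commute)
    note ne = uv inA(5-7) dist
    define H where "H = insert {u, v} (insert {a, x} (insert {y, b} (G - {{u, x}, {v, y}, {a, b}})))"
    have \<psi>: "\<psi> z = (H, (a, x), (y, b))" by (simp add: zeq \<psi>_def H_def)
    have HA: "H \<subseteq> pairs A"
      using GA[OF GS(1)] u v uv inA dist pairsI[of _ A] by (auto simp: H_def)
    \<comment> \<open>Each of the six vertices exchanges a neighbour for one of the same block: u
      gives x for v, v gives y for u, x gives u for a, y gives v for b, a gives b for x, b gives a
      for y.\<close>
    have degH: "card (nbrs \<beta> H w l) = T w l" if w: "w \<in> A" and l: "l \<in> J" for w l
    proof -
      have memH: "{w, z} \<in> H \<longleftrightarrow> {w, z} = {u, v} \<or> {w, z} = {a, x} \<or> {w, z} = {y, b} \<or>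
          {w, z} \<in> G \<and> {w, z} \<noteq> {u, x} \<and> {w, z} \<noteq> {v, y} \<and> {w, z} \<noteq> {a, b}" for w z
        by (auto simp: H_def)
      have sw: "card (nbrs \<beta> H w l) = card (nbrs \<beta> G w l)"
        if "nb H w = insert z' (nb G w - {z})" "{w, z} \<in> G" "{w, z'} \<notin> G" "\<beta> z = \<beta> z'" for w z z'
        using card_nbrs_swap[OF fnb[OF GS(1)] that(1) _ _ that(4)] that(2,3) by (auto simp: nb_def)
      have "card (nbrs \<beta> H w l) = card (nbrs \<beta> G w l)"
      proof -
        consider "w = u" | "w = v" | "w = x" | "w = y" | "w = a" | "w = b" | "w \<notin> {u, v, x, y, a, b}" by blast
        then show ?thesis
        proof cases
          case 1
          have "nb H u = insert v (nb G u - {x})"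
            unfolding set_eq_iff nb_def using ne ne[symmetric] by (simp add: memH doubleton_eq_iff)
          then show ?thesis unfolding 1 by (rule sw) (use e GS v \<beta>s in auto)
        next
          case 2
          have "nb H v = insert u (nb G v - {y})"
            unfolding set_eq_iff nb_def using ne ne[symmetric] by (simp add: memH doubleton_eq_iff)
          then show ?thesis unfolding 2 by (rule sw) (use e GS u \<beta>s in \<open>auto simp: insert_commute\<close>)
        next
          case 3
          have "nb H x = insert a (nb G x - {u})"
            unfolding set_eq_iff nb_def using ne ne[symmetric] by (simp add: memH doubleton_eq_iff)
          then show ?thesis unfolding 3 by (rule sw) (use e GS u \<beta>s in \<open>auto simp: insert_commute\<close>)
        next
          case 4
          have "nb H y = insert b (nb G y - {v})"
            unfolding set_eq_iff nb_def using ne ne[symmetric] by (simp add: memH doubleton_eq_iff)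
          then show ?thesis unfolding 4 by (rule sw) (use e GS v \<beta>s in \<open>auto simp: insert_commute\<close>)
        next
          case 5
          have "nb H a = insert x (nb G a - {b})"
            unfolding set_eq_iff nb_def using ne ne[symmetric] by (simp add: memH doubleton_eq_iff)
          then show ?thesis unfolding 5 by (rule sw) (use e GS u \<beta>s in \<open>auto simp: insert_commute\<close>)
        next
          case 6
          have "nb H b = insert y (nb G b - {a})"
            unfolding set_eq_iff nb_def using ne ne[symmetric] by (simp add: memH doubleton_eq_iff)
          then show ?thesis unfolding 6 by (rule sw) (use e GS u \<beta>s in \<open>auto simp: insert_commute\<close>)
        next
          case 7
          then have "nbrs \<beta> H w l = nbrs \<beta> G w l"
            unfolding set_eq_iff nbrs_def by (simp add: memH doubleton_eq_iff)
          then show ?thesis by simp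
        qed
      qed
      then show ?thesis using deg[OF GS(1) w l] by simp
    qed
    have "H \<in> S" using HA degH by (simp add: S_def deg_graphs_def)
    moreover have "F \<subseteq> H" using GS nF by (auto simp: H_def)
    ultimately have "H \<in> SB" by (simp add: SB_def H_def)
    then show "\<psi> z \<in> Sigma SB (\<lambda>G. adj \<beta> G i j \<times> adj \<beta> G i j)"
      unfolding \<psi> using \<beta>s by (auto simp: adj_def H_def)
    have "{u, v} \<notin> {{u, x}, {v, y}, {a, b}}" "{a, x} \<notin> {{u, x}, {v, y}, {a, b}}" "{y, b} \<notin> {{u, x}, {v, y}, {a, b}}"
      using ne by (auto simp: doubleton_eq_iff)
    then have "H - {{u, v}, {a, x}, {y, b}} = G - {{u, x}, {v, y}, {a, b}}"
      unfolding H_def using e GS(3) by auto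
    then have *: "H - {{u, v}, {a, x}, {y, b}} \<union> {{u, x}, {v, y}, {a, b}} = G" using e by auto
    have fst: "fst (\<psi> z) = H" by (simp add: \<psi>)
    show "z = (fst (\<psi> z) - {{u, v}, {a, x}, {y, b}} \<union> {{u, x}, {v, y}, {a, b}}, x, y, a, b)"
      unfolding fst * by (rule zeq)
  qed
  have "inj_on \<psi> (Sigma SA Z)"
  proof (rule inj_onI)
    fix z z' assume z: "z \<in> Sigma SA Z" and z': "z' \<in> Sigma SA Z" and eq: "\<psi> z = \<psi> z'"
    obtain G x y a b where zz: "z = (G, x, y, a, b)" by (metis prod_cases5)
    obtain G' x' y' a' b' where zz': "z' = (G', x', y', a', b')" by (metis prod_cases5)
    have "x = x'" "y = y'" "a = a'" "b = b'" using eq by (auto simp: zz zz' \<psi>_def)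
    then show "z = z'" using inv[OF zz z] inv[OF zz' z'] eq by simp
  qed
  moreover have "\<psi> ` Sigma SA Z \<subseteq> Sigma SB (\<lambda>G. adj \<beta> G i j \<times> adj \<beta> G i j)"
  proof
    fix r assume "r \<in> \<psi> ` Sigma SA Z"
    then obtain z where z: "r = \<psi> z" "z \<in> Sigma SA Z" by auto
    obtain G x y a b where "z = (G, x, y, a, b)" by (metis prod_cases5)
    then show "r \<in> Sigma SB (\<lambda>G. adj \<beta> G i j \<times> adj \<beta> G i j)" using img z by blast
  qed
  moreover have fin: "finite SA" "finite SB" using fS by (auto simp: SA_def SB_def)
  moreover have "finite (Sigma SB (\<lambda>G. adj \<beta> G i j \<times> adj \<beta> G i j))"
    using fin cadj by (intro finite_SigmaI) (auto simp: SB_def)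
  ultimately have "card (Sigma SA Z) \<le> card (Sigma SB (\<lambda>G. adj \<beta> G i j \<times> adj \<beta> G i j))"
    by (intro card_inj_on_le)
  moreover have "card SA * (cx * (cy * cq)) \<le> card (Sigma SA Z)"
    using fin Zlow by (intro card_Sigma_ge) auto
  moreover have "card (Sigma SB (\<lambda>G. adj \<beta> G i j \<times> adj \<beta> G i j)) = card SB * (M * M)"
  proof -
    have "card (adj \<beta> G i j \<times> adj \<beta> G i j) = M * M" if "G \<in> SB" for G
      using cadj that by (simp add: SB_def card_cartesian_product)
    then show ?thesis using fin cadj by (subst card_SigmaI) (auto simp: SB_def)
  qed
  ultimately show ?thesis unfolding SA_def SB_def cx_def cy_def cq_def by linarith
qed

section \<open>Entropy of binomial coefficients\<close>


definition phi :: "real \<Rightarrow> real" where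
  "phi x = x * ln x"

text \<open>For integers this is the leading term of the logarithm of the binomial coefficient
  \<open>x + y\<close> choose \<open>x\<close>; \<open>Psi x (1 - x)\<close> is the binary entropy
  in natural logarithms. Since \<open>phi 0 = 0\<close>, the boundary values are the right
  ones.\<close>

definition Psi :: "real \<Rightarrow> real \<Rightarrow> real" where
  "Psi x y = phi (x + y) - phi x - phi y"

lemma phi_0 [simp]: "phi 0 = 0" and phi_1 [simp]: "phi 1 = 0"
  by (simp_all add: phi_def)

text \<open>Both are \<open>ln t \<le> t - 1\<close>, at t = (x + 1) / x and at t = x / (x + 1).
  They are exactly the induction steps of the two factorial bounds.\<close>

lemma ln_ratio_bounds:
  fixes x :: real
  assumes "x > 0"
  shows "x * (ln (x + 1) - ln x) \<le> 1" "(x + 1) * (ln (x + 1) - ln x) \<ge> 1"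
proof -
  have "ln ((x + 1) / x) \<le> (x + 1) / x - 1" using assms by (intro ln_le_minus_one) simp
  moreover have "ln (x / (x + 1)) \<le> x / (x + 1) - 1" using assms by (intro ln_le_minus_one) simp
  ultimately show "x * (ln (x + 1) - ln x) \<le> 1" "(x + 1) * (ln (x + 1) - ln x) \<ge> 1"
    using assms by (simp_all add: ln_div field_simps)
qed

lemma ln_fact_ge: "phi (real n) - real n \<le> ln (fact n)"
proof (induction n)
  case (Suc n)
  show ?case
  proof (cases "n = 0")
    case False
    have "ln (fact (Suc n)) = ln (real n + 1) + ln (fact n)" by (simp add: ln_mult add.commute)
    then show ?thesis using Suc False ln_ratio_bounds(1)[of "real n"]
      by (simp add: phi_def algebra_simps)
  qed simp
qed simp

text \<open>The induction starts at 1 and carries ln n in place of ln (n + 1), for which the step is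
  the second ratio bound. A logarithmic error for each factorial is harmless at precision n ln
  n.\<close>

lemma ln_fact_le: "ln (fact n) \<le> phi (real n) - real n + ln (real n + 1) + 1"
proof -
  have "ln (fact n) \<le> phi (real n) - real n + ln (real n) + 1" if "n \<ge> 1"
    using that
  proof (induction n rule: nat_induct_at_least)
    case (Suc n)
    have "ln (fact (Suc n)) = ln (real n + 1) + ln (fact n)" by (simp add: ln_mult add.commute)
    then show ?case using Suc ln_ratio_bounds(2)[of "real n"]
      by (simp add: phi_def algebra_simps)
  qed simp
  note * = this
  show ?thesis
  proof (cases "n \<ge> 1")
    case True
    then have "ln (real n) \<le> ln (real n + 1)" by simp
    then show ?thesis using *[OF True] by linarith
  qed (auto simp: not_le)
qed

lemma ln_choose_bounds:
  assumes "e \<le> B"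
  shows "ln (real (B choose e)) \<ge> Psi (real e) (real B - real e) - 2 * ln (real B + 1) - 2"
    and "ln (real (B choose e)) \<le> Psi (real e) (real B - real e) + ln (real B + 1) + 1"
proof -
  have eq: "ln (real (B choose e)) = ln (fact B) - ln (fact e) - ln (fact (B - e))"
    using assms by (simp add: binomial_fact ln_div ln_mult)
  have Be: "real (B - e) = real B - real e" using assms by (simp add: of_nat_diff)
  have B: "real e + (real B - real e) = real B" by simp
  have le: "ln (real e + 1) \<le> ln (real B + 1)" "ln (real (B - e) + 1) \<le> ln (real B + 1)"
    using assms by auto
  show "ln (real (B choose e)) \<ge> Psi (real e) (real B - real e) - 2 * ln (real B + 1) - 2"
    using ln_fact_ge[of B] ln_fact_le[of e] ln_fact_le[of "B - e"] le unfolding eq Psi_def Be B by linarith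
  show "ln (real (B choose e)) \<le> Psi (real e) (real B - real e) + ln (real B + 1) + 1"
    using ln_fact_le[of B] ln_fact_ge[of e] ln_fact_ge[of "B - e"] unfolding eq Psi_def Be B by linarith
qed

lemma phi_diff_ge_1:
  assumes "1 \<le> x" "x \<le> y" "y \<le> L"
  shows "0 \<le> phi y - phi x" "phi y - phi x \<le> (y - x) * (1 + ln L)"
proof -
  have "ln x \<le> ln y" "ln y \<le> ln L" "0 \<le> ln x" using assms by auto
  then show "0 \<le> phi y - phi x" using assms by (simp add: phi_def mult_mono)
  have "ln (y / x) \<le> y / x - 1" using assms by (intro ln_le_minus_one) auto
  then have "x * (ln y - ln x) \<le> y - x" using assms by (simp add: ln_div field_simps)
  moreover have "(y - x) * ln y \<le> (y - x) * ln L"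
    using assms \<open>ln y \<le> ln L\<close> by (intro mult_left_mono) auto
  ultimately show "phi y - phi x \<le> (y - x) * (1 + ln L)" by (simp add: phi_def algebra_simps)
qed

lemma phi_le_1:
  assumes "0 \<le> x" "x \<le> 1"
  shows "-1 \<le> phi x" "phi x \<le> 0"
proof -
  show "phi x \<le> 0" using assms by (cases "x = 0") (auto simp: phi_def mult_nonneg_nonpos)
  show "-1 \<le> phi x"
  proof (cases "x = 0")
    case False
    then have "ln (1 / x) \<le> 1 / x - 1" using assms by (intro ln_le_minus_one) auto
    then show ?thesis using False assms by (simp add: phi_def ln_div field_simps)
  qed simp
qed

text \<open>\<open>phi\<close> is not Lipschitz near 0, but on the unit interval it stays between -1
  and 0, so an additive 1 pays for that range. From 1 up to L its slope is at most 1 + ln L.\<close>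

lemma phi_diff:
  assumes "0 \<le> x" "x \<le> L" "0 \<le> y" "y \<le> L" "1 \<le> L"
  shows "\<bar>phi x - phi y\<bar> \<le> \<bar>x - y\<bar> * (1 + ln L) + 1"
proof -
  have *: "\<bar>phi x - phi y\<bar> \<le> (y - x) * (1 + ln L) + 1" if "0 \<le> x" "x \<le> y" "y \<le> L" for x y
  proof -
    have L: "0 \<le> 1 + ln L" using assms by (simp add: add_nonneg_nonneg)
    then have P: "0 \<le> (y - x) * (1 + ln L)" using that by simp
    consider "y \<le> 1" | "1 \<le> x" | "x < 1" "1 < y" by linarith
    then show ?thesis
    proof cases
      case 1
      then show ?thesis using phi_le_1[of x] phi_le_1[of y] that P by (simp add: abs_le_iff)
    next
      case 2
      then show ?thesis using phi_diff_ge_1[of x y L] that by simp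
    next
      case 3
      have "(y - 1) * (1 + ln L) \<le> (y - x) * (1 + ln L)" using 3 L by (intro mult_right_mono) auto
      then show ?thesis using 3 phi_diff_ge_1[of 1 y L] phi_le_1[of x] that by (simp add: abs_le_iff)
    qed
  qed
  show ?thesis using *[of x y] *[of y x] assms by (cases "x \<le> y") (auto simp: abs_minus_commute)
qed

lemma Psi_diff:
  assumes "0 \<le> x" "0 \<le> y" "x + y \<le> L" "0 \<le> x'" "0 \<le> y'" "x' + y' \<le> L" "1 \<le> L"
  shows "\<bar>Psi x y - Psi x' y'\<bar> \<le> 2 * (\<bar>x - x'\<bar> + \<bar>y - y'\<bar>) * (1 + ln L) + 3"
proof -
  have L: "0 \<le> 1 + ln L" using assms by (simp add: add_nonneg_nonneg)
  have "\<bar>phi (x + y) - phi (x' + y')\<bar> \<le> \<bar>(x + y) - (x' + y')\<bar> * (1 + ln L) + 1"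
    using assms by (intro phi_diff) auto
  moreover have "\<bar>(x + y) - (x' + y')\<bar> * (1 + ln L) \<le> (\<bar>x - x'\<bar> + \<bar>y - y'\<bar>) * (1 + ln L)"
    using L by (intro mult_right_mono) auto
  moreover have "\<bar>phi x - phi x'\<bar> \<le> \<bar>x - x'\<bar> * (1 + ln L) + 1"
    using assms by (intro phi_diff) auto
  moreover have "\<bar>phi y - phi y'\<bar> \<le> \<bar>y - y'\<bar> * (1 + ln L) + 1"
    using assms by (intro phi_diff) auto
  moreover have "2 * (\<bar>x - x'\<bar> + \<bar>y - y'\<bar>) * (1 + ln L) =
      (\<bar>x - x'\<bar> + \<bar>y - y'\<bar>) * (1 + ln L) + \<bar>x - x'\<bar> * (1 + ln L) + \<bar>y - y'\<bar> * (1 + ln L)"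
    by (simp add: algebra_simps)
  moreover have "\<bar>Psi x y - Psi x' y'\<bar> \<le>
      \<bar>phi (x + y) - phi (x' + y')\<bar> + \<bar>phi x - phi x'\<bar> + \<bar>phi y - phi y'\<bar>"
    unfolding Psi_def by linarith
  ultimately show ?thesis by linarith
qed

text \<open>\<open>phi (c * z)\<close> is \<open>c * phi z + c * z * ln c\<close>, and the terms
  with ln c cancel because x + y - x - y = 0. This is how block areas are pulled out of the
  entropy.\<close>

lemma Psi_scale:
  assumes "0 \<le> c" "0 \<le> x" "0 \<le> y"
  shows "Psi (c * x) (c * y) = c * Psi x y"
proof -
  have phi: "phi (c * z) = c * phi z + c * z * ln c" if "0 \<le> z" for z
    using that assms(1) by (cases "c = 0 \<or> z = 0") (auto simp: phi_def ln_mult algebra_simps)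
  show ?thesis
    using phi[of "x + y"] phi[of x] phi[of y] assms by (simp add: Psi_def algebra_simps)
qed

text \<open>Rounding produces errors of order n in both arguments. They cost only order n ln n,
  because the slope of \<open>phi\<close> up to n^2 is O(ln n). The constant 40 is generous: 18
  comes from the variation of \<open>Psi\<close>, a few units from the factorial bounds.\<close>

lemma ln_choose_approx:
  fixes n e B :: nat and C x y :: real
  assumes n: "n \<ge> 3" and eB: "e \<le> B" "B \<le> n\<^sup>2" and C: "C \<ge> 1"
    and x: "0 \<le> x" "0 \<le> y" "x + y \<le> (real n)\<^sup>2"
    and err: "\<bar>real e - x\<bar> \<le> C * real n" "\<bar>real B - (x + y)\<bar> \<le> C * real n"
  shows "\<bar>ln (real (B choose e)) - Psi x y\<bar> \<le> 40 * C * (real n * ln (real n))"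
proof -
  define l where "l = ln (real n)"
  have "exp 1 \<le> real n" using n exp_le by linarith
  then have l: "l \<ge> 1" unfolding l_def using n by (subst ln_ge_iff) auto
  have lL: "ln ((real n)\<^sup>2) = 2 * l" using n by (simp add: l_def ln_realpow)
  have B: "real B \<le> (real n)\<^sup>2" using eB(2) by (metis of_nat_le_iff of_nat_power)
  have n2: "real n * 3 \<le> (real n)\<^sup>2" using n by (simp add: power2_eq_square)
  have "ln (real B + 1) \<le> ln ((real n) ^ 3)"
  proof -
    have "real B + 1 \<le> 2 * (real n)\<^sup>2" using B n2 n by linarith
    also have "\<dots> \<le> real n * (real n)\<^sup>2" using n by (intro mult_right_mono) auto
    finally show ?thesis using n by (subst ln_le_cancel_iff) (auto simp: power3_eq_cube power2_eq_square mult.assoc)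
  qed
  then have lB: "ln (real B + 1) \<le> 3 * l" using n by (simp add: l_def ln_realpow)
  have "\<bar>(real B - real e) - y\<bar> \<le> 2 * (C * real n)" using err by linarith
  then have tot: "\<bar>real e - x\<bar> + \<bar>(real B - real e) - y\<bar> \<le> 3 * (C * real n)" using err by linarith
  have "\<bar>Psi (real e) (real B - real e) - Psi x y\<bar> \<le>
      2 * (\<bar>real e - x\<bar> + \<bar>(real B - real e) - y\<bar>) * (1 + ln ((real n)\<^sup>2)) + 3"
    using eB B x n by (intro Psi_diff) auto
  also have "\<dots> \<le> 2 * (3 * (C * real n)) * (3 * l) + 3"
    using tot l lL C by (intro add_right_mono mult_mono) auto
  finally have P: "\<bar>Psi (real e) (real B - real e) - Psi x y\<bar> \<le> 18 * C * (real n * l) + 3" by simp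
  have "1 * 3 \<le> C * real n" using C n by (intro mult_mono) auto
  then have "3 * l \<le> (C * real n) * l" "3 * 1 \<le> (C * real n) * l" using l by (intro mult_mono; simp)+
  then show ?thesis
    unfolding l_def[symmetric] using P ln_choose_bounds[OF eB(1)] lB by (simp add: abs_le_iff)
qed

text \<open>Separates the entropy from a part that is affine in x. Weighted with the block areas,
  the affine part depends only on the total density of the graphon.\<close>

lemma rel_ent_Psi:
  assumes "0 < q" "q < 1" "0 \<le> x" "x \<le> 1"
  shows "rel_ent q x = - Psi x (1 - x) - x * ln q - (1 - x) * ln (1 - q)"
proof -
  have "x * ln (x / q) = phi x - x * ln q" if "0 \<le> x" "0 < q" for x q
    using that by (cases "x = 0") (auto simp: phi_def ln_div algebra_simps)
  from this[of x q] this[of "1 - x" "1 - q"] show ?thesis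
    using assms by (simp add: rel_ent_def Psi_def)
qed

text \<open>Gibbs' inequality: the two terms are at least x - q and q - x, which cancel.\<close>

lemma rel_ent_nonneg:
  assumes "0 < q" "q < 1" "0 \<le> x" "x \<le> 1"
  shows "0 \<le> rel_ent q x"
proof -
  have "x - q \<le> x * ln (x / q)" if "0 \<le> x" "0 < q" for x q :: real
  proof (cases "x = 0")
    case False
    then have "ln (q / x) \<le> q / x - 1" using that by (intro ln_le_minus_one) auto
    then show ?thesis using False that by (simp add: ln_div field_simps)
  qed (use that in auto)
  from this[of x q] this[of "1 - x" "1 - q"] show ?thesis
    using assms by (simp add: rel_ent_def)
qed

section \<open>Counting homomorphisms in a family of graphs\<close>


lemma edge_ends:
  assumes "card e = 2"
  shows "e = {fst (edge_ends e), snd (edge_ends e)}"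
proof -
  obtain u v where "e = {u, v}" using assms by (auto simp: card_2_iff)
  then have "\<exists>z. case z of (u, v) \<Rightarrow> e = {u, v}" by auto
  then have "case edge_ends e of (u, v) \<Rightarrow> e = {u, v}"
    unfolding edge_ends_def by (rule someI_ex)
  then show ?thesis by (simp add: case_prod_unfold)
qed

abbreviation src :: "('v \<Rightarrow> 'b) \<Rightarrow> 'v set \<Rightarrow> 'b" where
  "src B e \<equiv> B (fst (edge_ends e))"

abbreviation tgt :: "('v \<Rightarrow> 'b) \<Rightarrow> 'v set \<Rightarrow> 'b" where
  "tgt B e \<equiv> B (snd (edge_ends e))"

text \<open>Only injective maps are counted: distinct edges of K then have distinct images, so that
  edges can be demanded one after another. Nothing is lost by this, as only a lower bound for the
  number of homomorphisms is wanted.\<close>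

definition bhoms :: "'a set \<Rightarrow> ('a \<Rightarrow> 'b) \<Rightarrow> 'a set set \<Rightarrow> 'v set \<Rightarrow> 'v set set \<Rightarrow> ('v \<Rightarrow> 'b) \<Rightarrow> ('v \<Rightarrow> 'a) set" where
  "bhoms A \<beta> G V E B =
     {f \<in> V \<rightarrow>\<^sub>E A. inj_on f V \<and> (\<forall>v\<in>V. \<beta> (f v) = B v) \<and> (\<forall>e\<in>E. f ` e \<in> G)}"

lemma finite_bhoms: "finite A \<Longrightarrow> finite V \<Longrightarrow> finite (bhoms A \<beta> G V E B)"
  unfolding bhoms_def by (rule finite_subset[of _ "V \<rightarrow>\<^sub>E A"]) (auto intro: finite_PiE)

lemma card_bhoms_vertex:
  assumes A: "finite A" and U: "finite U" "v \<notin> U" and E: "\<And>e. e \<in> E \<Longrightarrow> e \<subseteq> U"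
    and b: "\<And>X. finite X \<Longrightarrow> card X \<le> card U \<Longrightarrow> b \<le> card (cell A \<beta> (B v) - X)"
  shows "card (bhoms A \<beta> G U E B) * b \<le> card (bhoms A \<beta> G (insert v U) E B)"
proof -
  let ?Z = "Sigma (bhoms A \<beta> G U E B) (\<lambda>f. cell A \<beta> (B v) - f ` U)"
  let ?h = "\<lambda>(f, x). f(v := x)"
  have "b \<le> card (cell A \<beta> (B v) - f ` U)" for f
    using b[OF finite_imageI card_image_le] U(1) by blast
  then have "card (bhoms A \<beta> G U E B) * b \<le> card ?Z"
    using finite_bhoms[OF A U(1)] by (intro card_Sigma_ge) (auto intro: finite_Diff finite_cell[OF A])
  also have "\<dots> \<le> card (bhoms A \<beta> G (insert v U) E B)"
  proof (rule card_inj_on_le[of ?h])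
    show "inj_on ?h ?Z"
    proof (rule inj_onI)
      fix z z' assume z: "z \<in> ?Z" "z' \<in> ?Z" "?h z = ?h z'"
      obtain f x f' x' where eq: "z = (f, x)" "z' = (f', x')" by (metis surj_pair)
      have upd: "f(v := x) = f'(v := x')" using z(3) by (simp add: eq)
      have ext: "f \<in> U \<rightarrow>\<^sub>E A" "f' \<in> U \<rightarrow>\<^sub>E A" using z by (auto simp: eq bhoms_def)
      have "f w = f' w" for w
      proof (cases "w = v")
        case True
        then have "w \<notin> U" using U by simp
        then show ?thesis using PiE_arb[OF ext(1)] PiE_arb[OF ext(2)] by simp
      next
        case False
        then show ?thesis using fun_cong[OF upd, of w] by simp
      qed
      moreover have "x = x'" using fun_cong[OF upd, of v] by simp
      ultimately show "z = z'" by (auto simp: eq)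
    qed
    show "?h ` ?Z \<subseteq> bhoms A \<beta> G (insert v U) E B"
    proof
      fix g assume "g \<in> ?h ` ?Z"
      then obtain f x where g: "g = f(v := x)" and f: "f \<in> bhoms A \<beta> G U E B"
        and x: "x \<in> cell A \<beta> (B v)" "x \<notin> f ` U" by auto
      have "g ` e = f ` e" if "e \<in> E" for e
        using E[OF that] U(2) by (intro image_cong) (auto simp: g)
      moreover have "inj_on g (insert v U)"
        using f x U(2) by (auto simp: g bhoms_def inj_on_def)
      moreover have "g \<in> insert v U \<rightarrow>\<^sub>E A"
        using f x U(2) by (auto simp: g bhoms_def cell_def PiE_def Pi_def extensional_def)
      ultimately show "g \<in> bhoms A \<beta> G (insert v U) E B"
        using f x U(2) by (auto simp: g bhoms_def cell_def)
    qed
  qed (use A U in \<open>auto intro: finite_bhoms\<close>)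
  finally show ?thesis .
qed

lemma card_bhoms_edge:
  assumes A: "finite A" and G: "G \<subseteq> pairs A" and U: "finite U" "u \<notin> U" "v \<notin> U" "u \<noteq> v"
    and E: "\<And>e. e \<in> E \<Longrightarrow> e \<subseteq> U"
    and a: "\<And>X. finite X \<Longrightarrow> card X \<le> card U \<Longrightarrow>
      a \<le> card {(x, y) \<in> adj \<beta> G (B u) (B v). x \<notin> X \<and> y \<notin> X}"
  shows "card (bhoms A \<beta> G U E B) * a \<le> card (bhoms A \<beta> G (U \<union> {u, v}) (insert {u, v} E) B)"
proof -
  let ?N = "\<lambda>f. {(x, y) \<in> adj \<beta> G (B u) (B v). x \<notin> f ` U \<and> y \<notin> f ` U}"
  let ?Z = "Sigma (bhoms A \<beta> G U E B) ?N"
  let ?h = "\<lambda>(f, x, y). f(u := x, v := y)"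
  have fadj: "finite (adj \<beta> G (B u) (B v))"
    using adj_subset[OF G] by (rule finite_subset) (simp add: finite_cell[OF A])
  have "finite (?N f)" for f by (rule finite_subset[OF _ fadj]) auto
  moreover have "a \<le> card (?N f)" for f
    using a[OF finite_imageI card_image_le] U(1) by blast
  ultimately have "card (bhoms A \<beta> G U E B) * a \<le> card ?Z"
    using finite_bhoms[OF A U(1)] by (intro card_Sigma_ge) auto
  also have "\<dots> \<le> card (bhoms A \<beta> G (U \<union> {u, v}) (insert {u, v} E) B)"
  proof (rule card_inj_on_le[of ?h])
    show "inj_on ?h ?Z"
    proof (rule inj_onI)
      fix z z' assume z: "z \<in> ?Z" "z' \<in> ?Z" "?h z = ?h z'"
      obtain f x y where eq1: "z = (f, x, y)" by (cases z)
      obtain f' x' y' where eq2: "z' = (f', x', y')" by (cases z')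
      note eq = eq1 eq2
      have upd: "f(u := x, v := y) = f'(u := x', v := y')" using z(3) by (simp add: eq)
      have ext: "f \<in> U \<rightarrow>\<^sub>E A" "f' \<in> U \<rightarrow>\<^sub>E A" using z by (auto simp: eq bhoms_def)
      have "f w = f' w" for w
      proof (cases "w \<in> {u, v}")
        case True
        then have "w \<notin> U" using U by auto
        then show ?thesis using PiE_arb[OF ext(1)] PiE_arb[OF ext(2)] by simp
      next
        case False
        then show ?thesis using fun_cong[OF upd, of w] by simp
      qed
      moreover have "x = x'" using fun_cong[OF upd, of u] U by simp
      moreover have "y = y'" using fun_cong[OF upd, of v] by simp
      ultimately show "z = z'" by (auto simp: eq)
    qed
    show "?h ` ?Z \<subseteq> bhoms A \<beta> G (U \<union> {u, v}) (insert {u, v} E) B"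
    proof
      fix g assume "g \<in> ?h ` ?Z"
      then obtain f x y where g: "g = f(u := x, v := y)" and f: "f \<in> bhoms A \<beta> G U E B"
        and xy: "(x, y) \<in> adj \<beta> G (B u) (B v)" "x \<notin> f ` U" "y \<notin> f ` U" by auto
      have xyA: "x \<in> A" "y \<in> A" "x \<noteq> y" "{x, y} \<in> G" "\<beta> x = B u" "\<beta> y = B v"
        using xy pairsD[OF G] by (auto simp: adj_def)
      have gU: "g w = f w" if "w \<in> U" for w using that U by (auto simp: g)
      have guv: "g u = x" "g v = y" using U by (auto simp: g)
      have "g ` e = f ` e" if "e \<in> E" for e
        using E[OF that] gU by (intro image_cong) auto
      moreover have "inj_on g (U \<union> {u, v})"
      proof -
        have "inj_on g U" using f inj_on_cong[of U g f] gU by (simp add: bhoms_def)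
        moreover have "inj_on g {u, v}" using guv xyA by (simp add: inj_on_def)
        moreover have "g ` (U - {u, v}) \<inter> g ` ({u, v} - U) = {}"
        proof -
          have "g ` U = f ` U" using gU by (intro image_cong) auto
          then have "g ` (U - {u, v}) \<subseteq> f ` U" by blast
          moreover have "g ` ({u, v} - U) \<subseteq> {x, y}" using guv by auto
          ultimately show ?thesis using xy(2,3) by blast
        qed
        ultimately show ?thesis unfolding inj_on_Un by blast
      qed
      moreover have "g \<in> U \<union> {u, v} \<rightarrow>\<^sub>E A"
      proof (rule PiE_I)
        fix w assume "w \<in> U \<union> {u, v}"
        then show "g w \<in> A" using f gU guv xyA by (auto simp: bhoms_def)
      next
        fix w assume "w \<notin> U \<union> {u, v}"
        then show "g w = undefined" using PiE_arb[of f U "\<lambda>_. A" w] f by (auto simp: g bhoms_def)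
      qed
      moreover have "\<beta> (g w) = B w" if "w \<in> U \<union> {u, v}" for w
        using that f gU guv xyA by (auto simp: bhoms_def)
      ultimately show "g \<in> bhoms A \<beta> G (U \<union> {u, v}) (insert {u, v} E) B"
        using f guv xyA by (auto simp: bhoms_def)
    qed
  qed (use A U in \<open>auto intro: finite_bhoms\<close>)
  finally show ?thesis .
qed

text \<open>Greedy embedding, edge by edge along the matching and then vertex by vertex. Each choice
  must avoid the vertices already used, at most \<open>card V\<close> of them; this is why a and b
  are bounds after deletion of an arbitrary set of that size.\<close>

lemma card_bhoms_matching:
  fixes V :: "'v set" and a :: "'v set \<Rightarrow> nat" and b :: "'v \<Rightarrow> nat"
  assumes A: "finite A" and G: "G \<subseteq> pairs A" and V: "finite V"
    and M: "finite M" "\<And>e. e \<in> M \<Longrightarrow> e \<subseteq> V \<and> card e = 2" "pairwise disjnt M"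
    and a: "\<And>e X. e \<in> M \<Longrightarrow> finite X \<Longrightarrow> card X \<le> card V \<Longrightarrow>
      a e \<le> card {(x, y) \<in> adj \<beta> G (src B e) (tgt B e). x \<notin> X \<and> y \<notin> X}"
    and b: "\<And>v X. v \<in> V \<Longrightarrow> finite X \<Longrightarrow> card X \<le> card V \<Longrightarrow> b v \<le> card (cell A \<beta> (B v) - X)"
  shows "(\<Prod>e\<in>M. a e) * (\<Prod>v\<in>V - \<Union>M. b v) \<le> card (bhoms A \<beta> G V M B)"
proof -
  have 1: "(\<Prod>e\<in>M'. a e) \<le> card (bhoms A \<beta> G (\<Union>M') M' B)" if "M' \<subseteq> M" for M'
    using finite_subset[OF that M(1)] that
  proof (induction M' rule: finite_induct)
    case empty
    have "bhoms A \<beta> G {} {} B = {\<lambda>_. undefined}" by (auto simp: bhoms_def)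
    then show ?case by simp
  next
    case (insert e M')
    define u v where "u = fst (edge_ends e)" and "v = snd (edge_ends e)"
    have e2: "card e = 2" "e \<subseteq> V" using M(2) insert.prems by auto
    then have e: "e = {u, v}" using edge_ends u_def v_def by metis
    have uv: "u \<noteq> v" using e2 e by auto
    have dis: "e \<inter> \<Union>M' = {}"
      using M(3) insert.hyps insert.prems by (fastforce simp: pairwise_def disjnt_def)
    have UV: "\<Union>M' \<subseteq> V" using M(2) insert.prems by auto
    have fU: "finite (\<Union>M')" using UV V finite_subset by auto
    have "(\<Prod>e\<in>insert e M'. a e) = (\<Prod>e\<in>M'. a e) * a e" using insert.hyps by (simp add: mult.commute)
    also have "\<dots> \<le> card (bhoms A \<beta> G (\<Union>M') M' B) * a e"
      using insert by (intro mult_right_mono) auto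
    also have "\<dots> \<le> card (bhoms A \<beta> G (\<Union>M' \<union> {u, v}) (insert {u, v} M') B)"
    proof (rule card_bhoms_edge[OF A G fU _ _ uv])
      show "a e \<le> card {(x, y) \<in> adj \<beta> G (B u) (B v). x \<notin> X \<and> y \<notin> X}"
        if "finite X" "card X \<le> card (\<Union>M')" for X
        using a[of e X] that card_mono[OF V UV] insert.prems by (simp add: u_def v_def)
    qed (use dis e in auto)
    also have "\<Union>M' \<union> {u, v} = \<Union>(insert e M')" using e by auto
    finally show ?case using e by simp
  qed
  have MV: "\<Union>M \<subseteq> V" using M(2) by auto
  have 2: "(\<Prod>e\<in>M. a e) * (\<Prod>v\<in>W. b v) \<le> card (bhoms A \<beta> G (\<Union>M \<union> W) M B)" if "W \<subseteq> V - \<Union>M" for W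
    using finite_subset[OF that finite_Diff[OF V]] that
  proof (induction W rule: finite_induct)
    case empty
    then show ?case using 1[of M] by simp
  next
    case (insert v W)
    have UV: "\<Union>M \<union> W \<subseteq> V" using insert.prems MV by auto
    have "(\<Prod>e\<in>M. a e) * (\<Prod>v\<in>insert v W. b v) = (\<Prod>e\<in>M. a e) * (\<Prod>v\<in>W. b v) * b v"
      using insert.hyps by (simp add: mult_ac)
    also have "\<dots> \<le> card (bhoms A \<beta> G (\<Union>M \<union> W) M B) * b v"
      using insert by (intro mult_right_mono) auto
    also have "\<dots> \<le> card (bhoms A \<beta> G (insert v (\<Union>M \<union> W)) M B)"
    proof (rule card_bhoms_vertex[OF A])
      show "finite (\<Union>M \<union> W)" using UV V finite_subset by auto
      show "b v \<le> card (cell A \<beta> (B v) - X)" if "finite X" "card X \<le> card (\<Union>M \<union> W)" for X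
        using b[of v X] that card_mono[OF V UV] insert.prems by auto
    qed (use insert in auto)
    finally show ?case by (simp add: Un_commute)
  qed
  have "\<Union>M \<union> (V - \<Union>M) = V" using MV by auto
  then show ?thesis using 2[of "V - \<Union>M"] by simp
qed

lemma sum_card_swap:
  assumes "finite X" "finite Y"
  shows "(\<Sum>x\<in>X. card {y \<in> Y. R x y}) = (\<Sum>y\<in>Y. card {x \<in> X. R x y})"
proof -
  have "(\<Sum>x\<in>X. card {y \<in> Y. R x y}) = (\<Sum>x\<in>X. \<Sum>y\<in>Y. if R x y then 1 else 0)"
    using assms by (intro sum.cong) (auto simp: sum.inter_filter[symmetric])
  also have "\<dots> = (\<Sum>y\<in>Y. \<Sum>x\<in>X. if R x y then 1 else 0)" by (rule sum.swap)
  also have "\<dots> = (\<Sum>y\<in>Y. card {x \<in> X. R x y})"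
    using assms by (intro sum.cong) (auto simp: sum.inter_filter[symmetric])
  finally show ?thesis .
qed

text \<open>For a fixed map the edges of \<open>Ec\<close> come free, and each edge of
  \<open>Eu\<close> keeps at least the fraction \<open>q e\<close> of the graphs, whatever was
  demanded before. What remains is the number of pairs of a graph and a map respecting
  \<open>Es\<close>; exchanging the sums turns it into copies of the matching in each graph, which
  are counted greedily. Thus \<open>Es\<close> is treated deterministically and only
  \<open>Eu\<close> by conditional proportions.\<close>

lemma sum_card_bhoms:
  fixes V :: "'v set" and a :: "'v set \<Rightarrow> nat" and b :: "'v \<Rightarrow> nat" and q :: "'v set \<Rightarrow> real"
  assumes A: "finite A" and S: "\<And>G. G \<in> S \<Longrightarrow> G \<subseteq> pairs A" and VE: "simple_graph V E"
    and E: "E = Es \<union> Ec \<union> Eu" "pairwise disjnt Es" "Eu \<inter> (Es \<union> Ec) = {}"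
    and a: "\<And>G e X. G \<in> S \<Longrightarrow> e \<in> Es \<Longrightarrow> finite X \<Longrightarrow> card X \<le> card V \<Longrightarrow>
      a e \<le> card {(x, y) \<in> adj \<beta> G (src B e) (tgt B e). x \<notin> X \<and> y \<notin> X}"
    and b: "\<And>v X. v \<in> V \<Longrightarrow> finite X \<Longrightarrow> card X \<le> card V \<Longrightarrow> b v \<le> card (cell A \<beta> (B v) - X)"
    and c: "\<And>G e x y. G \<in> S \<Longrightarrow> e \<in> Ec \<Longrightarrow> x \<in> cell A \<beta> (src B e) \<Longrightarrow>
      y \<in> cell A \<beta> (tgt B e) \<Longrightarrow> x \<noteq> y \<Longrightarrow> {x, y} \<in> G"
    and q: "\<And>F e x y. finite F \<Longrightarrow> card F \<le> card E \<Longrightarrow> e \<in> Eu \<Longrightarrow>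
      x \<in> cell A \<beta> (src B e) \<Longrightarrow> y \<in> cell A \<beta> (tgt B e) \<Longrightarrow>
      x \<noteq> y \<Longrightarrow> {x, y} \<notin> F \<Longrightarrow>
      q e * real (card {G \<in> S. F \<subseteq> G}) \<le> real (card {G \<in> S. insert {x, y} F \<subseteq> G})"
    and q0: "\<And>e. e \<in> Eu \<Longrightarrow> 0 \<le> q e"
  shows "(\<Prod>e\<in>Eu. q e) * (real (\<Prod>e\<in>Es. a e) * real (\<Prod>v\<in>V - \<Union>Es. b v)) * real (card S)
    \<le> (\<Sum>G\<in>S. real (card (bhoms A \<beta> G V E B)))"
proof -
  have V: "finite V" and e2: "\<And>e. e \<in> E \<Longrightarrow> e \<subseteq> V \<and> card e = 2"
    using VE by (auto simp: simple_graph_def)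
  have fE: "finite E" using e2 by (intro finite_subset[OF _ finite_Pow_iff[THEN iffD2, OF V]]) auto
  have fS: "finite S" using S finite_pairs[OF A] by (intro finite_subset[of S "Pow (pairs A)"]) auto
  define I where "I = bhoms A \<beta> ({} :: 'a set set) V {} B"
  have fI: "finite I" unfolding I_def using A V by (rule finite_bhoms)
  have bh: "bhoms A \<beta> G V E' B = {f \<in> I. (\<lambda>e. f ` e) ` E' \<subseteq> G}" for G E'
    by (auto simp: bhoms_def I_def)
  define N where "N f E' = card {G \<in> S. (\<lambda>e. f ` e) ` E' \<subseteq> G}" for f :: "'v \<Rightarrow> 'a" and E'
  have swap: "(\<Sum>G\<in>S. card (bhoms A \<beta> G V E' B)) = (\<Sum>f\<in>I. N f E')" for E'
    unfolding bh N_def by (rule sum_card_swap[OF fS fI])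
  have key: "(\<Prod>e\<in>Eu. q e) * real (N f Es) \<le> real (N f E)" if f: "f \<in> I" for f
  proof -
    have inj: "inj_on f V" and fA: "f \<in> V \<rightarrow> A" and fB: "\<And>v. v \<in> V \<Longrightarrow> \<beta> (f v) = B v"
      using f by (auto simp: I_def bhoms_def)
    have ends: "f ` e = {src f e, tgt f e}"
        "src f e \<in> cell A \<beta> (src B e)"
        "tgt f e \<in> cell A \<beta> (tgt B e)"
        "src f e \<noteq> tgt f e" if "e \<in> E" for e
    proof -
      let ?u = "fst (edge_ends e)" and ?v = "snd (edge_ends e)"
      have e: "e = {?u, ?v}" using edge_ends e2[OF that] by blast
      then have "?u \<in> V" "?v \<in> V" using e2[OF that] by auto
      moreover have "card {?u, ?v} = 2" using e e2[OF that] by metis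
      then have "?u \<noteq> ?v" by (cases "?u = ?v") auto
      ultimately show "f ?u \<in> cell A \<beta> (B ?u)" "f ?v \<in> cell A \<beta> (B ?v)" "f ?u \<noteq> f ?v"
        using fA fB inj by (auto simp: cell_def inj_on_def)
      have "f ` {?u, ?v} = {f ?u, f ?v}" by simp
      then show "f ` e = {f ?u, f ?v}" using e by simp
    qed
    have NEs: "N f Es = N f (Es \<union> Ec)"
    proof -
      have "f ` e \<in> G" if "G \<in> S" "e \<in> Ec" for G e
        using ends[of e] c[OF that] that E(1) by auto
      then have "{G \<in> S. (\<lambda>e. f ` e) ` Es \<subseteq> G} = {G \<in> S. (\<lambda>e. f ` e) ` (Es \<union> Ec) \<subseteq> G}" by auto
      then show ?thesis by (simp add: N_def)
    qed
    have "(\<Prod>e\<in>E'. q e) * real (N f (Es \<union> Ec)) \<le> real (N f (Es \<union> Ec \<union> E'))" if "E' \<subseteq> Eu" for E'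
    proof -
      have "finite E'" using that fE E(1) finite_subset[of E' E] by auto
      then show ?thesis using that
      proof (induction E' rule: finite_induct)
        case (insert e E')
        let ?E = "Es \<union> Ec \<union> E'"
        let ?F = "(\<lambda>e. f ` e) ` ?E"
        have e: "e \<in> Eu" "e \<in> E" using insert.prems E by auto
        have sub: "?E \<subseteq> E" using insert.prems E by auto
        have fin: "finite ?E" using finite_subset[OF sub fE] .
        have "f ` e \<notin> ?F"
        proof
          assume "f ` e \<in> ?F"
          then obtain e' where e': "e' \<in> ?E" "f ` e = f ` e'" by auto
          then have "e' = e" using e2 e sub inj_on_image_eq_iff[OF inj, of e e'] by blast
          then show False using e'(1) insert.hyps insert.prems E(3) by auto
        qed
        have "card ?F \<le> card E" using card_image_le[OF fin] card_mono[OF fE sub] order_trans by blast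
        then have "q e * real (card {G \<in> S. ?F \<subseteq> G}) \<le> real (card {G \<in> S. insert (f ` e) ?F \<subseteq> G})"
          using q[of ?F e "src f e" "tgt f e"] ends[OF e(2)] e(1) fin \<open>f ` e \<notin> ?F\<close>
          by auto
        also have "insert (f ` e) ?F = (\<lambda>e. f ` e) ` (Es \<union> Ec \<union> insert e E')" by auto
        finally have "q e * real (N f ?E) \<le> real (N f (Es \<union> Ec \<union> insert e E'))"
          by (simp only: N_def)
        moreover have "q e * ((\<Prod>e\<in>E'. q e) * real (N f (Es \<union> Ec))) \<le> q e * real (N f ?E)"
          using insert q0[OF e(1)] by (intro mult_left_mono) auto
        ultimately show ?case using insert.hyps by (simp add: mult.assoc)
      qed simp
    qed
    from this[of Eu] show ?thesis using NEs E(1) by simp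
  qed
  have match: "(\<Prod>e\<in>Es. a e) * (\<Prod>v\<in>V - \<Union>Es. b v) \<le> card (bhoms A \<beta> G V Es B)" if G: "G \<in> S" for G
    using E(1) e2 finite_subset[of Es E] fE
    by (intro card_bhoms_matching[OF A S[OF G] V _ _ E(2) a[OF G] b]) auto
  have "(\<Prod>e\<in>Eu. q e) * (real (\<Prod>e\<in>Es. a e) * real (\<Prod>v\<in>V - \<Union>Es. b v)) * real (card S)
      = (\<Prod>e\<in>Eu. q e) * (\<Sum>G\<in>S. real ((\<Prod>e\<in>Es. a e) * (\<Prod>v\<in>V - \<Union>Es. b v)))"
    by simp
  also have "\<dots> \<le> (\<Prod>e\<in>Eu. q e) * (\<Sum>G\<in>S. real (card (bhoms A \<beta> G V Es B)))"
    using match q0 by (intro mult_left_mono sum_mono prod_nonneg) (auto simp del: of_nat_mult of_nat_prod)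
  also have "\<dots> = (\<Prod>e\<in>Eu. q e) * (\<Sum>f\<in>I. real (N f Es))"
    using swap[of Es] by (metis of_nat_sum)
  also have "\<dots> = (\<Sum>f\<in>I. (\<Prod>e\<in>Eu. q e) * real (N f Es))" by (rule sum_distrib_left)
  also have "\<dots> \<le> (\<Sum>f\<in>I. real (N f E))" using key by (rule sum_mono)
  also have "\<dots> = (\<Sum>G\<in>S. real (card (bhoms A \<beta> G V E B)))"
    using swap[of E] by (metis of_nat_sum)
  finally show ?thesis .
qed

lemma sum_bhoms_le_hom_count:
  assumes A: "finite A" and J: "finite J" and V: "finite V"
  shows "(\<Sum>B\<in>V \<rightarrow>\<^sub>E J. card (bhoms A \<beta> G V E B)) \<le> hom_count V E A G"
proof -
  have f: "finite (V \<rightarrow>\<^sub>E J)" "finite (V \<rightarrow>\<^sub>E A)" using A J V by (auto intro: finite_PiE)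
  have "(\<Sum>B\<in>V \<rightarrow>\<^sub>E J. card (bhoms A \<beta> G V E B)) = card (\<Union>B\<in>V \<rightarrow>\<^sub>E J. bhoms A \<beta> G V E B)"
  proof (rule card_UN_disjoint[symmetric])
    show "\<forall>B\<in>V \<rightarrow>\<^sub>E J. \<forall>B'\<in>V \<rightarrow>\<^sub>E J. B \<noteq> B' \<longrightarrow> bhoms A \<beta> G V E B \<inter> bhoms A \<beta> G V E B' = {}"
    proof (intro ballI impI)
      fix B B' assume "B \<in> V \<rightarrow>\<^sub>E J" "B' \<in> V \<rightarrow>\<^sub>E J" "B \<noteq> B'"
      then have "\<exists>v\<in>V. B v \<noteq> B' v" using PiE_ext by metis
      then show "bhoms A \<beta> G V E B \<inter> bhoms A \<beta> G V E B' = {}" by (auto simp: bhoms_def)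
    qed
  qed (use f finite_bhoms[OF A V] in auto)
  also have "\<dots> \<le> hom_count V E A G"
    unfolding hom_count_def using f by (intro card_mono) (auto simp: bhoms_def)
  finally show ?thesis .
qed

section \<open>Rounding the block sizes and edge counts\<close>


text \<open>Off the diagonal the entries pair up: each induction step adds a row and a column of
  equal sums and an even corner.\<close>

lemma even_sum_symmetric:
  fixes f :: "nat \<Rightarrow> nat \<Rightarrow> nat"
  assumes "\<And>i j. i < k \<Longrightarrow> j < k \<Longrightarrow> f i j = f j i" "\<And>i. i < k \<Longrightarrow> even (f i i)"
  shows "even (\<Sum>i=1..<k. \<Sum>j=1..<k. f i j)"
  using assms
proof (induction k)
  case (Suc k)
  show ?case
  proof (cases "k = 0")
    case False
    have "(\<Sum>i=1..<Suc k. \<Sum>j=1..<Suc k. f i j) =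
        (\<Sum>i=1..<k. \<Sum>j=1..<k. f i j) + (\<Sum>i=1..<k. f i k) + (\<Sum>j=1..<k. f k j) + f k k"
      using False by (simp add: sum.distrib)
    moreover have "(\<Sum>j=1..<k. f k j) = (\<Sum>i=1..<k. f i k)"
      using Suc.prems by (intro sum.cong) auto
    ultimately show ?thesis using Suc by simp
  qed simp
qed simp

lemma abs_mult_diff_le:
  fixes a b a' b' c n :: real
  assumes "\<bar>a - a'\<bar> \<le> c" "\<bar>b - b'\<bar> \<le> c" "0 \<le> a" "a \<le> n" "0 \<le> b'" "b' \<le> n"
  shows "\<bar>a * b - a' * b'\<bar> \<le> 2 * c * n"
proof -
  have "a * b - a' * b' = a * (b - b') + b' * (a - a')" by (simp add: algebra_simps)
  also have "\<bar>\<dots>\<bar> \<le> \<bar>a * (b - b')\<bar> + \<bar>b' * (a - a')\<bar>" by (rule abs_triangle_ineq)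
  also have "\<dots> = a * \<bar>b - b'\<bar> + b' * \<bar>a - a'\<bar>" using assms by (simp add: abs_mult)
  also have "\<dots> \<le> n * c + n * c"
    using assms by (intro add_mono mult_mono) auto
  finally show ?thesis by simp
qed

text \<open>Sizes and edge counts of the blocks below k are rounded down; the last row and column
  are then forced by the degree sums. Feasibility rests on \<open>m k \<ge> 1 - p\<close>: at most d
  vertices lie outside the last cell, and that cell is larger than d, so the forced counts fit. The
  last two conclusions record that less than one edge is lost, which is what makes blocks of weight
  1 complete.\<close>

lemma block_rounding:
  fixes m :: "nat \<Rightarrow> real" and w :: "nat \<Rightarrow> nat \<Rightarrow> real" and n k d :: nat and p :: real
  assumes k: "k \<ge> 1" and n: "n \<ge> 2"
    and m: "\<And>i. i \<in> {1..k} \<Longrightarrow> 0 \<le> m i" "(\<Sum>i=1..k. m i) = 1"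
    and w: "\<And>i j. i \<in> {1..k} \<Longrightarrow> j \<in> {1..k} \<Longrightarrow> 0 \<le> w i j \<and> w i j \<le> 1 \<and> w i j = w j i"
    and rows: "\<And>i. i \<in> {1..k} \<Longrightarrow> (\<Sum>j=1..k. w i j * m j) = p"
    and d: "real d = p * real n" and mk: "m k \<ge> 1 - p" and p: "0 \<le> p" "p \<le> 1/4" and ev: "even (d * n)"
  obtains N :: "nat \<Rightarrow> nat" and M :: "nat \<Rightarrow> nat \<Rightarrow> nat" where
    "(\<Sum>i=1..k. N i) = n"
    "\<And>i. i \<in> {1..k} \<Longrightarrow> real n * m i - 1 \<le> real (N i) \<and> real (N i) \<le> real n * m i + real k"
    "\<And>i j. i \<in> {1..k} \<Longrightarrow> j \<in> {1..k} \<Longrightarrow> M i j = M j i"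
    "\<And>i. i \<in> {1..k} \<Longrightarrow> even (M i i)"
    "\<And>i. i \<in> {1..k} \<Longrightarrow> (\<Sum>j=1..k. M i j) = N i * d"
    "\<And>i j. i \<in> {1..k} \<Longrightarrow> j \<in> {1..k} \<Longrightarrow> i \<noteq> j \<Longrightarrow> M i j \<le> N i * N j"
    "\<And>i. i \<in> {1..k} \<Longrightarrow> M i i \<le> N i * (N i - 1)"
    "\<And>i j. i \<in> {1..k} \<Longrightarrow> j \<in> {1..k} \<Longrightarrow>
      \<bar>real (M i j) - (real n)\<^sup>2 * m i * m j * w i j\<bar> \<le> 20 * (real k)\<^sup>2 * real n"
    "\<And>i j. i \<in> {1..<k} \<Longrightarrow> j \<in> {1..<k} \<Longrightarrow> i \<noteq> j \<Longrightarrow>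
      w i j * (real (N i) * real (N j)) - 1 < real (M i j)"
    "\<And>i. i \<in> {1..<k} \<Longrightarrow> w i i * (real (N i) * (real (N i) - 1)) - 2 < real (M i i)"
proof -
  define N0 where "N0 i = nat \<lfloor>real n * m i\<rfloor>" for i
  define N where "N i = (if i < k then N0 i else n - (\<Sum>i=1..<k. N0 i))" for i
  \<comment> \<open>On the diagonal the number of edges, half of the ordered count, is rounded and
    then doubled, so that the entry is even. The factor N i - 1 accounts for the absence of
    loops.\<close>
  define M0 where "M0 i j = (if i = j then 2 * nat \<lfloor>w i i * (real (N i) * (real (N i) - 1)) / 2\<rfloor>
      else nat \<lfloor>w i j * (real (N i) * real (N j))\<rfloor>)" for i j
  define r where "r i = (\<Sum>j=1..<k. M0 i j)" for i
  define c where "c i = N i * d - r i" for i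
  define M where "M i j = (if i < k then if j < k then M0 i j else c i
      else if j < k then c j else N k * d - (\<Sum>i=1..<k. c i))" for i j
  have split: "sum f {1..k} = sum f {1..<k} + f k" for f :: "nat \<Rightarrow> 'c::comm_monoid_add"
    using k by (metis atLeastLessThanSuc_atLeastAtMost sum.atLeastLessThan_Suc)
  have N0: "real (N0 i) \<le> real n * m i" "real n * m i - 1 < real (N0 i)" if "i \<in> {1..k}" for i
    using m(1)[OF that] unfolding N0_def by (auto simp: of_nat_nat zero_le_mult_iff)
  have msum: "(\<Sum>i=1..<k. real n * m i) = real n * (1 - m k)"
    using m(2) split[of m] by (simp add: sum_distrib_left[symmetric])
  have sN0: "real (\<Sum>i=1..<k. N0 i) \<le> real n * (1 - m k)"
    unfolding msum[symmetric] of_nat_sum using N0 by (intro sum_mono) auto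
  have mk1: "0 \<le> m k" "m k \<le> 1"
    using m k sum_nonneg[of "{1..<k}" m] split[of m] by auto
  have sN0n: "(\<Sum>i=1..<k. N0 i) \<le> n"
  proof -
    have "real n * (1 - m k) \<le> real n" using mk1 by (simp add: mult_left_le)
    then show ?thesis using sN0 by linarith
  qed
  have Nk: "real (N k) = real n - real (\<Sum>i=1..<k. N0 i)"
    unfolding N_def using sN0n by (simp add: of_nat_diff)
  have Nkge: "real (N k) \<ge> real n * m k" using sN0 Nk by (simp add: algebra_simps)
  have Nsum: "(\<Sum>i=1..k. N i) = n"
  proof -
    have "(\<Sum>i=1..<k. N i) = (\<Sum>i=1..<k. N0 i)" by (intro sum.cong) (auto simp: N_def)
    then show ?thesis unfolding split using sN0n by (simp add: N_def)
  qed
  have Nbd: "real n * m i - 1 \<le> real (N i) \<and> real (N i) \<le> real n * m i + real k" if i: "i \<in> {1..k}" for i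
  proof (cases "i < k")
    case True
    then show ?thesis using N0[OF i] by (simp add: N_def)
  next
    case False
    then have [simp]: "i = k" using i by simp
    have "(\<Sum>i=1..<k. real n * m i - 1) \<le> real (\<Sum>i=1..<k. N0 i)"
      unfolding of_nat_sum using N0 by (intro sum_mono less_imp_le) auto
    then have "real n * (1 - m k) - (real k - 1) \<le> real (\<Sum>i=1..<k. N0 i)"
      using msum k by (simp add: sum_subtractf of_nat_diff)
    then show ?thesis using Nk Nkge k by (simp add: algebra_simps)
  qed
  have Nle: "real (N i) \<le> real n * m i" if "i \<in> {1..<k}" for i
    using N0[of i] that by (simp add: N_def)
  have Nn: "N i \<le> n" if "i \<in> {1..k}" for i
    using member_le_sum[of i "{1..k}" N] that Nsum by simp
  have M0le: "real (M0 i j) \<le> w i j * (real (N i) * real (N j))"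
     "i \<noteq> j \<Longrightarrow> w i j * (real (N i) * real (N j)) - 1 < real (M0 i j)"
     "w i i * (real (N i) * (real (N i) - 1)) - 2 < real (M0 i i)"
     "real (M0 i i) \<le> w i i * (real (N i) * (real (N i) - 1))"
    if ij: "i \<in> {1..<k}" "j \<in> {1..<k}" for i j
  proof -
    have w0: "0 \<le> w i j" "0 \<le> w i i" using w[of i j] w[of i i] ij by auto
    have "0 \<le> real (N i) * (real (N i) - 1)" by (cases "N i") auto
    then have 1: "0 \<le> w i i * (real (N i) * (real (N i) - 1)) / 2" using w0 by simp
    then show di: "real (M0 i i) \<le> w i i * (real (N i) * (real (N i) - 1))"
      by (simp add: M0_def) linarith
    show "w i i * (real (N i) * (real (N i) - 1)) - 2 < real (M0 i i)"
      using 1 by (simp add: M0_def) linarith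
    show "i \<noteq> j \<Longrightarrow> w i j * (real (N i) * real (N j)) - 1 < real (M0 i j)"
      using w0 by (simp add: M0_def)
    have "w i i * (real (N i) * (real (N i) - 1)) \<le> w i i * (real (N i) * real (N i))"
      using w0 by (intro mult_left_mono) auto
    then show "real (M0 i j) \<le> w i j * (real (N i) * real (N j))"
      using di w0 by (cases "i = j") (auto simp: M0_def)
  qed
  \<comment> \<open>The inner part of a row leaves a nonnegative rest because
    \<open>N j \<le> n * m j\<close> for j < k, the effect of rounding sizes down, and because the
    full row has density p.\<close>
  have rle: "r i \<le> N i * d" if i: "i \<in> {1..<k}" for i
  proof -
    have wm: "(\<Sum>j=1..<k. w i j * m j) \<le> p"
      using rows[of i] split[of "\<lambda>j. w i j * m j"] w[of i k] mk1 i k by auto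
    have "real (r i) \<le> (\<Sum>j=1..<k. w i j * (real (N i) * real (N j)))"
      unfolding r_def of_nat_sum using M0le(1)[OF i] by (intro sum_mono) auto
    also have "\<dots> \<le> (\<Sum>j=1..<k. w i j * (real (N i) * (real n * m j)))"
      using Nle w i by (intro sum_mono mult_left_mono) auto
    also have "\<dots> = (real (N i) * real n) * (\<Sum>j=1..<k. w i j * m j)"
      by (simp add: sum_distrib_left algebra_simps)
    also have "\<dots> \<le> (real (N i) * real n) * p" using wm by (intro mult_left_mono) auto
    also have "\<dots> = real (N i * d)" using d by simp
    finally show ?thesis by linarith
  qed
  \<comment> \<open>The difference is at least n (1 - 2 p), and n \<ge> 2 together with p \<le> 1/4
    makes this at least 1. The extra 1 is needed for the corner, where loops are excluded.\<close>
  have dN: "d + 1 \<le> N k"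
  proof -
    have "real n * m k \<ge> real n * (1 - p)" using mk by (intro mult_left_mono) auto
    moreover have "real n * (1 - 2 * p) \<ge> 2 * (1 / 2)" using n p by (intro mult_mono) auto
    ultimately have "real d + 1 \<le> real (N k)" using Nkge d by (simp add: algebra_simps)
    then show ?thesis by linarith
  qed
  have sumN: "(\<Sum>i=1..<k. N i) + N k = n" using Nsum split by metis
  have sc: "(\<Sum>i=1..<k. c i) \<le> N k * d"
  proof -
    have "real (\<Sum>i=1..<k. N i) = real n - real (N k)" using sumN by linarith
    also have "\<dots> \<le> real n * (1 - m k)" using Nkge by (simp add: algebra_simps)
    also have "\<dots> \<le> real n * p" using mk by (intro mult_left_mono) auto
    also have "\<dots> = real d" using d by simp
    finally have le: "(\<Sum>i=1..<k. N i) \<le> d" by linarith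
    have "(\<Sum>i=1..<k. c i) \<le> (\<Sum>i=1..<k. N i * d)" unfolding c_def by (intro sum_mono) simp
    also have "\<dots> = (\<Sum>i=1..<k. N i) * d" by (simp add: sum_distrib_right)
    also have "\<dots> \<le> N k * d" using le dN by (intro mult_right_mono) auto
    finally show ?thesis .
  qed
  have M0sym: "M0 i j = M0 j i" if "i \<in> {1..<k}" "j \<in> {1..<k}" for i j
    using w[of i j] that by (auto simp: M0_def mult.commute)
  have Msym: "M i j = M j i" if "i \<in> {1..k}" "j \<in> {1..k}" for i j
    using M0sym[of i j] that by (auto simp: M_def)
  have Meven: "even (M i i)" if i: "i \<in> {1..k}" for i
  proof (cases "i < k")
    case True
    then show ?thesis by (simp add: M_def M0_def)
  next
    case False
    then have [simp]: "i = k" using i by simp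
    \<comment> \<open>Parity of the corner: it is N k d minus the sum of the c i, and c i = N i d -
      r i. So the corner plus d n is an even number plus the sum of the r i, which is even by
      symmetry; and d n is even by assumption.\<close>
    have aux: "a + b + c = 2 * (a + e) + f" if "e + f = c" "a + e = b" for a b c e f :: nat
      using that by simp
    have reven: "even (\<Sum>i=1..<k. r i)"
    proof -
      \<comment> \<open>Index 0 is not a block; setting the entries to 0 there supplies symmetry for
        all indices below k.\<close>
      have "even (\<Sum>i=1..<k. \<Sum>j=1..<k. if i = 0 \<or> j = 0 then 0 else M0 i j)"
        using M0sym by (intro even_sum_symmetric) (auto simp: M0_def)
      also have "(\<Sum>i=1..<k. \<Sum>j=1..<k. if i = 0 \<or> j = 0 then 0 else M0 i j) = (\<Sum>i=1..<k. r i)"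
        unfolding r_def by (intro sum.cong) auto
      finally show ?thesis .
    qed
    have "(\<Sum>i=1..<k. c i) + (\<Sum>i=1..<k. r i) = (\<Sum>i=1..<k. N i) * d"
      unfolding sum.distrib[symmetric] sum_distrib_right using rle by (intro sum.cong) (auto simp: c_def)
    moreover have "M k k + (\<Sum>i=1..<k. c i) = N k * d" using sc by (simp add: M_def)
    ultimately have *: "M k k + N k * d + (\<Sum>i=1..<k. N i) * d = 2 * (M k k + (\<Sum>i=1..<k. c i)) + (\<Sum>i=1..<k. r i)"
      by (rule aux)
    have "even (M k k + N k * d + (\<Sum>i=1..<k. N i) * d)" unfolding * using reven by simp
    then have "even (M k k + n * d)" using sumN by (metis add.assoc add.commute distrib_right)
    then show ?thesis using ev by (simp add: mult.commute)
  qed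
  have rowk: "(\<Sum>j=1..<k. M i j) = r i" "M i k = c i" if "i \<in> {1..<k}" for i
    using that by (auto simp: M_def r_def intro: sum.cong)
  have rowk': "(\<Sum>j=1..<k. M k j) = (\<Sum>j=1..<k. c j)"
    by (intro sum.cong) (auto simp: M_def)
  have Mrows: "(\<Sum>j=1..k. M i j) = N i * d" if i: "i \<in> {1..k}" for i
  proof (cases "i < k")
    case True
    then have "i \<in> {1..<k}" using i by simp
    then show ?thesis unfolding split using rowk rle by (simp add: c_def)
  next
    case False
    then have [simp]: "i = k" using i by simp
    have "M k k = N k * d - (\<Sum>i=1..<k. c i)" by (simp add: M_def)
    then show ?thesis unfolding split using sc rowk' by simp
  qed
  have cle: "c i \<le> N i * N k" for i
  proof -
    have "c i \<le> N i * d" by (simp add: c_def)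
    also have "\<dots> \<le> N i * N k" using dN by (intro mult_left_mono) auto
    finally show ?thesis .
  qed
  have Mle: "M i j \<le> N i * N j" if ij: "i \<in> {1..k}" "j \<in> {1..k}" "i \<noteq> j" for i j
  proof (cases "i < k \<and> j < k")
    case True
    then have "real (M0 i j) \<le> w i j * (real (N i) * real (N j))" using M0le(1)[of i j] ij by simp
    also have "\<dots> \<le> 1 * (real (N i) * real (N j))" using w[of i j] ij by (intro mult_right_mono) auto
    finally show ?thesis using True by (simp add: M_def flip: of_nat_mult)
  next
    case False
    then have "i = k \<or> j = k" using ij by auto
    then show ?thesis using cle[of i] cle[of j] ij by (auto simp: M_def mult.commute)
  qed
  have Mdiag: "M i i \<le> N i * (N i - 1)" if i: "i \<in> {1..k}" for i
  proof (cases "i < k")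
    case True
    have r: "real (N i) * (real (N i) - 1) = real (N i * (N i - 1))"
      by (cases "N i") (auto simp: algebra_simps)
    have "real (M0 i i) \<le> w i i * (real (N i) * (real (N i) - 1))" using M0le(4)[of i i] True i by simp
    also have "\<dots> \<le> 1 * (real (N i) * (real (N i) - 1))" unfolding r using w[of i i] i by (intro mult_right_mono) auto
    finally have "real (M0 i i) \<le> real (N i * (N i - 1))" using r by linarith
    then have "M0 i i \<le> N i * (N i - 1)" by (simp only: of_nat_le_iff)
    then show ?thesis using True by (simp add: M_def)
  next
    case False
    then have [simp]: "i = k" using i by simp
    have "M k k \<le> N k * d" by (simp add: M_def)
    also have "\<dots> \<le> N k * (N k - 1)" using dN by (intro mult_left_mono) auto
    finally show ?thesis by simp
  qed
  have mle: "m i \<le> 1" if "i \<in> {1..k}" for i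
    using member_le_sum[of i "{1..k}" m] that m by auto
  let ?t = "\<lambda>i j. (real n)\<^sup>2 * m i * m j * w i j"
  have e1: "\<bar>real (M i j) - ?t i j\<bar> \<le> 5 * real n" if ij: "i \<in> {1..<k}" "j \<in> {1..<k}" for i j
  proof -
    have ij': "i \<in> {1..k}" "j \<in> {1..k}" using ij by auto
    have N: "\<bar>real (N i) - real n * m i\<bar> \<le> 1" "\<bar>real (N j) - real n * m j\<bar> \<le> 1"
      using Nle[OF ij(1)] Nle[OF ij(2)] Nbd[OF ij'(1)] Nbd[OF ij'(2)] by auto
    have "\<bar>real (N i) * real (N j) - (real n * m i) * (real n * m j)\<bar> \<le> 2 * 1 * real n"
      using N Nn[OF ij'(1)] m(1)[OF ij'(2)] mle[OF ij'(2)]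
      by (intro abs_mult_diff_le) (auto simp: mult_left_le)
    then have "w i j * \<bar>real (N i) * real (N j) - (real n * m i) * (real n * m j)\<bar> \<le> 1 * (2 * real n)"
      using w[OF ij'] by (intro mult_mono) auto
    then have A: "\<bar>w i j * (real (N i) * real (N j)) - ?t i j\<bar> \<le> 2 * real n"
      using w[OF ij'] by (simp add: abs_mult_pos' right_diff_distrib power2_eq_square mult_ac)
    have B: "\<bar>real (M0 i j) - w i j * (real (N i) * real (N j))\<bar> \<le> real n + 2"
    proof (cases "i = j")
      case True
      have "w i i * real (N i) \<le> 1 * real n" using w[of i i] ij' Nn[OF ij'(1)] by (intro mult_mono) auto
      then show ?thesis using True M0le[OF ij] by (simp add: algebra_simps)
    next
      case False
      then show ?thesis using M0le[OF ij] by simp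
    qed
    have "M i j = M0 i j" using ij by (simp add: M_def)
    then show ?thesis using A B n by (simp add: abs_le_iff)
  qed
  \<comment> \<open>The error of a forced entry is that of the rest of its row, at most k times 5 n,
    plus n from rounding N i. The corner in turn collects up to k errors of this kind, whence the
    factor \<open>(real k)\<^sup>2\<close>.\<close>
  have e2: "\<bar>real (M i k) - ?t i k\<bar> \<le> 6 * real k * real n" if i: "i \<in> {1..<k}" for i
  proof -
    have i': "i \<in> {1..k}" using i by simp
    have "real (M i k) = real (N i * d) - (\<Sum>j=1..<k. real (M i j))"
      using rowk[OF i] rle[OF i] by (simp add: c_def of_nat_diff flip: of_nat_sum)
    moreover have "?t i k = (real n)\<^sup>2 * m i * p - (\<Sum>j=1..<k. ?t i j)"
    proof -
      have "(\<Sum>j=1..k. ?t i j) = (real n)\<^sup>2 * m i * p"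
        unfolding rows[OF i', symmetric] sum_distrib_left by (intro sum.cong) auto
      then show ?thesis using split[of "?t i"] by simp
    qed
    ultimately have "real (M i k) - ?t i k =
        (real (N i) - real n * m i) * real d - (\<Sum>j=1..<k. real (M i j) - ?t i j)"
      using d by (simp add: sum_subtractf algebra_simps power2_eq_square)
    also have "\<bar>\<dots>\<bar> \<le> \<bar>(real (N i) - real n * m i) * real d\<bar> + \<bar>\<Sum>j=1..<k. real (M i j) - ?t i j\<bar>"
      by (rule abs_triangle_ineq4)
    also have "\<dots> \<le> 1 * real n + real k * (5 * real n)"
    proof (rule add_mono)
      have "\<bar>real (N i) - real n * m i\<bar> \<le> 1" using Nle[OF i] Nbd[OF i'] by auto
      moreover have "real d \<le> 1 * real n" unfolding d using p by (intro mult_right_mono) auto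
      ultimately have "\<bar>real (N i) - real n * m i\<bar> * real d \<le> 1 * real n" by (intro mult_mono) auto
      then show "\<bar>(real (N i) - real n * m i) * real d\<bar> \<le> 1 * real n" by (simp add: abs_mult)
      have "\<bar>\<Sum>j=1..<k. real (M i j) - ?t i j\<bar> \<le> (\<Sum>j=1..<k. \<bar>real (M i j) - ?t i j\<bar>)" by (rule sum_abs)
      also have "\<dots> \<le> (\<Sum>j=1..<k. 5 * real n)" using e1[OF i] by (intro sum_mono) auto
      also have "\<dots> \<le> real k * (5 * real n)" using k by (simp add: of_nat_diff mult_right_mono)
      finally show "\<bar>\<Sum>j=1..<k. real (M i j) - ?t i j\<bar> \<le> real k * (5 * real n)" .
    qed
    also have "\<dots> \<le> 6 * real k * real n"
      using k mult_right_mono[of 1 "real k" "real n"] by simp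
    finally show ?thesis .
  qed
  have e3: "\<bar>real (M k k) - ?t k k\<bar> \<le> 7 * (real k)\<^sup>2 * real n"
  proof -
    have kk: "k \<in> {1..k}" using k by simp
    have "real (M k k) = real (N k * d) - (\<Sum>i=1..<k. real (c i))"
      using sc by (simp add: M_def of_nat_diff flip: of_nat_sum)
    also have "(\<Sum>i=1..<k. real (c i)) = (\<Sum>i=1..<k. real (M i k))" using rowk by (intro sum.cong) auto
    finally have 1: "real (M k k) = real (N k * d) - (\<Sum>i=1..<k. real (M i k))" .
    have "?t k k = (real n)\<^sup>2 * m k * p - (\<Sum>j=1..<k. ?t k j)"
    proof -
      have "(\<Sum>j=1..k. ?t k j) = (real n)\<^sup>2 * m k * p"
        unfolding rows[OF kk, symmetric] sum_distrib_left by (intro sum.cong) auto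
      then show ?thesis using split[of "?t k"] by simp
    qed
    also have "(\<Sum>j=1..<k. ?t k j) = (\<Sum>j=1..<k. ?t j k)" using w kk by (intro sum.cong) auto
    finally have "real (M k k) - ?t k k =
        (real (N k) - real n * m k) * real d - (\<Sum>j=1..<k. real (M j k) - ?t j k)"
      using d 1 by (simp add: sum_subtractf algebra_simps power2_eq_square)
    also have "\<bar>\<dots>\<bar> \<le> \<bar>(real (N k) - real n * m k) * real d\<bar> + \<bar>\<Sum>j=1..<k. real (M j k) - ?t j k\<bar>"
      by (rule abs_triangle_ineq4)
    also have "\<dots> \<le> real k * real n + real k * (6 * real k * real n)"
    proof (rule add_mono)
      have "\<bar>real (N k) - real n * m k\<bar> \<le> real k" using Nkge Nbd[OF kk] by auto
      moreover have "real d \<le> 1 * real n" unfolding d using p by (intro mult_right_mono) auto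
      ultimately have "\<bar>real (N k) - real n * m k\<bar> * real d \<le> real k * real n" by (intro mult_mono) auto
      then show "\<bar>(real (N k) - real n * m k) * real d\<bar> \<le> real k * real n" by (simp add: abs_mult)
      have "\<bar>\<Sum>j=1..<k. real (M j k) - ?t j k\<bar> \<le> (\<Sum>j=1..<k. \<bar>real (M j k) - ?t j k\<bar>)" by (rule sum_abs)
      also have "\<dots> \<le> (\<Sum>j=1..<k. 6 * real k * real n)" using e2 by (intro sum_mono) auto
      also have "\<dots> \<le> real k * (6 * real k * real n)" using k by (simp add: of_nat_diff mult_right_mono)
      finally show "\<bar>\<Sum>j=1..<k. real (M j k) - ?t j k\<bar> \<le> real k * (6 * real k * real n)" .
    qed
    also have "\<dots> \<le> 7 * (real k)\<^sup>2 * real n"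
      using k mult_right_mono[of 1 "real k" "real k * real n"] by (simp add: power2_eq_square mult_ac)
    finally show ?thesis .
  qed
  have k2: "1 \<le> (real k)\<^sup>2" "real k \<le> (real k)\<^sup>2"
    using k one_le_power[of "real k" 2] self_le_power[of "real k" 2] by auto
  have err: "\<bar>real (M i j) - ?t i j\<bar> \<le> 20 * (real k)\<^sup>2 * real n" if ij: "i \<in> {1..k}" "j \<in> {1..k}" for i j
  proof -
    have b: "5 * real n \<le> 20 * (real k)\<^sup>2 * real n" "6 * real k * real n \<le> 20 * (real k)\<^sup>2 * real n"
        "7 * (real k)\<^sup>2 * real n \<le> 20 * (real k)\<^sup>2 * real n"
      using k2 by (intro mult_right_mono; linarith)+
    consider "i < k" "j < k" | "i < k" "j = k" | "i = k" "j < k" | "i = k" "j = k"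
      using ij by fastforce
    then show ?thesis
    proof cases
      case 1 then show ?thesis using order_trans[OF e1 b(1)] ij by simp
    next
      case 2 then show ?thesis using order_trans[OF e2 b(2)] ij by simp
    next
      case 3
      then show ?thesis using order_trans[OF e2[of j] b(2)] ij Msym[OF ij] w[OF ij] by (simp add: mult_ac)
    next
      case 4 then show ?thesis using order_trans[OF e3 b(3)] by simp
    qed
  qed
  show ?thesis
  proof (rule that[of N M])
    show "w i j * (real (N i) * real (N j)) - 1 < real (M i j)" if "i \<in> {1..<k}" "j \<in> {1..<k}" "i \<noteq> j" for i j
      using M0le(2)[OF that] that by (simp add: M_def)
    show "w i i * (real (N i) * (real (N i) - 1)) - 2 < real (M i i)" if "i \<in> {1..<k}" for i
      using M0le(3)[OF that that] that by (simp add: M_def)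
  qed (use Nsum Nbd Msym Meven Mrows Mle Mdiag err in blast)+
qed


section \<open>Cells of given sizes and a bound for the number of regular graphs\<close>

lemma ex_labelling:
  fixes N :: "nat \<Rightarrow> nat" and k :: nat
  assumes "finite A" "card A = (\<Sum>i=1..k. N i)"
  shows "\<exists>\<beta>. \<beta> ` A \<subseteq> {1..k} \<and> (\<forall>i\<in>{1..k}. card (cell A \<beta> i) = N i)"
  using assms
proof (induction k arbitrary: A)
  case 0
  then show ?case by simp
next
  case (Suc k)
  have "N (Suc k) \<le> card A" using Suc.prems by simp
  then obtain A' where A': "A' \<subseteq> A" "card A' = N (Suc k)" using obtain_subset_with_card_n by metis
  have fA': "finite A'" using A' Suc.prems finite_subset by auto
  have "card (A - A') = (\<Sum>i=1..k. N i)" using A' Suc.prems fA' by (simp add: card_Diff_subset)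
  then obtain \<beta> where \<beta>: "\<beta> ` (A - A') \<subseteq> {1..k}" "\<And>i. i \<in> {1..k} \<Longrightarrow> card (cell (A - A') \<beta> i) = N i"
    using Suc.IH[of "A - A'"] Suc.prems by auto
  define \<gamma> where "\<gamma> u = (if u \<in> A' then Suc k else \<beta> u)" for u
  have "card (cell A \<gamma> i) = N i" if "i \<in> {1..Suc k}" for i
  proof (cases "i = Suc k")
    case True
    have "\<beta> u \<noteq> Suc k" if "u \<in> A - A'" for u using \<beta>(1) that by fastforce
    then have "cell A \<gamma> i = A'" using A' True by (auto simp: cell_def \<gamma>_def)
    then show ?thesis using A' True by simp
  next
    case False
    then have "cell A \<gamma> i = cell (A - A') \<beta> i" by (auto simp: cell_def \<gamma>_def)
    then show ?thesis using \<beta>(2) that False by simp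
  qed
  moreover have "\<gamma> ` A \<subseteq> {1..Suc k}" using \<beta>(1) by (fastforce simp: \<gamma>_def)
  ultimately show ?case by blast
qed

text \<open>Of regularity only the number of edges is kept, found by counting incidences in two
  ways. This crude bound meets \<open>Psi p (1 - p)\<close> in the entropy identity for block
  weights.\<close>

lemma card_regular_le_choose:
  assumes "even (d * n)"
  shows "finite (regular_graphs n d)" "card (regular_graphs n d) \<le> ((n choose 2) choose (d * n div 2))"
proof -
  let ?A = "{1..n}"
  let ?R = "{G. G \<subseteq> pairs ?A \<and> card G = d * n div 2}"
  have fR: "finite ?R" by (rule finite_subset[of _ "Pow (pairs ?A)"]) (auto simp: finite_pairs)
  have sub: "regular_graphs n d \<subseteq> ?R"
  proof
    fix G assume "G \<in> regular_graphs n d"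
    then have G: "G \<subseteq> pairs ?A" "\<And>v. v \<in> ?A \<Longrightarrow> card {e \<in> G. v \<in> e} = d"
      by (auto simp: regular_graphs_def simple_graph_def pairs_def)
    have fG: "finite G" using G(1) finite_pairs finite_subset by blast
    have "d * n = (\<Sum>v\<in>?A. card {e \<in> G. v \<in> e})" using G(2) by simp
    also have "\<dots> = (\<Sum>e\<in>G. card {v \<in> ?A. v \<in> e})" by (rule sum_card_swap) (use fG in auto)
    also have "\<dots> = (\<Sum>e\<in>G. 2)"
    proof (rule sum.cong)
      fix e assume "e \<in> G"
      then have "e \<in> pairs ?A" using G(1) by blast
      then have "{v \<in> ?A. v \<in> e} = e" "card e = 2" by (auto simp: pairs_def)
      then show "card {v \<in> ?A. v \<in> e} = 2" by simp
    qed simp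
    finally show "G \<in> ?R" using G(1) by simp
  qed
  show "finite (regular_graphs n d)" using sub fR finite_subset by blast
  have "card (regular_graphs n d) \<le> card ?R" by (rule card_mono[OF fR sub])
  also have "\<dots> = ((n choose 2) choose (d * n div 2))"
    using n_subsets[OF finite_pairs[of ?A]] card_pairs[of ?A] by simp
  finally show "card (regular_graphs n d) \<le> ((n choose 2) choose (d * n div 2))" .
qed

text \<open>The blocks with i \<le> j cover every unordered pair of cells once, and a diagonal block
  holds half as many vertex pairs as its area suggests. The factor 1/2 in front of I_p(W) n^2
  originates here.\<close>

lemma sum_upper_triangle:
  fixes f :: "nat \<Rightarrow> nat \<Rightarrow> real"
  assumes "\<And>i j. i \<in> {1..k} \<Longrightarrow> j \<in> {1..k} \<Longrightarrow> f i j = f j i"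
  shows "(\<Sum>(i, j)\<in>{(i, j). 1 \<le> i \<and> i \<le> j \<and> j \<le> k}. (if i = j then 1 / 2 else 1) * f i j)
    = (1 / 2) * (\<Sum>i=1..k. \<Sum>j=1..k. f i j)"
proof -
  let ?J = "{1..k} \<times> {1..k}"
  let ?C = "{(i, j). 1 \<le> i \<and> i \<le> j \<and> j \<le> k}"
  let ?L = "{z \<in> ?J. fst z < snd z}" and ?U = "{z \<in> ?J. snd z < fst z}" and ?D = "{z \<in> ?J. fst z = snd z}"
  let ?f = "\<lambda>z. f (fst z) (snd z)"
  have "sum ?f ?U = sum ?f ?L"
    using assms by (intro sum.reindex_bij_witness[of _ prod.swap prod.swap]) auto
  moreover have "sum ?f ?J = sum ?f ?L + sum ?f ?U + sum ?f ?D"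
  proof -
    have "?J = ?L \<union> ?U \<union> ?D" by auto
    then have "sum ?f ?J = sum ?f (?L \<union> ?U \<union> ?D)" by simp
    also have "\<dots> = sum ?f (?L \<union> ?U) + sum ?f ?D"
      by (rule sum.union_disjoint) (auto intro: finite_subset[of _ ?J])
    also have "sum ?f (?L \<union> ?U) = sum ?f ?L + sum ?f ?U"
      by (rule sum.union_disjoint) (auto intro: finite_subset[of _ ?J])
    finally show ?thesis .
  qed
  moreover have "(\<Sum>(i, j)\<in>?C. (if i = j then 1 / 2 else 1) * f i j) = sum ?f ?L + sum (\<lambda>z. (1 / 2) * ?f z) ?D"
  proof -
    have "?C = ?L \<union> ?D" by auto
    then have "(\<Sum>(i, j)\<in>?C. (if i = j then 1 / 2 else 1) * f i j)
        = (\<Sum>(i, j)\<in>?L \<union> ?D. (if i = j then 1 / 2 else 1) * f i j)" by simp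
    also have "\<dots> = (\<Sum>(i, j)\<in>?L. (if i = j then 1 / 2 else 1) * f i j)
        + (\<Sum>(i, j)\<in>?D. (if i = j then 1 / 2 else 1) * f i j)"
      by (rule sum.union_disjoint) (auto intro: finite_subset[of _ ?J])
    also have "(\<Sum>(i, j)\<in>?L. (if i = j then 1 / 2 else 1) * f i j) = sum ?f ?L"
      by (intro sum.cong) auto
    also have "(\<Sum>(i, j)\<in>?D. (if i = j then 1 / 2 else 1) * f i j) = sum (\<lambda>z. (1 / 2) * ?f z) ?D"
      by (intro sum.cong) auto
    finally show ?thesis .
  qed
  moreover have "sum ?f ?J = (\<Sum>i=1..k. \<Sum>j=1..k. f i j)"
    by (simp add: sum.cartesian_product case_prod_unfold)
  moreover have "sum (\<lambda>z. (1 / 2) * ?f z) ?D = (1 / 2) * sum ?f ?D" by (rule sum_distrib_left[symmetric])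
  ultimately show ?thesis by linarith
qed

text \<open>The block graphon at a single n, reduced to its numbers. The bound
  \<open>2 \<le> real n * m i\<close> keeps every rounded cell nonempty, n \<ge> 3 gives ln n \<ge>
  1, and p \<le> 1/4 leaves room for the rounding.\<close>

locale block_weights =
  fixes m :: "nat \<Rightarrow> real" and w :: "nat \<Rightarrow> nat \<Rightarrow> real" and n k d :: nat and p :: real
  assumes k: "k \<ge> 1" and n: "n \<ge> 3"
    and m: "\<And>i. i \<in> {1..k} \<Longrightarrow> 2 \<le> real n * m i" and m_sum: "(\<Sum>i=1..k. m i) = 1"
    and w: "\<And>i j. i \<in> {1..k} \<Longrightarrow> j \<in> {1..k} \<Longrightarrow> 0 \<le> w i j \<and> w i j \<le> 1 \<and> w i j = w j i"
    and rows: "\<And>i. i \<in> {1..k} \<Longrightarrow> (\<Sum>j=1..k. w i j * m j) = p"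
    and d: "real d = p * real n" and mk: "m k \<ge> 1 - p" and p: "0 < p" "p \<le> 1/4" and ev: "even (d * n)"
begin

definition ent :: real where
  "ent = (\<Sum>i=1..k. \<Sum>j=1..k. m i * m j * rel_ent p (w i j))"

lemma m_pos: "i \<in> {1..k} \<Longrightarrow> 0 < m i"
proof -
  assume "i \<in> {1..k}"
  then have "0 < real n * m i" using m[of i] by linarith
  then show ?thesis using n by (simp add: zero_less_mult_iff)
qed

lemma m_le_1: "i \<in> {1..k} \<Longrightarrow> m i \<le> 1"
  using member_le_sum[of i "{1..k}" m] m_pos m_sum by fastforce

text \<open>By p-regularity the weighted mean of the w i j is p, so the affine parts of the relative
  entropies add up to \<open>Psi p (1 - p)\<close>. Hence \<open>ent\<close>, which is I_p(W), is
  the entropy deficit of the block densities against constant density p; a quotient of two counts of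
  graphs produces exactly this difference.\<close>

lemma ent_eq:
  "ent = Psi p (1 - p) - (\<Sum>i=1..k. \<Sum>j=1..k. m i * m j * Psi (w i j) (1 - w i j))"
proof -
  have 1: "(\<Sum>i=1..k. \<Sum>j=1..k. m i * m j * w i j) = p"
  proof -
    have "(\<Sum>j=1..k. m i * m j * w i j) = m i * p" if "i \<in> {1..k}" for i
      unfolding rows[OF that, symmetric] sum_distrib_left by (intro sum.cong) auto
    then have "(\<Sum>i=1..k. \<Sum>j=1..k. m i * m j * w i j) = (\<Sum>i=1..k. m i * p)" by (intro sum.cong) auto
    then show ?thesis using m_sum by (simp add: sum_distrib_right[symmetric])
  qed
  have 2: "(\<Sum>i=1..k. \<Sum>j=1..k. m i * m j) = 1"
    using m_sum by (simp add: sum_distrib_left[symmetric] sum_distrib_right[symmetric])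
  have *: "rel_ent p (w i j) = - Psi (w i j) (1 - w i j) - w i j * ln p - (1 - w i j) * ln (1 - p)"
    if "i \<in> {1..k}" "j \<in> {1..k}" for i j
    using rel_ent_Psi[of p "w i j"] p w[OF that] by simp
  have "ent = (\<Sum>i=1..k. \<Sum>j=1..k. m i * m j * w i j * (ln (1 - p) - ln p) - m i * m j * ln (1 - p)
      - m i * m j * Psi (w i j) (1 - w i j))"
    unfolding ent_def
    by (intro sum.cong refl) (simp add: * algebra_simps)
  also have "\<dots> = (\<Sum>i=1..k. \<Sum>j=1..k. m i * m j * w i j) * (ln (1 - p) - ln p)
      - (\<Sum>i=1..k. \<Sum>j=1..k. m i * m j) * ln (1 - p)
      - (\<Sum>i=1..k. \<Sum>j=1..k. m i * m j * Psi (w i j) (1 - w i j))"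
    by (simp add: sum_subtractf sum_distrib_right)
  also have "\<dots> = Psi p (1 - p) - (\<Sum>i=1..k. \<Sum>j=1..k. m i * m j * Psi (w i j) (1 - w i j))"
    unfolding 1 2 by (simp add: Psi_def phi_def algebra_simps)
  finally show ?thesis .
qed

text \<open>A lower bound for the balanced family is set against the upper bound for all regular
  graphs, in logarithms. The properties of N, M and T are exported as well, since the first moment
  depends on how the numbers were rounded and not only on the size of the family.\<close>

lemma structured_family:
  obtains \<beta> :: "nat \<Rightarrow> nat" and N :: "nat \<Rightarrow> nat" and M T :: "nat \<Rightarrow> nat \<Rightarrow> nat" where
    "\<beta> ` {1..n} \<subseteq> {1..k}"
    "\<And>i. i \<in> {1..k} \<Longrightarrow> card (cell {1..n} \<beta> i) = N i"
    "\<And>i. i \<in> {1..k} \<Longrightarrow> real n * m i - 1 \<le> real (N i) \<and> real (N i) \<le> real n * m i + real k"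
    "\<And>i j. i \<in> {1..k} \<Longrightarrow> j \<in> {1..k} \<Longrightarrow> M i j = M j i"
    "\<And>i j. i \<in> {1..k} \<Longrightarrow> j \<in> {1..k} \<Longrightarrow>
      \<bar>real (M i j) - (real n)\<^sup>2 * m i * m j * w i j\<bar> \<le> 20 * (real k)\<^sup>2 * real n"
    "\<And>i j. i \<in> {1..<k} \<Longrightarrow> j \<in> {1..<k} \<Longrightarrow> i \<noteq> j \<Longrightarrow>
      w i j * (real (N i) * real (N j)) - 1 < real (M i j)"
    "\<And>i. i \<in> {1..<k} \<Longrightarrow> w i i * (real (N i) * (real (N i) - 1)) - 2 < real (M i i)"
    "\<And>i. i \<in> {1..k} \<Longrightarrow> even (M i i)"
    "\<And>i j. i \<in> {1..k} \<Longrightarrow> j \<in> {1..k} \<Longrightarrow> (\<Sum>u\<in>cell {1..n} \<beta> i. T u j) = M i j"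
    "\<And>u j. u \<in> {1..n} \<Longrightarrow> j \<in> {1..k} \<Longrightarrow>
      T u j \<in> {M (\<beta> u) j div N (\<beta> u), M (\<beta> u) j div N (\<beta> u) + 1}"
    "deg_graphs {1..n} {1..k} \<beta> T \<subseteq> regular_graphs n d"
    "0 < card (deg_graphs {1..n} {1..k} \<beta> T)"
    "ln (real (card (regular_graphs n d))) - ln (real (card (deg_graphs {1..n} {1..k} \<beta> T)))
      \<le> (1/2) * ent * (real n)\<^sup>2 + 900 * real k ^ 4 * (real n * ln (real n))"
proof -
  let ?A = "{1..n}" and ?J = "{1..k}"
  obtain N M where
    N: "(\<Sum>i=1..k. N i) = n"
    and Nbd: "\<And>i. i \<in> ?J \<Longrightarrow> real n * m i - 1 \<le> real (N i) \<and> real (N i) \<le> real n * m i + real k"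
    and Msym: "\<And>i j. i \<in> ?J \<Longrightarrow> j \<in> ?J \<Longrightarrow> M i j = M j i"
    and Mev: "\<And>i. i \<in> ?J \<Longrightarrow> even (M i i)"
    and Mrows: "\<And>i. i \<in> ?J \<Longrightarrow> (\<Sum>j=1..k. M i j) = N i * d"
    and Mle: "\<And>i j. i \<in> ?J \<Longrightarrow> j \<in> ?J \<Longrightarrow> i \<noteq> j \<Longrightarrow> M i j \<le> N i * N j"
    and Mdiag: "\<And>i. i \<in> ?J \<Longrightarrow> M i i \<le> N i * (N i - 1)"
    and Merr: "\<And>i j. i \<in> ?J \<Longrightarrow> j \<in> ?J \<Longrightarrow>
      \<bar>real (M i j) - (real n)\<^sup>2 * m i * m j * w i j\<bar> \<le> 20 * (real k)\<^sup>2 * real n"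
    and M1: "\<And>i j. i \<in> {1..<k} \<Longrightarrow> j \<in> {1..<k} \<Longrightarrow> i \<noteq> j \<Longrightarrow>
      w i j * (real (N i) * real (N j)) - 1 < real (M i j)"
    and M2: "\<And>i. i \<in> {1..<k} \<Longrightarrow> w i i * (real (N i) * (real (N i) - 1)) - 2 < real (M i i)"
  proof (rule block_rounding[of k n m w p d])
    show "\<And>i. i \<in> {1..k} \<Longrightarrow> 0 \<le> m i" using m_pos less_imp_le by blast
  qed (use k n m_sum w rows d mk p ev in \<open>auto simp del: atLeastAtMost_iff\<close>)
  have "\<exists>\<beta>. \<beta> ` ?A \<subseteq> ?J \<and> (\<forall>i\<in>?J. card (cell ?A \<beta> i) = N i)"
    using N by (intro ex_labelling) auto
  then obtain \<beta> where \<beta>: "\<beta> ` ?A \<subseteq> ?J" "\<And>i. i \<in> ?J \<Longrightarrow> card (cell ?A \<beta> i) = N i" by blast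
  have Npos: "N i > 0" if "i \<in> ?J" for i
  proof -
    have "real (N i) \<ge> 1" using Nbd[OF that] m[OF that] by linarith
    then show ?thesis by simp
  qed
  have Nn: "N i \<le> n" if "i \<in> ?J" for i
    using member_le_sum[of i "{1..k}" N] that N by simp
  obtain T where T: "\<And>u. u \<in> ?A \<Longrightarrow> (\<Sum>j=1..k. T u j) = d"
    "\<And>i j. i \<in> ?J \<Longrightarrow> j \<in> ?J \<Longrightarrow> (\<Sum>u\<in>cell ?A \<beta> i. T u j) = M i j"
    "\<And>u j. u \<in> ?A \<Longrightarrow> j \<in> ?J \<Longrightarrow>
      T u j \<in> {M (\<beta> u) j div card (cell ?A \<beta> (\<beta> u)), M (\<beta> u) j div card (cell ?A \<beta> (\<beta> u)) + 1}"
    and prod: "(\<Prod>(i, j)\<in>{(i, j). 1 \<le> i \<and> i \<le> j \<and> j \<le> k}.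
        card (blk ?A \<beta> i j) choose (if i = j then M i j div 2 else M i j))
      \<le> (card ?A + 1) ^ (card ?A * k) * card (deg_graphs ?A ?J \<beta> T)"
  proof (rule prod_choose_le_deg_graphs[of ?A \<beta> k M d])
    show "cell ?A \<beta> i \<noteq> {}" if "i \<in> ?J" for i using \<beta>(2)[OF that] Npos[OF that] by auto
    show "(\<Sum>j=1..k. M i j) = card (cell ?A \<beta> i) * d" if "i \<in> ?J" for i
      using \<beta>(2)[OF that] Mrows[OF that] by simp
  qed (use \<beta> Msym Mev in blast)+
  define S where "S = deg_graphs ?A ?J \<beta> T"
  define l where "l = real n * ln (real n)"
  define C where "C = {(i, j). 1 \<le> i \<and> i \<le> j \<and> j \<le> k}"
  define B where "B = (\<lambda>(i, j). card (blk ?A \<beta> i j))"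
  define e where "e = (\<lambda>(i, j). if i = j then M i j div 2 else M i j)"
  define h :: "nat \<times> nat \<Rightarrow> real" where "h = (\<lambda>(i, j). if i = j then 1 / 2 else 1)"
  define g where "g = (\<lambda>(i, j). (real n)\<^sup>2 * (m i * m j))"
  define P where "P = (\<lambda>(i, j). Psi (w i j) (1 - w i j))"
  have l0: "0 \<le> l" using n by (simp add: l_def)
  have CJ: "C \<subseteq> ?J \<times> ?J" by (auto simp: C_def)
  then have fC: "finite C" by (rule finite_subset) simp
  have k2: "1 \<le> (real k)\<^sup>2" "real k \<le> (real k)\<^sup>2"
    using k one_le_power[of "real k" 2] self_le_power[of "real k" 2] by auto
  \<comment> \<open>With \<open>h c\<close> equal to 1/2 on the diagonal and \<open>g c\<close> the
    scaled area, \<open>B c\<close> and \<open>e c\<close> are \<open>h c * g c\<close> and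
    \<open>h c * g c * w i j\<close> up to 20 k^2 n. Taking 20 k^2 for the constant C of the
    binomial approximation gives 40 * 20 = 800.\<close>
  have eB: "e c \<le> B c" "\<bar>ln (real (B c choose e c)) - h c * g c * P c\<bar> \<le> 800 * (real k)\<^sup>2 * l"
    if c: "c \<in> C" for c
  proof -
    obtain i j where cij: "c = (i, j)" and ij: "i \<in> ?J" "j \<in> ?J" using c by (auto simp: C_def)
    note blk = card_blk[of ?A i j \<beta>, unfolded \<beta>(2)[OF ij(1)] \<beta>(2)[OF ij(2)]]
    have NN: "\<bar>real (N i) * real (N j) - (real n * m i) * (real n * m j)\<bar> \<le> 2 * real k * real n"
      using Nbd[OF ij(1)] Nbd[OF ij(2)] k Nn[OF ij(1)] m_pos[OF ij(2)] m_le_1[OF ij(2)]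
      by (intro abs_mult_diff_le) (auto simp: mult_left_le)
    have gij: "g c = (real n * m i) * (real n * m j)" by (simp add: g_def cij power2_eq_square)
    have hB: "\<bar>real (B c) - h c * g c\<bar> \<le> 20 * (real k)\<^sup>2 * real n"
    proof (cases "i = j")
      case True
      then have "2 * B c = N i * (N i - 1)" using blk by (simp add: B_def cij)
      then have "2 * real (B c) = real (N i * (N i - 1))" by (metis of_nat_mult of_nat_numeral)
      also have "\<dots> = real (N i) * real (N i) - real (N i)" by (cases "N i") (auto simp: algebra_simps)
      finally have "\<bar>2 * real (B c) - g c\<bar> \<le> 2 * real k * real n + real n"
        using NN True Nn[OF ij(1)] gij by (simp add: abs_le_iff)
      moreover have "real n \<le> (real k)\<^sup>2 * real n" "real k * real n \<le> (real k)\<^sup>2 * real n"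
        using k2 mult_right_mono[of 1 "(real k)\<^sup>2" "real n"] by (auto intro: mult_right_mono)
      ultimately show ?thesis using True by (simp add: h_def cij abs_le_iff)
    next
      case False
      then have "B c = N i * N j" using blk by (simp add: B_def cij)
      moreover have "real k * real n \<le> (real k)\<^sup>2 * real n" "0 \<le> (real k)\<^sup>2 * real n"
        using k2 by (auto intro: mult_right_mono)
      ultimately show ?thesis using NN False gij by (simp add: h_def cij)
    qed
    show ecB: "e c \<le> B c"
      using blk Mle[OF ij] Mdiag[OF ij(1)] by (cases "i = j") (auto simp: B_def e_def cij)
    have he: "\<bar>real (e c) - h c * g c * w i j\<bar> \<le> 20 * (real k)\<^sup>2 * real n"
    proof (cases "i = j")
      case True
      then have "2 * real (e c) = real (M i i)" using Mev[OF ij(1)] by (auto simp: e_def cij)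
      then show ?thesis using Merr[OF ij] True gij by (simp add: h_def cij power2_eq_square mult_ac abs_le_iff)
    next
      case False
      then show ?thesis using Merr[OF ij] gij by (simp add: e_def h_def cij power2_eq_square mult_ac)
    qed
    have g0: "0 \<le> h c * g c" using m_pos[OF ij(1)] m_pos[OF ij(2)] by (auto simp: h_def g_def cij)
    have w01: "0 \<le> w i j" "w i j \<le> 1" using w[OF ij] by auto
    have gn: "h c * g c \<le> (real n)\<^sup>2"
    proof -
      have "m i * m j \<le> 1" using m_pos[OF ij(1)] m_pos[OF ij(2)] m_le_1[OF ij(1)] m_le_1[OF ij(2)]
        by (simp add: mult_le_one)
      then have "g c \<le> (real n)\<^sup>2" by (simp add: g_def cij mult_left_le)
      moreover have "h c * g c \<le> 1 * g c"
        using m_pos[OF ij(1)] m_pos[OF ij(2)] by (intro mult_right_mono) (auto simp: h_def g_def cij)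
      ultimately show ?thesis by simp
    qed
    have Bn: "B c \<le> n\<^sup>2"
    proof -
      have "B c \<le> N i * N j" using blk
        by (cases "i = j") (auto simp: B_def cij intro: order_trans[of _ "2 * card (blk ?A \<beta> i j)"])
      also have "\<dots> \<le> n * n" using Nn[OF ij(1)] Nn[OF ij(2)] by (rule mult_le_mono)
      finally show ?thesis by (simp add: power2_eq_square)
    qed
    have "\<bar>ln (real (B c choose e c)) - Psi (h c * g c * w i j) (h c * g c * (1 - w i j))\<bar>
        \<le> 40 * (20 * (real k)\<^sup>2) * (real n * ln (real n))"
    proof (rule ln_choose_approx[OF n ecB Bn])
      have "h c * g c * w i j + h c * g c * (1 - w i j) = h c * g c" by (simp add: algebra_simps)
      then show "h c * g c * w i j + h c * g c * (1 - w i j) \<le> (real n)\<^sup>2"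
        "\<bar>real (B c) - (h c * g c * w i j + h c * g c * (1 - w i j))\<bar> \<le> 20 * (real k)\<^sup>2 * real n"
        using gn hB by simp_all
    qed (use he g0 w01 k2 in auto)
    also have "Psi (h c * g c * w i j) (h c * g c * (1 - w i j)) = h c * g c * P c"
      using Psi_scale[of "h c * g c" "w i j" "1 - w i j"] g0 w01 by (simp add: P_def cij)
    finally show "\<bar>ln (real (B c choose e c)) - h c * g c * P c\<bar> \<le> 800 * (real k)\<^sup>2 * l"
      by (simp add: l_def)
  qed
  have pos: "0 < B c choose e c" if "c \<in> C" for c using eB(1)[OF that] by simp
  have prod': "(\<Prod>c\<in>C. B c choose e c) \<le> (n + 1) ^ (n * k) * card S"
    using prod by (simp add: C_def B_def e_def S_def case_prod_unfold)
  have "0 < (\<Prod>c\<in>C. B c choose e c)" using pos by (simp add: prod_pos)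
  have S0: "0 < card S"
  proof (rule ccontr)
    assume "\<not> 0 < card S"
    then have "(n + 1) ^ (n * k) * card S = 0" by (simp only: not_gr_zero mult_0_right)
    then show False using prod' \<open>0 < (\<Prod>c\<in>C. B c choose e c)\<close> by linarith
  qed
  have "real (\<Prod>c\<in>C. B c choose e c) \<le> real ((n + 1) ^ (n * k) * card S)"
    using prod' by (simp only: of_nat_le_iff)
  moreover have "0 < real (\<Prod>c\<in>C. B c choose e c)"
    using \<open>0 < (\<Prod>c\<in>C. B c choose e c)\<close> by (simp only: of_nat_0_less_iff)
  ultimately have "ln (real (\<Prod>c\<in>C. B c choose e c)) \<le> ln (real ((n + 1) ^ (n * k) * card S))"
    by (subst ln_le_cancel_iff) linarith+
  also have "\<dots> = real (n * k) * ln (real n + 1) + ln (real (card S))"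
    using S0 by (simp add: ln_mult ln_realpow)
  finally have 1: "ln (real (\<Prod>c\<in>C. B c choose e c)) \<le> real (n * k) * ln (real n + 1) + ln (real (card S))" .
  have "ln (real n + 1) \<le> ln ((real n)\<^sup>2)"
    using n by (subst ln_le_cancel_iff) (auto simp: power2_eq_square intro: order_trans[of _ "3 * real n"])
  then have "ln (real n + 1) \<le> 2 * ln (real n)" using n by (simp add: ln_realpow)
  then have "real (n * k) * ln (real n + 1) \<le> real (n * k) * (2 * ln (real n))" by (rule mult_left_mono) simp
  then have 2: "real (n * k) * ln (real n + 1) \<le> 2 * real k * l" by (simp add: l_def mult_ac)
  have 3: "ln (real (\<Prod>c\<in>C. B c choose e c)) = (\<Sum>c\<in>C. ln (real (B c choose e c)))"
    unfolding of_nat_prod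
  proof (rule ln_prod[OF fC])
    fix c assume "c \<in> C"
    then show "real (B c choose e c) \<noteq> 0" using pos[of c] by (metis less_irrefl of_nat_eq_0_iff)
  qed
  have "card C \<le> card (?J \<times> ?J)" using CJ by (intro card_mono) auto
  then have cC: "real (card C) \<le> (real k)\<^sup>2"
    by (simp add: power2_eq_square card_cartesian_product flip: of_nat_mult)
  have "(\<Sum>c\<in>C. h c * g c * P c - 800 * (real k)\<^sup>2 * l) \<le> (\<Sum>c\<in>C. ln (real (B c choose e c)))"
    using eB(2) by (intro sum_mono) (fastforce simp: abs_le_iff)
  moreover have "real (card C) * (800 * (real k)\<^sup>2 * l) \<le> (real k)\<^sup>2 * (800 * (real k)\<^sup>2 * l)"
    using cC l0 by (intro mult_right_mono) auto
  ultimately have 4: "(\<Sum>c\<in>C. h c * g c * P c) - 800 * real k ^ 4 * l \<le> (\<Sum>c\<in>C. ln (real (B c choose e c)))"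
    by (simp add: sum_subtractf power4_eq_xxxx power2_eq_square mult_ac)
  have 5: "(\<Sum>c\<in>C. h c * g c * P c) = (1/2) * (real n)\<^sup>2 * (\<Sum>i=1..k. \<Sum>j=1..k. m i * m j * Psi (w i j) (1 - w i j))"
  proof -
    have "(\<Sum>c\<in>C. h c * g c * P c) = (\<Sum>(i, j)\<in>C. (if i = j then 1 / 2 else 1) *
        ((real n)\<^sup>2 * (m i * m j) * Psi (w i j) (1 - w i j)))"
      by (intro sum.cong) (auto simp: h_def g_def P_def)
    also have "\<dots> = (1/2) * (\<Sum>i=1..k. \<Sum>j=1..k. (real n)\<^sup>2 * (m i * m j) * Psi (w i j) (1 - w i j))"
      unfolding C_def using w by (intro sum_upper_triangle) (auto simp: mult.commute)
    finally show ?thesis by (simp add: sum_distrib_left mult_ac)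
  qed
  have reg: "finite (regular_graphs n d)" "card (regular_graphs n d) \<le> ((n choose 2) choose (d * n div 2))"
    using card_regular_le_choose[OF ev] by auto
  have sub: "S \<subseteq> regular_graphs n d"
  proof
    fix G assume G: "G \<in> S"
    then have GA: "G \<subseteq> pairs ?A" by (simp add: S_def deg_graphs_def)
    moreover have "card {e \<in> G. v \<in> e} = d" if "v \<in> ?A" for v
      using card_edges_at[of ?A G ?J \<beta> T v] G \<beta>(1) that T(1) by (simp add: S_def)
    ultimately show "G \<in> regular_graphs n d"
      by (auto simp: regular_graphs_def simple_graph_def pairs_def)
  qed
  have c0: "0 < card (regular_graphs n d)"
    using S0 card_mono[OF reg(1) sub] by linarith
  have "\<bar>ln (real ((n choose 2) choose (d * n div 2))) - Psi ((1/2) * (real n)\<^sup>2 * p) ((1/2) * (real n)\<^sup>2 * (1 - p))\<bar>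
      \<le> 40 * 1 * (real n * ln (real n))"
  proof (rule ln_choose_approx[OF n])
    have "d \<le> n - 1"
    proof -
      have "real d \<le> (1/4) * real n" unfolding d using p by (intro mult_right_mono) auto
      then have "real d \<le> real n - 1" using n by simp
      then show ?thesis by linarith
    qed
    have "d * n \<le> (n - 1) * n" using \<open>d \<le> n - 1\<close> by (rule mult_right_mono) simp
    then show "d * n div 2 \<le> n choose 2" by (simp add: choose_two div_le_mono mult.commute)
    have "even (n * (n - 1))" by (cases n) auto
    then have c2: "2 * (n choose 2) = n * (n - 1)" by (simp add: choose_two)
    have r: "2 * real (n choose 2) = real n * real n - real n"
    proof -
      have "2 * real (n choose 2) = real (n * (n - 1))" using c2 by (metis of_nat_mult of_nat_numeral)
      then show ?thesis using n by (simp add: of_nat_diff algebra_simps)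
    qed
    show "n choose 2 \<le> n\<^sup>2"
    proof -
      have "real (n choose 2) \<le> real (n\<^sup>2)"
        using r by (simp add: power2_eq_square)
      then show ?thesis by (simp only: of_nat_le_iff)
    qed
    have half: "(1/2) * (real n)\<^sup>2 * p + (1/2) * (real n)\<^sup>2 * (1 - p) = (1/2) * (real n)\<^sup>2"
      by (simp add: field_simps)
    show "(1/2) * (real n)\<^sup>2 * p + (1/2) * (real n)\<^sup>2 * (1 - p) \<le> (real n)\<^sup>2"
      unfolding half by simp
    have "2 * (d * n div 2) = d * n" using ev by simp
    then have "2 * real (d * n div 2) = real d * real n" by (metis of_nat_mult of_nat_numeral)
    then have "real (d * n div 2) = (1/2) * (real n)\<^sup>2 * p" using d by (simp add: power2_eq_square mult_ac)
    then show "\<bar>real (d * n div 2) - (1/2) * (real n)\<^sup>2 * p\<bar> \<le> 1 * real n"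
      by simp
    show "\<bar>real (n choose 2) - ((1/2) * (real n)\<^sup>2 * p + (1/2) * (real n)\<^sup>2 * (1 - p))\<bar> \<le> 1 * real n"
      unfolding half using r by (simp add: power2_eq_square abs_le_iff)
  qed (use p in auto)
  moreover have "ln (real (card (regular_graphs n d))) \<le> ln (real ((n choose 2) choose (d * n div 2)))"
  proof -
    have "ln (real a) \<le> ln (real b)" if "0 < a" "a \<le> b" for a b :: nat
      using that by (subst ln_le_cancel_iff) auto
    then show ?thesis using c0 reg(2) by blast
  qed
  moreover have "Psi ((1/2) * (real n)\<^sup>2 * p) ((1/2) * (real n)\<^sup>2 * (1 - p)) = (1/2) * (real n)\<^sup>2 * Psi p (1 - p)"
    using p by (intro Psi_scale) auto
  ultimately have 6: "ln (real (card (regular_graphs n d))) \<le> (1/2) * (real n)\<^sup>2 * Psi p (1 - p) + 40 * l"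
    by (simp add: l_def abs_le_iff)
  \<comment> \<open>Error budget in units of l: 800 k^4 from at most k^2 blocks, 2 k from the number
    of degree matrices, 40 from the count of all regular graphs; together at most 900 k^4.\<close>
  have k4: "1 * l \<le> real k ^ 4 * l" "real k * l \<le> real k ^ 4 * l"
    by (rule mult_right_mono[OF _ l0], use k one_le_power[of "real k" 4] self_le_power[of "real k" 4] in simp)+
  have "ln (real (card (regular_graphs n d))) - ln (real (card S))
      \<le> (1/2) * ent * (real n)\<^sup>2 + 900 * real k ^ 4 * l"
  proof -
    have "(1/2) * ent * (real n)\<^sup>2 = (1/2) * (real n)\<^sup>2 * Psi p (1 - p) -
      (1/2) * (real n)\<^sup>2 * (\<Sum>i=1..k. \<Sum>j=1..k. m i * m j * Psi (w i j) (1 - w i j))"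
      unfolding ent_eq by (simp add: algebra_simps)
    moreover have "2 * real k * l = 2 * (real k * l)" "900 * real k ^ 4 * l = 900 * (real k ^ 4 * l)"
      "800 * real k ^ 4 * l = 800 * (real k ^ 4 * l)" by simp_all
    ultimately show ?thesis using 1 2 3 4 5 6 k4 l0 by linarith
  qed
  then show ?thesis
    using that[of \<beta> N M T] \<beta> Nbd Msym Merr M1 M2 Mev T(2) T(3) sub S0
    unfolding S_def l_def by (smt (verit, ccfv_threshold) imageI subset_eq)
qed

end

section \<open>The first moment of a single block assignment\<close>


text \<open>With x = M / a, y = M / b and r = M / (a b) one has x y M = r M^2. Three factors 1 -
  \<delta> replace the truncated counts by x, y and M, and the switching inequality becomes X (1 -
  \<delta>)^3 r \<le> Y. A fourth factor passes from r to w; the fifth, with w \<le> \<delta>,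
  passes from the ratio Y / X to the proportion Y / (X + Y). Bernoulli's inequality turns the five
  factors into 1 - 5 \<delta>.\<close>

lemma switching_ratio:
  fixes X Y Du Dv \<Delta>1 \<Delta>2 M t a b :: nat and \<delta> w :: real
  assumes ineq: "X * ((Du - t) * ((Dv - (t + 1)) * (M - (2 * t + 4 * \<Delta>1 + 4 * \<Delta>2 + 2 * \<Delta>1 * \<Delta>2)))) \<le> Y * (M * M)"
    and \<delta>: "0 < \<delta>" "\<delta> \<le> 1/10"
    and D: "real M / real a - 1 \<le> real Du" "real M / real b - 1 \<le> real Dv"
    and \<Delta>: "real \<Delta>1 \<le> real M / real a + 1" "real \<Delta>2 \<le> real M / real b + 1"
    and big: "real t + 2 \<le> \<delta> * (real M / real a)" "real t + 2 \<le> \<delta> * (real M / real b)"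
    and ab: "40 \<le> \<delta> * real a" "40 \<le> \<delta> * real b"
    and ratio: "40 * (real M / (real a * real b)) \<le> \<delta>" "(1 - \<delta>) * w \<le> real M / (real a * real b)"
    and w: "0 \<le> w" "w \<le> \<delta>"
  shows "(1 - 5 * \<delta>) * w * (real X + real Y) \<le> real Y"
proof -
  define x y r where "x = real M / real a" and "y = real M / real b" and "r = real M / (real a * real b)"
  have a0: "0 < real a" "0 < real b"
    using ab \<delta> by (auto intro!: Nat.gr0I)
  have xy1: "1 \<le> x" "1 \<le> y"
  proof -
    have "1 \<le> \<delta> * x" "1 \<le> \<delta> * y" using big by (auto simp: x_def y_def)
    moreover have "\<delta> * x \<le> 1 * x" "\<delta> * y \<le> 1 * y"
      using \<delta> by (intro mult_right_mono; simp add: x_def y_def)+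
    ultimately show "1 \<le> x" "1 \<le> y" by auto
  qed
  have M0: "0 < real M" using xy1 a0 by (auto simp: x_def intro!: Nat.gr0I)
  have xyr: "x * y = real M * r" by (simp add: x_def y_def r_def)
  have r0: "0 < r" using M0 a0 by (simp add: r_def)
  have x\<delta>: "40 * x \<le> \<delta> * real M"
  proof -
    have "x * 40 \<le> x * (\<delta> * real a)" using ab xy1 by (intro mult_left_mono) auto
    then show ?thesis using a0 by (simp add: x_def mult_ac)
  qed
  have y\<delta>: "40 * y \<le> \<delta> * real M"
  proof -
    have "y * 40 \<le> y * (\<delta> * real b)" using ab xy1 by (intro mult_left_mono) auto
    then show ?thesis using a0 by (simp add: y_def mult_ac)
  qed
  have "(1 - \<delta>) * x = x - \<delta> * x" "(1 - \<delta>) * y = y - \<delta> * y" by (simp_all add: algebra_simps)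
  then have Du: "(1 - \<delta>) * x \<le> real (Du - t)" and Dv: "(1 - \<delta>) * y \<le> real (Dv - (t + 1))"
    using D big unfolding x_def[symmetric] y_def[symmetric] by linarith+
  have DD: "real \<Delta>1 * real \<Delta>2 \<le> (2 * x) * (2 * y)"
    using \<Delta> xy1 by (intro mult_mono) (auto simp: x_def y_def)
  have rM: "40 * (real M * r) \<le> \<delta> * real M"
    using mult_right_mono[OF ratio(1), of "real M"] by (simp add: r_def mult_ac)
  \<comment> \<open>The losses are at most 2 x + 8 x + 8 y + 8 M r, and each of x, y and M r is at
    most \<delta> M / 40. This fixes the constant 40 in the hypotheses.\<close>
  have Q: "(1 - \<delta>) * real M \<le> real (M - (2 * t + 4 * \<Delta>1 + 4 * \<Delta>2 + 2 * \<Delta>1 * \<Delta>2))"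
  proof -
    have "2 * real t \<le> 2 * x" 
    proof -
      have "real t \<le> \<delta> * x" using big by (simp add: x_def)
      also have "\<dots> \<le> 1 * x" using \<delta> xy1 by (intro mult_right_mono) auto
      finally show ?thesis by simp
    qed
    moreover have "real \<Delta>1 \<le> 2 * x" "real \<Delta>2 \<le> 2 * y" using \<Delta> xy1 by (auto simp: x_def y_def)
    moreover have "real \<Delta>1 * real \<Delta>2 \<le> 4 * (real M * r)"
    proof -
      have "(2 * x) * (2 * y) = 4 * (x * y)" by simp
      then show ?thesis using DD xyr by linarith
    qed
    ultimately have "2 * real t + 4 * real \<Delta>1 + 4 * real \<Delta>2 + 2 * (real \<Delta>1 * real \<Delta>2) \<le> \<delta> * real M"
      using x\<delta> y\<delta> rM by linarith
    then have "real (2 * t + 4 * \<Delta>1 + 4 * \<Delta>2 + 2 * \<Delta>1 * \<Delta>2) \<le> \<delta> * real M" by simp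
    moreover have "(1 - \<delta>) * real M = real M - \<delta> * real M" by (simp add: algebra_simps)
    moreover have "real M - real z \<le> real (M - z)" for z by linarith
    ultimately show ?thesis by (metis (no_types, lifting) diff_left_mono order_trans)
  qed
  have d1: "0 \<le> 1 - \<delta>" using \<delta> by simp
  have "(1 - \<delta>) ^ 3 * (x * y * real M) = ((1 - \<delta>) * x) * (((1 - \<delta>) * y) * ((1 - \<delta>) * real M))"
    by (simp add: power3_eq_cube)
  also have "\<dots> \<le> real (Du - t) * (real (Dv - (t + 1)) * real (M - (2 * t + 4 * \<Delta>1 + 4 * \<Delta>2 + 2 * \<Delta>1 * \<Delta>2)))"
    using Du Dv Q d1 xy1 by (intro mult_mono mult_nonneg_nonneg) auto
  finally have "real X * ((1 - \<delta>) ^ 3 * (x * y * real M)) \<le>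
     real X * (real (Du - t) * (real (Dv - (t + 1)) * real (M - (2 * t + 4 * \<Delta>1 + 4 * \<Delta>2 + 2 * \<Delta>1 * \<Delta>2))))"
    by (intro mult_left_mono) auto
  also have "\<dots> \<le> real Y * (real M * real M)"
    using ineq by (metis of_nat_le_iff of_nat_mult)
  finally have "(real X * ((1 - \<delta>) ^ 3 * r)) * (real M * real M) \<le> real Y * (real M * real M)"
    unfolding xyr by (simp add: mult_ac)
  then have 1: "real X * ((1 - \<delta>) ^ 3 * r) \<le> real Y"
    using M0 by (simp add: mult_le_cancel_right_pos)
  define c where "c = (1 - \<delta>) ^ 4 * w"
  have "real X * c = real X * ((1 - \<delta>) ^ 3 * ((1 - \<delta>) * w))" by (simp add: c_def power3_eq_cube power4_eq_xxxx mult_ac)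
  also have "\<dots> \<le> real X * ((1 - \<delta>) ^ 3 * r)"
    using ratio(2) d1 by (intro mult_left_mono) (auto simp: r_def)
  finally have 2: "real X * c \<le> real Y" using 1 by linarith
  have c: "0 \<le> c" "c \<le> \<delta>"
  proof -
    show "0 \<le> c" using d1 w by (simp add: c_def)
    have "c \<le> 1 * w" unfolding c_def using d1 \<delta> w by (intro mult_right_mono power_le_one) auto
    then show "c \<le> \<delta>" using w by simp
  qed
  have "1 - 5 * \<delta> \<le> (1 - \<delta>) ^ 5"
    using Bernoulli_inequality[of "- \<delta>" 5] \<delta> by simp
  then have "(1 - 5 * \<delta>) * (w * (real X + real Y)) \<le> (1 - \<delta>) ^ 5 * (w * (real X + real Y))"
    using w by (intro mult_right_mono) auto
  also have "\<dots> = (1 - \<delta>) * (real X * c + c * real Y)"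
    by (simp add: c_def power_numeral_reduce algebra_simps)
  also have "\<dots> \<le> (1 - \<delta>) * (real Y + \<delta> * real Y)"
    using 2 c d1 by (intro mult_left_mono add_mono mult_right_mono) auto
  also have "\<dots> = (1 - \<delta>\<^sup>2) * real Y" by (simp add: algebra_simps power2_eq_square)
  also have "\<dots> \<le> 1 * real Y" by (intro mult_right_mono) auto
  finally show ?thesis by (simp add: mult.assoc)
qed

text \<open>A vertex of X spoils at most \<Delta>1 pairs as first entry and at most \<Delta>2 as
  second entry. The bound holds in every graph of the family, not just on average.\<close>

lemma adj_avoiding:
  fixes T :: "'a \<Rightarrow> 'b \<Rightarrow> nat"
  assumes A: "finite A" and G: "G \<in> deg_graphs A J \<beta> T" and ij: "i \<in> J" "j \<in> J"
    and \<Delta>1: "\<And>u. u \<in> cell A \<beta> i \<Longrightarrow> T u j \<le> \<Delta>1" and \<Delta>2: "\<And>u. u \<in> cell A \<beta> j \<Longrightarrow> T u i \<le> \<Delta>2"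
    and M: "(\<Sum>u\<in>cell A \<beta> i. T u j) = M" and X: "finite X" "card X \<le> v"
  shows "M - v * (\<Delta>1 + \<Delta>2) \<le> card {(x, y) \<in> adj \<beta> G i j. x \<notin> X \<and> y \<notin> X}"
proof -
  have GA: "G \<subseteq> pairs A" and deg: "\<And>u l. u \<in> A \<Longrightarrow> l \<in> J \<Longrightarrow> card (nbrs \<beta> G u l) = T u l"
    using G by (auto simp: deg_graphs_def)
  define P where "P = Sigma (X \<inter> cell A \<beta> i) (\<lambda>x. nbrs \<beta> G x j)"
  define Q where "Q = prod.swap ` Sigma (X \<inter> cell A \<beta> j) (\<lambda>y. nbrs \<beta> G y i)"
  have le: "finite (Sigma (X \<inter> R) (\<lambda>x. nbrs \<beta> G x l)) \<and> card (Sigma (X \<inter> R) (\<lambda>x. nbrs \<beta> G x l)) \<le> v * \<Delta>"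
    if "\<And>x. x \<in> R \<Longrightarrow> card (nbrs \<beta> G x l) \<le> \<Delta>" for R l \<Delta>
  proof -
    have "card (Sigma (X \<inter> R) (\<lambda>x. nbrs \<beta> G x l)) = (\<Sum>x\<in>X \<inter> R. card (nbrs \<beta> G x l))"
      using X finite_nbrs[OF A GA] by (intro card_SigmaI) auto
    also have "\<dots> \<le> (\<Sum>x\<in>X \<inter> R. \<Delta>)" using that by (intro sum_mono) auto
    also have "\<dots> \<le> v * \<Delta>" using X card_mono[of X "X \<inter> R"] by (simp add: order_trans)
    finally have "card (Sigma (X \<inter> R) (\<lambda>x. nbrs \<beta> G x l)) \<le> v * \<Delta>" .
    moreover have "finite (Sigma (X \<inter> R) (\<lambda>x. nbrs \<beta> G x l))"
      using X(1) by (intro finite_SigmaI finite_nbrs[OF A GA]) simp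
    ultimately show ?thesis by blast
  qed
  have P: "finite P \<and> card P \<le> v * \<Delta>1"
    unfolding P_def using \<Delta>1 deg ij by (intro le) (auto simp: cell_def)
  have "finite Q \<and> card Q \<le> v * \<Delta>2"
    unfolding Q_def using le[of "cell A \<beta> j" i \<Delta>2] \<Delta>2 deg ij by (auto simp: card_image cell_def)
  then have PQ: "finite (P \<union> Q)" "card (P \<union> Q) \<le> v * (\<Delta>1 + \<Delta>2)"
    using P card_Un_le[of P Q] by (auto simp: algebra_simps)
  have fadj: "finite (adj \<beta> G i j)"
    using adj_subset[OF GA] by (rule finite_subset) (simp add: finite_cell[OF A])
  have "card (adj \<beta> G i j) = M"
    unfolding card_adj[OF A GA] M[symmetric] using deg ij by (intro sum.cong) (auto simp: cell_def)
  then have "M - v * (\<Delta>1 + \<Delta>2) \<le> card (adj \<beta> G i j) - card (P \<union> Q)" using PQ by simp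
  also have "\<dots> \<le> card (adj \<beta> G i j - (P \<union> Q))" using PQ by (intro diff_card_le_card_Diff)
  also have "\<dots> \<le> card {(x, y) \<in> adj \<beta> G i j. x \<notin> X \<and> y \<notin> X}"
  proof (rule card_mono)
    show "finite {(x, y) \<in> adj \<beta> G i j. x \<notin> X \<and> y \<notin> X}" by (rule finite_subset[OF _ fadj]) auto
    show "adj \<beta> G i j - (P \<union> Q) \<subseteq> {(x, y) \<in> adj \<beta> G i j. x \<notin> X \<and> y \<notin> X}"
    proof
      fix z assume z: "z \<in> adj \<beta> G i j - (P \<union> Q)"
      obtain x y where xy: "z = (x, y)" by (cases z)
      have e: "{x, y} \<in> G" "x \<in> cell A \<beta> i" "y \<in> cell A \<beta> j" "\<beta> x = i" "\<beta> y = j"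
        using z adj_subset[OF GA, of \<beta> i j] by (auto simp: xy adj_def)
      have "x \<notin> X" using z e by (auto simp: xy P_def nbrs_def)
      moreover have "y \<notin> X"
      proof
        assume "y \<in> X"
        then have "(y, x) \<in> Sigma (X \<inter> cell A \<beta> j) (\<lambda>y. nbrs \<beta> G y i)"
          using e by (auto simp: nbrs_def insert_commute)
        then have "(x, y) \<in> Q" unfolding Q_def by force
        then show False using z by (simp add: xy)
      qed
      ultimately show "z \<in> {(x, y) \<in> adj \<beta> G i j. x \<notin> X \<and> y \<notin> X}" using z by (simp add: xy)
    qed
  qed
  finally show ?thesis .
qed

text \<open>A block with at least as many edges as it has vertex pairs contains all of them. This
  turns the exact count in a block of weight 1 into the presence of each single edge.\<close>

lemma complete_block:
  assumes A: "finite A" and G: "G \<subseteq> pairs A"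
    and c: "card (adj \<beta> G i j) \<ge> (if i = j then card (cell A \<beta> i) * (card (cell A \<beta> i) - 1)
      else card (cell A \<beta> i) * card (cell A \<beta> j))"
    and xy: "x \<in> cell A \<beta> i" "y \<in> cell A \<beta> j" "x \<noteq> y"
  shows "{x, y} \<in> G"
proof -
  have fb: "finite (blk A \<beta> i j)" using finite_pairs[OF A] by (auto simp: blk_def)
  have "card (blk A \<beta> i j) \<le> card (G \<inter> blk A \<beta> i j)"
    using c card_blk[OF A, of i j \<beta>] card_adj_blk[OF A G, of \<beta> i j] by (auto split: if_splits)
  then have "G \<inter> blk A \<beta> i j = blk A \<beta> i j"
    using fb by (intro card_seteq) auto
  moreover have "{x, y} \<in> blk A \<beta> i j" using xy by (auto simp: blk_def cell_def pairs_def)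
  ultimately show ?thesis by blast
qed


text \<open>A and B stand for the ideal cell sizes, a and b for the rounded ones, M for the rounded
  edge count. The loss 3 \<epsilon> reflects (1 - \<epsilon>) / (1 + \<epsilon>)^2 \<ge> 1 - 3
  \<epsilon>; the bounds with a factor 2 serve only the largeness and smallness conditions of the
  switching estimate.\<close>

lemma edge_density_bounds:
  fixes a b M A B w \<epsilon> :: real
  assumes pos: "0 < A" "0 < B" "0 < w" and \<epsilon>: "0 < \<epsilon>" "\<epsilon> \<le> 1/100"
    and a: "(1 - \<epsilon>) * A \<le> a" "a \<le> (1 + \<epsilon>) * A" and b: "(1 - \<epsilon>) * B \<le> b" "b \<le> (1 + \<epsilon>) * B"
    and M: "\<bar>M - w * (A * B)\<bar> \<le> \<epsilon> * (w * (A * B))"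
  shows "w * B / 2 \<le> M / a" "w * A / 2 \<le> M / b" "M / (a * b) \<le> 2 * w" "(1 - 3 * \<epsilon>) * w \<le> M / (a * b)"
proof -
  have P: "0 < w * (A * B)" using pos by simp
  have Ml: "(1 - \<epsilon>) * (w * (A * B)) \<le> M" and Mu: "M \<le> (1 + \<epsilon>) * (w * (A * B))"
    using M by (auto simp: abs_le_iff algebra_simps)
  have "0 < (1 - \<epsilon>) * A" "0 < (1 - \<epsilon>) * B" using pos \<epsilon> by auto
  then have ab0: "0 < a" "0 < b" using a b by linarith+
  have e1: "(1 / 2) * (1 + \<epsilon>) \<le> 1 - \<epsilon>" using \<epsilon> by simp
  have half: "(1 / 2) * (1 + \<epsilon>) * (w * (A * B)) \<le> (1 - \<epsilon>) * (w * (A * B))"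
    using e1 P by (intro mult_right_mono) auto
  have "w * B / 2 * a \<le> w * B / 2 * ((1 + \<epsilon>) * A)" using a pos by (intro mult_left_mono) auto
  also have "\<dots> = (1 / 2) * (1 + \<epsilon>) * (w * (A * B))" by simp
  also have "\<dots> \<le> M" using half Ml by linarith
  finally show "w * B / 2 \<le> M / a" using ab0 by (simp add: pos_le_divide_eq)
  have "w * A / 2 * b \<le> w * A / 2 * ((1 + \<epsilon>) * B)" using b pos by (intro mult_left_mono) auto
  also have "\<dots> = (1 / 2) * (1 + \<epsilon>) * (w * (A * B))" by simp
  also have "\<dots> \<le> M" using half Ml by linarith
  finally show "w * A / 2 \<le> M / b" using ab0 by (simp add: pos_le_divide_eq)
  have "1 + \<epsilon> \<le> 2 * ((1 - \<epsilon>) * (1 - \<epsilon>))"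
  proof -
    have "2 * ((1 - \<epsilon>) * (1 - \<epsilon>)) = 2 - 4 * \<epsilon> + 2 * (\<epsilon> * \<epsilon>)" by (simp add: algebra_simps)
    moreover have "0 \<le> \<epsilon> * \<epsilon>" by simp
    ultimately show ?thesis using \<epsilon> by linarith
  qed
  then have "(1 + \<epsilon>) * (w * (A * B)) \<le> 2 * ((1 - \<epsilon>) * (1 - \<epsilon>)) * (w * (A * B))"
    using P by (intro mult_right_mono) auto
  also have "\<dots> = 2 * w * (((1 - \<epsilon>) * A) * ((1 - \<epsilon>) * B))" by (simp add: mult_ac)
  also have "\<dots> \<le> 2 * w * (a * b)"
    using a b pos \<epsilon> ab0 by (intro mult_left_mono mult_mono) auto
  finally show "M / (a * b) \<le> 2 * w" using Mu ab0 by (simp add: pos_divide_le_eq)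
  have "(1 - 3 * \<epsilon>) * ((1 + \<epsilon>) * (1 + \<epsilon>)) \<le> 1 - \<epsilon>"
  proof -
    have "(1 - 3 * \<epsilon>) * ((1 + \<epsilon>) * (1 + \<epsilon>)) = 1 - \<epsilon> - 5 * (\<epsilon> * \<epsilon>) - 3 * (\<epsilon> * \<epsilon> * \<epsilon>)"
      by (simp add: algebra_simps)
    moreover have "0 \<le> \<epsilon> * \<epsilon>" "0 \<le> \<epsilon> * \<epsilon> * \<epsilon>" using \<epsilon> by auto
    ultimately show ?thesis by linarith
  qed
  then have e3: "(1 - 3 * \<epsilon>) * ((1 + \<epsilon>) * (1 + \<epsilon>)) * (w * (A * B)) \<le> (1 - \<epsilon>) * (w * (A * B))"
    using P by (intro mult_right_mono) auto
  have "(1 - 3 * \<epsilon>) * w * (a * b) \<le> (1 - 3 * \<epsilon>) * w * (((1 + \<epsilon>) * A) * ((1 + \<epsilon>) * B))"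
    using a b pos \<epsilon> ab0 by (intro mult_left_mono mult_mono) auto
  also have "\<dots> = (1 - 3 * \<epsilon>) * ((1 + \<epsilon>) * (1 + \<epsilon>)) * (w * (A * B))" by (simp add: mult_ac)
  also have "\<dots> \<le> M" using e3 Ml by linarith
  finally show "(1 - 3 * \<epsilon>) * w \<le> M / (a * b)" using ab0 by (simp add: pos_le_divide_eq)
qed

text \<open>Of the loss 7 \<epsilon>, two parts come from rounding M, three from pairs meeting the v
  used vertices, and two from rounding the cell sizes. Largeness of w a, which Condition (9)
  provides, makes the + 1 in the two maximal degrees negligible even after multiplication by
  v.\<close>

lemma matching_edge_bound:
  fixes a b v M :: nat and A B w \<epsilon> s :: real
  assumes \<epsilon>: "0 < \<epsilon>" "\<epsilon> \<le> 1/100" and w: "0 \<le> w" and AB: "0 < A" "0 < B"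
    and a: "(1 - \<epsilon>) * A \<le> real a" and b: "(1 - \<epsilon>) * B \<le> real b"
    and v: "real v + 2 \<le> \<epsilon> * real a" "real v + 2 \<le> \<epsilon> * real b" "2 * real v + 2 \<le> \<epsilon> * (w * real a)"
    and M: "w * (real a * real b) - w * real a - 2 \<le> real M"
  shows "(1 - 7 * \<epsilon>) * (w * (A * B)) \<le> real (M - v * ((M div a + 1) + (M div b + 1)))"
proof -
  define P where "P = w * (real a * real b)"
  have a0: "0 < real a" "0 < real b" using v \<epsilon> by (auto intro!: Nat.gr0I)
  then have b1: "1 \<le> real b" by simp
  have P0: "0 \<le> P" using w by (simp add: P_def)
  have wa: "w * real a \<le> \<epsilon> * P"
  proof -
    have "w * real a * 1 \<le> w * real a * (\<epsilon> * real b)" using v w by (intro mult_left_mono) auto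
    then show ?thesis by (simp add: P_def mult_ac)
  qed
  have v2: "2 * real v + 2 \<le> \<epsilon> * P"
  proof -
    have "\<epsilon> * (w * real a) * 1 \<le> \<epsilon> * (w * real a) * real b" using b1 w \<epsilon> by (intro mult_left_mono) auto
    then show ?thesis using v(3) by (simp add: P_def mult_ac)
  qed
  have M1: "(1 - 2 * \<epsilon>) * P \<le> real M"
    using M wa v2 by (simp add: P_def[symmetric] algebra_simps)
  have va: "real v * (real M / real a) \<le> \<epsilon> * real M"
  proof -
    have "real v * real M \<le> (\<epsilon> * real a) * real M" using v by (intro mult_right_mono) auto
    then show ?thesis using a0 by (simp add: field_simps)
  qed
  have vb: "real v * (real M / real b) \<le> \<epsilon> * real M"
  proof -
    have "real v * real M \<le> (\<epsilon> * real b) * real M" using v by (intro mult_right_mono) auto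
    then show ?thesis using a0 by (simp add: field_simps)
  qed
  have "real (M div a) \<le> real M / real a" "real (M div b) \<le> real M / real b"
    by (simp_all add: of_nat_div_le_of_nat)
  then have "real v * (real (M div a) + real (M div b) + 2) \<le> real v * (real M / real a + real M / real b + 2)"
    by (intro mult_left_mono) auto
  also have "\<dots> \<le> 2 * \<epsilon> * real M + \<epsilon> * P" using va vb v2 by (simp add: algebra_simps)
  finally have "real M - real v * (real (M div a) + real (M div b) + 2) \<ge> (1 - 2 * \<epsilon>) * real M - \<epsilon> * P"
    by (simp add: algebra_simps)
  moreover have "(1 - 2 * \<epsilon>) * ((1 - 2 * \<epsilon>) * P) \<le> (1 - 2 * \<epsilon>) * real M"
    using M1 \<epsilon> by (intro mult_left_mono) auto
  moreover have "(1 - 2 * \<epsilon>) * ((1 - 2 * \<epsilon>) * P) = (1 - 4 * \<epsilon>) * P + 4 * (\<epsilon> * \<epsilon> * P)"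
    by (simp add: algebra_simps)
  moreover have "0 \<le> \<epsilon> * \<epsilon> * P" using P0 by simp
  moreover have "(1 - 5 * \<epsilon>) * P = (1 - 4 * \<epsilon>) * P - \<epsilon> * P" by (simp add: algebra_simps)
  ultimately have 1: "(1 - 5 * \<epsilon>) * P \<le> real M - real v * (real (M div a) + real (M div b) + 2)" by linarith
  have 2: "real M - real v * (real (M div a) + real (M div b) + 2)
      \<le> real (M - v * ((M div a + 1) + (M div b + 1)))"
  proof -
    have "real v * (real (M div a) + real (M div b) + 2) = real (v * ((M div a + 1) + (M div b + 1)))"
      by (simp add: algebra_simps)
    then show ?thesis by linarith
  qed
  have "(1 - 7 * \<epsilon>) \<le> (1 - 5 * \<epsilon>) * ((1 - \<epsilon>) * (1 - \<epsilon>))"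
  proof -
    have "(1 - 5 * \<epsilon>) * ((1 - \<epsilon>) * (1 - \<epsilon>)) = 1 - 7 * \<epsilon> + (\<epsilon> * \<epsilon>) * (11 - 5 * \<epsilon>)"
      by (simp add: algebra_simps)
    moreover have "0 \<le> (\<epsilon> * \<epsilon>) * (11 - 5 * \<epsilon>)" using \<epsilon> by (intro mult_nonneg_nonneg) auto
    ultimately show ?thesis by linarith
  qed
  then have "(1 - 7 * \<epsilon>) * (w * (A * B)) \<le> (1 - 5 * \<epsilon>) * ((1 - \<epsilon>) * (1 - \<epsilon>)) * (w * (A * B))"
    using w AB by (intro mult_right_mono) auto
  also have "\<dots> = (1 - 5 * \<epsilon>) * (w * (((1 - \<epsilon>) * A) * ((1 - \<epsilon>) * B)))" by (simp add: mult_ac)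
  also have "\<dots> \<le> (1 - 5 * \<epsilon>) * P"
    unfolding P_def using a b w AB \<epsilon> by (intro mult_left_mono mult_mono) auto
  finally have "(1 - 7 * \<epsilon>) * (w * (A * B)) \<le> (1 - 5 * \<epsilon>) * P" .
  from order_trans[OF order_trans[OF this 1] 2] show ?thesis .
qed

text \<open>The predicate \<open>imp\<close> marks the edges in important blocks, and \<open>\<Lambda>\<close> is a large constant.\<close>

definition admissible :: "'v set set \<Rightarrow> real \<Rightarrow> nat \<Rightarrow> nat \<Rightarrow> (nat \<Rightarrow> real) \<Rightarrow> (nat \<Rightarrow> nat \<Rightarrow> real) \<Rightarrow>
    ('v \<Rightarrow> nat) \<Rightarrow> ('v set \<Rightarrow> bool) \<Rightarrow> bool" where
  "admissible E \<Lambda> n k m w B imp \<longleftrightarrow>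
    (\<forall>e\<in>E. imp e \<longrightarrow> src B e < k \<and> tgt B e < k \<and>
      \<Lambda> \<le> w (src B e) (tgt B e) * (real n * m (src B e))) \<and>
    (\<forall>e\<in>E. \<not> imp e \<longrightarrow> w (src B e) (tgt B e) * \<Lambda> \<le> 1 \<and>
      \<Lambda> \<le> w (src B e) (tgt B e) * (real n * m (src B e) * m (tgt B e))) \<and>
    pairwise disjnt {e \<in> E. imp e \<and> w (src B e) (tgt B e) < 1}"

section \<open>The first moment over one family, for every K-block\<close>

context block_weights
begin

text \<open>One family and one labelling serve all K-blocks, so that the bounds can be added over B
  afterwards. A factor 1 - 5 \<delta> is paid for each unimportant edge, each matching edge and each
  vertex off the matching; complete blocks cost nothing. The size of \<Lambda> makes \<delta>
  \<Lambda> dominate rounding errors of order k^2 as well as the bounded number of vertices and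
  edges to be avoided.\<close>

lemma kblock_first_moment:
  fixes V :: "'v set" and E :: "'v set set" and \<delta> \<Lambda> :: real
  assumes VE: "simple_graph V E" and \<delta>: "0 < \<delta>" "\<delta> \<le> 1/10"
    and \<Lambda>: "400 * (real (card V + card E) + 2) * (real k + 1)\<^sup>2 \<le> \<delta> * \<Lambda>"
    and mL: "\<And>i. i \<in> {1..k} \<Longrightarrow> \<Lambda> \<le> real n * m i"
  obtains S \<beta> where "S \<subseteq> regular_graphs n d" "0 < card S"
    "ln (real (card (regular_graphs n d))) - ln (real (card S))
      \<le> (1/2) * ent * (real n)\<^sup>2 + 900 * real k ^ 4 * (real n * ln (real n))"
    "\<And>B imp. B ` V \<subseteq> {1..k} \<Longrightarrow> admissible E \<Lambda> n k m w B imp \<Longrightarrow>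
      (1 - 5 * \<delta>) ^ (card E + card V) *
        ((\<Prod>e\<in>E. w (src B e) (tgt B e)) * (\<Prod>v\<in>V. real n * m (B v))) *
        real (card S) \<le> (\<Sum>G\<in>S. real (card (bhoms {1..n} \<beta> G V E B)))"
proof -
  let ?A = "{1..n}" and ?J = "{1..k}"
  obtain \<beta> N M T where \<beta>: "\<beta> ` ?A \<subseteq> ?J"
    and cN: "\<And>i. i \<in> ?J \<Longrightarrow> card (cell ?A \<beta> i) = N i"
    and Nbd: "\<And>i. i \<in> ?J \<Longrightarrow> real n * m i - 1 \<le> real (N i) \<and> real (N i) \<le> real n * m i + real k"
    and Msym: "\<And>i j. i \<in> ?J \<Longrightarrow> j \<in> ?J \<Longrightarrow> M i j = M j i"
    and Merr: "\<And>i j. i \<in> ?J \<Longrightarrow> j \<in> ?J \<Longrightarrow>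
      \<bar>real (M i j) - (real n)\<^sup>2 * m i * m j * w i j\<bar> \<le> 20 * (real k)\<^sup>2 * real n"
    and M1: "\<And>i j. i \<in> {1..<k} \<Longrightarrow> j \<in> {1..<k} \<Longrightarrow> i \<noteq> j \<Longrightarrow>
      w i j * (real (N i) * real (N j)) - 1 < real (M i j)"
    and M2: "\<And>i. i \<in> {1..<k} \<Longrightarrow> w i i * (real (N i) * (real (N i) - 1)) - 2 < real (M i i)"
    and Mev: "\<And>i. i \<in> ?J \<Longrightarrow> even (M i i)"
    and Tsum: "\<And>i j. i \<in> ?J \<Longrightarrow> j \<in> ?J \<Longrightarrow> (\<Sum>u\<in>cell ?A \<beta> i. T u j) = M i j"
    and T: "\<And>u j. u \<in> ?A \<Longrightarrow> j \<in> ?J \<Longrightarrow> T u j \<in> {M (\<beta> u) j div N (\<beta> u), M (\<beta> u) j div N (\<beta> u) + 1}"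
    and sub: "deg_graphs ?A ?J \<beta> T \<subseteq> regular_graphs n d"
    and S0: "0 < card (deg_graphs ?A ?J \<beta> T)"
    and lnS: "ln (real (card (regular_graphs n d))) - ln (real (card (deg_graphs ?A ?J \<beta> T)))
      \<le> (1/2) * ent * (real n)\<^sup>2 + 900 * real k ^ 4 * (real n * ln (real n))"
    using structured_family by blast
  define S where "S = deg_graphs ?A ?J \<beta> T"
  define s where "s = real (card V + card E) + 2"
  \<comment> \<open>A finer accuracy than \<delta>: the loss 7 \<epsilon> of a matching edge fits
    into 5 \<delta>, the loss 3 \<epsilon> of a density into \<delta>.\<close>
  define \<epsilon> where "\<epsilon> = \<delta> / 20"
  have \<epsilon>: "0 < \<epsilon>" "\<epsilon> \<le> 1/100" "\<delta> = 20 * \<epsilon>" using \<delta> by (auto simp: \<epsilon>_def)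
  have s2: "2 \<le> s" by (simp add: s_def)
  have kk: "1 \<le> (real k + 1)\<^sup>2" "real k \<le> (real k + 1)\<^sup>2" "(real k)\<^sup>2 \<le> (real k + 1)\<^sup>2"
    using k by (auto simp: power2_eq_square algebra_simps)
  have L: "20 * s * (real k + 1)\<^sup>2 \<le> \<epsilon> * \<Lambda>"
  proof -
    have "400 * s * (real k + 1)\<^sup>2 = 20 * (20 * s * (real k + 1)\<^sup>2)" by simp
    moreover have "\<delta> * \<Lambda> = 20 * (\<epsilon> * \<Lambda>)" by (simp add: \<epsilon>(3))
    ultimately show ?thesis using \<Lambda> unfolding s_def by linarith
  qed
  have Ls: "20 * s \<le> \<epsilon> * \<Lambda>"
  proof -
    have "20 * s * 1 \<le> 20 * s * (real k + 1)\<^sup>2" using kk s2 by (intro mult_left_mono) auto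
    then show ?thesis using L by linarith
  qed
  have Lk: "20 * real k \<le> \<epsilon> * \<Lambda>" "40 * (real k)\<^sup>2 \<le> \<epsilon> * \<Lambda>"
  proof -
    have a: "40 * (real k + 1)\<^sup>2 \<le> 20 * s * (real k + 1)\<^sup>2" using s2 by (intro mult_right_mono) auto
    then show "20 * real k \<le> \<epsilon> * \<Lambda>" using L kk by linarith
    show "40 * (real k)\<^sup>2 \<le> \<epsilon> * \<Lambda>" using a L kk by linarith
  qed
  have \<Lambda>0: "0 < \<Lambda>"
  proof -
    have "0 < \<epsilon> * \<Lambda>" using Ls s2 by linarith
    then show ?thesis using \<epsilon> by (simp add: zero_less_mult_iff)
  qed
  have \<Lambda>1: "1 \<le> \<Lambda>"
  proof -
    have "\<epsilon> * \<Lambda> \<le> 1 * \<Lambda>" using \<epsilon> \<Lambda>0 by (intro mult_right_mono) auto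
    then show ?thesis using Ls s2 by linarith
  qed
  have A0: "0 < real n * m i" if "i \<in> ?J" for i using mL[OF that] \<Lambda>0 by linarith
  have eA: "20 * s \<le> \<epsilon> * (real n * m i)" "20 * real k \<le> \<epsilon> * (real n * m i)" if "i \<in> ?J" for i
    using mult_left_mono[OF mL[OF that], of \<epsilon>] \<epsilon> Ls Lk by linarith+
  have Na: "(1 - \<epsilon>) * (real n * m i) \<le> real (N i)" "real (N i) \<le> (1 + \<epsilon>) * (real n * m i)"
    if i: "i \<in> ?J" for i
    using Nbd[OF i] eA[OF i] s2 by (auto simp: algebra_simps)
  have Nhalf: "real n * m i / 2 \<le> real (N i)" if i: "i \<in> ?J" for i
  proof -
    have "(1/2) * (real n * m i) \<le> (1 - \<epsilon>) * (real n * m i)"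
      using \<epsilon> A0[OF i] by (intro mult_right_mono) auto
    then show ?thesis using Na(1)[OF i] by simp
  qed
  have eN: "10 * s \<le> \<epsilon> * real (N i)" if i: "i \<in> ?J" for i
  proof -
    have "\<epsilon> * (real n * m i / 2) \<le> \<epsilon> * real (N i)" using Nhalf[OF i] \<epsilon> by (intro mult_left_mono) auto
    then show ?thesis using eA(1)[OF i] by simp
  qed
  have Npos: "0 < N i" if "i \<in> ?J" for i
    using eN[OF that] s2 by (auto intro!: Nat.gr0I)
  have GA: "G \<subseteq> pairs ?A" if "G \<in> S" for G using that by (simp add: S_def deg_graphs_def)
  have Tbd: "T u j \<le> M i j div N i + 1" "M i j div N i \<le> T u j" if "u \<in> cell ?A \<beta> i" "j \<in> ?J" for u i j
    using T[of u j] that by (auto simp: cell_def)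
  have \<theta>: "0 \<le> 1 - 5 * \<delta>" "1 - 5 * \<delta> \<le> 1" using \<delta> by auto
  have main: "(1 - 5 * \<delta>) ^ (card E + card V) *
        ((\<Prod>e\<in>E. w (src B e) (tgt B e)) * (\<Prod>v\<in>V. real n * m (B v))) *
        real (card S) \<le> (\<Sum>G\<in>S. real (card (bhoms ?A \<beta> G V E B)))"
    if B: "B ` V \<subseteq> ?J"
      and adm: "admissible E \<Lambda> n k m w B imp"
    for B imp
  proof -
    have c2: "\<And>e. e \<in> E \<Longrightarrow> imp e \<Longrightarrow> src B e < k \<and> tgt B e < k \<and>
        \<Lambda> \<le> w (src B e) (tgt B e) * (real n * m (src B e))"
      and c3: "\<And>e. e \<in> E \<Longrightarrow> \<not> imp e \<Longrightarrow> w (src B e) (tgt B e) * \<Lambda> \<le> 1 \<and>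
        \<Lambda> \<le> w (src B e) (tgt B e) *
          (real n * m (src B e) * m (tgt B e))"
      and c4: "pairwise disjnt {e \<in> E. imp e \<and> w (src B e) (tgt B e) < 1}"
      using adm by (simp_all add: admissible_def)
    define I where "I e = src B e" for e
    define J where "J e = tgt B e" for e
    define W where "W e = w (I e) (J e)" for e
    \<comment> \<open>Somewhat important, very important (complete) and unimportant edges. In the
      second class the weight is exactly 1, since weights never exceed 1.\<close>
    define Es where "Es = {e \<in> E. imp e \<and> W e < 1}"
    define Ec where "Ec = {e \<in> E. imp e \<and> \<not> W e < 1}"
    define Eu where "Eu = {e \<in> E. \<not> imp e}"
    have V: "finite V" and e2: "\<And>e. e \<in> E \<Longrightarrow> e \<subseteq> V \<and> card e = 2"
      using VE by (auto simp: simple_graph_def)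
    have fE: "finite E" using e2 by (intro finite_subset[OF _ finite_Pow_iff[THEN iffD2, OF V]]) auto
    have ends: "fst (edge_ends e) \<in> V" "snd (edge_ends e) \<in> V" "e = {fst (edge_ends e), snd (edge_ends e)}"
      "fst (edge_ends e) \<noteq> snd (edge_ends e)" if "e \<in> E" for e
    proof -
      have e: "e = {fst (edge_ends e), snd (edge_ends e)}" using edge_ends e2[OF that] by blast
      then show "e = {fst (edge_ends e), snd (edge_ends e)}" .
      show "fst (edge_ends e) \<in> V" "snd (edge_ends e) \<in> V" using e e2[OF that] by blast+
      have "card {fst (edge_ends e), snd (edge_ends e)} = 2" using e e2[OF that] by metis
      then show "fst (edge_ends e) \<noteq> snd (edge_ends e)"
        by (cases "fst (edge_ends e) = snd (edge_ends e)") auto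
    qed
    have IJ: "I e \<in> ?J" "J e \<in> ?J" if "e \<in> E" for e
      using ends[OF that] B by (auto simp: I_def J_def)
    have Bv: "B v \<in> ?J" if "v \<in> V" for v using B that by auto
    have W01: "0 \<le> W e" "W e \<le> 1" if "e \<in> E" for e using w[OF IJ[OF that]] by (auto simp: W_def)
    define a where "a e = M (I e) (J e) - card V * ((M (I e) (J e) div N (I e) + 1) + (M (I e) (J e) div N (J e) + 1))" for e
    define b where "b v = N (B v) - card V" for v
    define q where "q e = (1 - 5 * \<delta>) * W e" for e
    have vs: "real (card V) + 2 \<le> s" "real (card E) + 2 \<le> s" by (auto simp: s_def)
    have M\<Delta>: "T u (J e) \<le> M (I e) (J e) div N (I e) + 1" if "e \<in> E" "u \<in> cell ?A \<beta> (I e)" for e u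
      using Tbd(1)[OF that(2)] IJ[OF that(1)] by blast
    have M\<Delta>': "T u (I e) \<le> M (I e) (J e) div N (J e) + 1" if "e \<in> E" "u \<in> cell ?A \<beta> (J e)" for e u
      using Tbd(1)[OF that(2), of "I e"] IJ[OF that(1)] Msym by metis
    have sum_ineq: "(\<Prod>e\<in>Eu. q e) * (real (\<Prod>e\<in>Es. a e) * real (\<Prod>v\<in>V - \<Union>Es. b v)) * real (card S)
      \<le> (\<Sum>G\<in>S. real (card (bhoms ?A \<beta> G V E B)))"
    proof (rule sum_card_bhoms[where Ec = Ec])
      show "E = Es \<union> Ec \<union> Eu" "Eu \<inter> (Es \<union> Ec) = {}" by (auto simp: Es_def Ec_def Eu_def)
      show "pairwise disjnt Es" using c4 by (simp add: Es_def W_def I_def J_def)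
      show "a e \<le> card {(x, y) \<in> adj \<beta> G (src B e) (tgt B e). x \<notin> X \<and> y \<notin> X}"
        if "G \<in> S" "e \<in> Es" "finite X" "card X \<le> card V" for G e X
      proof -
        have e: "e \<in> E" using that by (simp add: Es_def)
        show ?thesis
          unfolding a_def I_def[symmetric] J_def[symmetric]
          using that(1) IJ[OF e] M\<Delta>[OF e] M\<Delta>'[OF e] Tsum[OF IJ[OF e]] that(3,4)
          by (intro adj_avoiding[where J = ?J and T = T]) (auto simp: S_def)
      qed
      show "b v \<le> card (cell ?A \<beta> (B v) - X)" if "v \<in> V" "finite X" "card X \<le> card V" for v X
      proof -
        have "b v \<le> card (cell ?A \<beta> (B v)) - card X" using that cN[OF Bv] by (simp add: b_def)
        also have "\<dots> \<le> card (cell ?A \<beta> (B v) - X)" using that by (intro diff_card_le_card_Diff)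
        finally show ?thesis .
      qed
      show "{x, y} \<in> G" if "G \<in> S" "e \<in> Ec" "x \<in> cell ?A \<beta> (src B e)"
        "y \<in> cell ?A \<beta> (tgt B e)" "x \<noteq> y" for G e x y
      proof -
        have e: "e \<in> E" "imp e" "W e = 1" using that W01[of e] by (auto simp: Ec_def)
        have lt: "I e \<in> {1..<k}" "J e \<in> {1..<k}"
          using c2[OF e(1,2)] IJ[OF e(1)] by (auto simp: I_def J_def)
        have "card (adj \<beta> G (I e) (J e)) = (\<Sum>u\<in>cell ?A \<beta> (I e). T u (J e))"
          unfolding card_adj[OF finite_atLeastAtMost GA[OF that(1)]]
          using that(1) IJ[OF e(1)] by (intro sum.cong) (auto simp: S_def deg_graphs_def cell_def)
        then have cM: "card (adj \<beta> G (I e) (J e)) = M (I e) (J e)" using Tsum IJ[OF e(1)] by simp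
        have "(if I e = J e then N (I e) * (N (I e) - 1) else N (I e) * N (J e)) \<le> M (I e) (J e)"
        proof (cases "I e = J e")
          case True
          have r: "real (N (I e)) * (real (N (I e)) - 1) = real (N (I e) * (N (I e) - 1))"
            by (cases "N (I e)") (auto simp: algebra_simps)
          have "real (N (I e)) * (real (N (I e)) - 1) - 2 < real (M (I e) (I e))"
            using M2[OF lt(1)] True e(3) by (simp add: W_def)
          then have "N (I e) * (N (I e) - 1) < M (I e) (I e) + 2" unfolding r by linarith
          \<comment> \<open>Inside one cell the rounding only shows that the count exceeds N (N - 1)
            - 2. Both numbers are even, so not a single edge is missing.\<close>
          moreover have "even (N (I e) * (N (I e) - 1))" by (cases "N (I e)") auto
          moreover have "even (M (I e) (I e))" using Mev IJ[OF e(1)] by simp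
          moreover have "x \<le> y" if "x < y + 2" "even x" "even y" for x y :: nat
            using that by presburger
          ultimately show ?thesis using True by metis
        next
          case False
          have "real (N (I e) * N (J e)) - 1 < real (M (I e) (J e))"
            using M1[OF lt False] e(3) by (simp add: W_def)
          then have "N (I e) * N (J e) \<le> M (I e) (J e)" by linarith
          then show ?thesis using False by simp
        qed
        then show ?thesis
          using that cM cN[OF IJ(1)[OF e(1)]] cN[OF IJ(2)[OF e(1)]] GA[OF that(1)]
          by (intro complete_block[where A = ?A and \<beta> = \<beta> and i = "I e" and j = "J e"]) (auto simp: I_def J_def)
      qed
      show "0 \<le> q e" if "e \<in> Eu" for e
        using that W01[of e] \<theta> by (simp add: q_def Eu_def)
      show "q e * real (card {G \<in> S. F \<subseteq> G}) \<le> real (card {G \<in> S. insert {x, y} F \<subseteq> G})"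
        if F: "finite F" "card F \<le> card E" and e: "e \<in> Eu"
          and x: "x \<in> cell ?A \<beta> (src B e)" and y: "y \<in> cell ?A \<beta> (tgt B e)"
          and xy: "x \<noteq> y" "{x, y} \<notin> F" for F e x y
      proof -
        have eE: "e \<in> E" "\<not> imp e" using e by (auto simp: Eu_def)
        define i j where "i = I e" and "j = J e"
        have ij: "i \<in> ?J" "j \<in> ?J" using IJ[OF eE(1)] by (auto simp: i_def j_def)
        have W: "W e * \<Lambda> \<le> 1" "\<Lambda> \<le> W e * (real n * m i * m j)"
          using c3[OF eE] by (auto simp: W_def i_def j_def I_def J_def)
        have xA: "x \<in> ?A" "\<beta> x = i" and yA: "y \<in> ?A" "\<beta> y = j"
          using x y by (auto simp: cell_def i_def j_def I_def J_def)
        define A Bq where "A = real n * m i" and "Bq = real n * m j"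
        have AB: "0 < A" "0 < Bq" using A0 ij by (auto simp: A_def Bq_def)
        have W0: "0 < W e"
        proof (rule ccontr)
          assume "\<not> 0 < W e"
          then have "W e = 0" using W01[OF eE(1)] by simp
          then show False using W \<Lambda>0 by simp
        qed
        have WA: "\<Lambda> \<le> W e * A" "\<Lambda> \<le> W e * Bq"
        proof -
          have "W e * (real n * m i * m j) \<le> W e * (real n * m i * 1)"
            using W0 AB m_le_1[OF ij(2)] unfolding A_def by (intro mult_left_mono) auto
          then show "\<Lambda> \<le> W e * A" using W by (simp add: A_def)
          have "W e * ((real n * m j) * m i) \<le> W e * ((real n * m j) * 1)"
            using W0 AB m_le_1[OF ij(1)] unfolding Bq_def by (intro mult_left_mono) auto
          then show "\<Lambda> \<le> W e * Bq" using W by (simp add: Bq_def mult_ac)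
        qed
        \<comment> \<open>The rounding error is of order k^2 n. It is a small fraction of the
          expected count, of order n^2, because \<open>admissible\<close> bounds
          \<open>W e * (real n * m i * m j)\<close>, with a single factor n, from below by
          \<Lambda>.\<close>
        have Mab: "\<bar>real (M i j) - W e * (A * Bq)\<bar> \<le> \<epsilon> * (W e * (A * Bq))"
        proof -
          have "20 * (real k)\<^sup>2 * real n \<le> \<epsilon> * \<Lambda> * real n" using Lk by (intro mult_right_mono) auto
          also have "\<dots> \<le> \<epsilon> * (W e * (real n * m i * m j)) * real n"
            using W \<epsilon> by (intro mult_right_mono mult_left_mono) auto
          also have "\<dots> = \<epsilon> * (W e * (A * Bq))" by (simp add: A_def Bq_def mult_ac)
          finally have "20 * (real k)\<^sup>2 * real n \<le> \<epsilon> * (W e * (A * Bq))" .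
          moreover have "(real n)\<^sup>2 * m i * m j * w i j = W e * (A * Bq)"
            by (simp add: A_def Bq_def W_def i_def j_def power2_eq_square mult_ac)
          ultimately show ?thesis using Merr[OF ij] by simp
        qed
        note eb = edge_density_bounds[OF AB W0 \<epsilon>(1,2) Na(1,2)[OF ij(1), folded A_def]
            Na(1,2)[OF ij(2), folded Bq_def] Mab]
        let ?X = "{G \<in> S. F \<subseteq> G \<and> {x, y} \<notin> G}" and ?Y = "{G \<in> S. F \<subseteq> G \<and> {x, y} \<in> G}"
        have divle: "real (M i j) / real z - 1 \<le> real (M i j div z) \<and> real (M i j div z) \<le> real (M i j) / real z"
          for z
        proof -
          have "real (M i j mod z) / real z \<le> 1"
            by (cases "z = 0") (auto simp: divide_le_eq_1 less_imp_le)
          then show ?thesis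
            using of_nat_of_nat_div_aux[of "M i j" z, where ?'a = real] of_nat_div_le_of_nat[of "M i j" z, where ?'a = real]
            by linarith
        qed
        have "(1 - 5 * \<delta>) * W e * (real (card ?X) + real (card ?Y)) \<le> real (card ?Y)"
        proof (rule switching_ratio)
          show "card ?X * ((T x j - card E) * ((T y i - (card E + 1)) * (M i j - (2 * card E +
              4 * (M i j div N i + 1) + 4 * (M i j div N j + 1) + 2 * (M i j div N i + 1) * (M i j div N j + 1)))))
            \<le> card ?Y * (M i j * M i j)"
            unfolding S_def
            using xA yA xy ij F Tsum[OF ij] M\<Delta>[OF eE(1)] M\<Delta>'[OF eE(1)]
            by (intro card_switching) (auto simp: i_def j_def)
          show "real (M i j) / real (N i) - 1 \<le> real (T x j)"
            using divle[of "N i"] Tbd(2)[of x i j] x ij by (force simp: i_def I_def)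
          show "real (M i j) / real (N j) - 1 \<le> real (T y i)"
            using divle[of "N j"] Tbd(2)[of y j i] y ij Msym[OF ij] by (force simp: j_def J_def)
          show "real (M i j div N i + 1) \<le> real (M i j) / real (N i) + 1"
            "real (M i j div N j + 1) \<le> real (M i j) / real (N j) + 1"
            using divle by auto
          have big: "real (card E) + 2 \<le> \<delta> * (z / 2)" if "\<Lambda> \<le> z" for z
          proof -
            have "\<epsilon> * \<Lambda> \<le> \<epsilon> * z" using that \<epsilon> by (intro mult_left_mono) auto
            then have "20 * s \<le> \<epsilon> * z" using Ls by linarith
            then show ?thesis using \<epsilon>(3) vs s2 by simp
          qed
          show "real (card E) + 2 \<le> \<delta> * (real (M i j) / real (N i))"
            using order_trans[OF big[OF WA(2)] mult_left_mono[OF eb(1), of \<delta>]] \<delta> by simp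
          show "real (card E) + 2 \<le> \<delta> * (real (M i j) / real (N j))"
            using order_trans[OF big[OF WA(1)] mult_left_mono[OF eb(2), of \<delta>]] \<delta> by simp
          show "40 \<le> \<delta> * real (N i)" "40 \<le> \<delta> * real (N j)"
            using eN[OF ij(1)] eN[OF ij(2)] s2 \<epsilon>(3) by simp_all
          \<comment> \<open>From \<open>W e * \<Lambda> \<le> 1\<close>, the form in which smallness
            of p arrives here. The density is at most twice \<open>W e\<close>, so 40 times the
            density is at most \<delta>.\<close>
          have "80 * W e \<le> \<delta>"
          proof -
            have "W e * (20 * s) \<le> W e * (\<epsilon> * \<Lambda>)" using Ls W0 by (intro mult_left_mono) auto
            also have "\<dots> = \<epsilon> * (W e * \<Lambda>)" by (simp add: mult_ac)
            also have "\<dots> \<le> \<epsilon> * 1" using W \<epsilon> by (intro mult_left_mono) auto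
            finally have "W e * (20 * s) \<le> \<epsilon>" by simp
            moreover have "W e * (20 * 2) \<le> W e * (20 * s)" using s2 W0 by (intro mult_left_mono) auto
            ultimately show ?thesis using \<epsilon>(1,3) by linarith
          qed
          then show "40 * (real (M i j) / (real (N i) * real (N j))) \<le> \<delta>" "W e \<le> \<delta>"
            using eb(3) W0 by linarith+
          have "(1 - \<delta>) * W e \<le> (1 - 3 * \<epsilon>) * W e" using \<epsilon> W0 by (intro mult_right_mono) auto
          then show "(1 - \<delta>) * W e \<le> real (M i j) / (real (N i) * real (N j))" using eb(4) by linarith
        qed (use \<delta> W0 in auto)
        moreover have "real (card {G \<in> S. F \<subseteq> G}) = real (card ?X) + real (card ?Y)"
        proof -
          have "finite S" unfolding S_def by (rule finite_deg_graphs) simp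
          then have "card (?X \<union> ?Y) = card ?X + card ?Y" by (intro card_Un_disjoint) auto
          moreover have "{G \<in> S. F \<subseteq> G} = ?X \<union> ?Y" by auto
          ultimately show ?thesis by simp
        qed
        moreover have "{G \<in> S. insert {x, y} F \<subseteq> G} = ?Y" by auto
        ultimately show ?thesis by (simp add: q_def)
      qed
    qed (use GA VE in auto)
    have a_ge: "(1 - 5 * \<delta>) * (W e * ((real n * m (I e)) * (real n * m (J e)))) \<le> real (a e)" if "e \<in> Es" for e
    proof -
      have e: "e \<in> E" "imp e" using that by (auto simp: Es_def)
      note ij = IJ[OF e(1)]
      have lt: "I e \<in> {1..<k}" "J e \<in> {1..<k}"
        using c2[OF e] ij by (auto simp: I_def J_def)
      have WA: "\<Lambda> \<le> W e * (real n * m (I e))" using c2[OF e] by (simp add: W_def I_def J_def)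
      have "(1 - 5 * \<delta>) * (W e * ((real n * m (I e)) * (real n * m (J e)))) \<le>
          (1 - 7 * \<epsilon>) * (W e * ((real n * m (I e)) * (real n * m (J e))))"
        using \<epsilon> W01[OF e(1)] m_pos[OF ij(1)] m_pos[OF ij(2)] by (intro mult_right_mono mult_nonneg_nonneg) auto
      also have "\<dots> \<le> real (a e)"
        unfolding a_def
      proof (rule matching_edge_bound[OF \<epsilon>(1,2) W01(1)[OF e(1)] A0[OF ij(1)] A0[OF ij(2)] Na(1)[OF ij(1)] Na(1)[OF ij(2)]])
        show "real (card V) + 2 \<le> \<epsilon> * real (N (I e))" "real (card V) + 2 \<le> \<epsilon> * real (N (J e))"
          using eN[OF ij(1)] eN[OF ij(2)] vs s2 by linarith+
        have "W e * (real n * m (I e) / 2) \<le> W e * real (N (I e))"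
          using Nhalf[OF ij(1)] W01[OF e(1)] by (intro mult_left_mono) auto
        then have "\<Lambda> / 2 \<le> W e * real (N (I e))" using WA by simp
        then have "\<epsilon> * (\<Lambda> / 2) \<le> \<epsilon> * (W e * real (N (I e)))" using \<epsilon> by (intro mult_left_mono) auto
        then show "2 * real (card V) + 2 \<le> \<epsilon> * (W e * real (N (I e)))" using Ls vs s2 by simp
        show "W e * (real (N (I e)) * real (N (J e))) - W e * real (N (I e)) - 2 \<le> real (M (I e) (J e))"
        proof (cases "I e = J e")
          case True
          then show ?thesis using M2[OF lt(1)] by (simp add: W_def algebra_simps)
        next
          case False
          have "0 \<le> W e * real (N (I e))" using W01[OF e(1)] by simp
          then show ?thesis using M1[OF lt False] by (simp add: W_def)
        qed
      qed
      finally show ?thesis .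
    qed
    have b_ge: "(1 - 5 * \<delta>) * (real n * m (B v)) \<le> real (b v)" if "v \<in> V" for v
    proof -
      have "real n * m (B v) - real n * m (B v) * (5 * \<delta>) \<le> real (N (B v)) - real (card V)"
        using Nbd[OF Bv[OF that]] eA(1)[OF Bv[OF that]] vs \<epsilon>(3) s2 A0[OF Bv[OF that]]
        by (simp add: mult_ac)
      also have "\<dots> \<le> real (b v)" unfolding b_def by linarith
      finally show ?thesis by (simp add: algebra_simps)
    qed
    let ?c = "1 - 5 * \<delta>"
    have fin: "finite Es" "finite Ec" "finite Eu" using fE by (auto simp: Es_def Ec_def Eu_def)
    have EsV: "\<Union>Es \<subseteq> V" using e2 by (auto simp: Es_def)
    have dis: "pairwise disjnt Es" using c4 by (simp add: Es_def W_def I_def J_def)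
    have prodW: "(\<Prod>e\<in>E. W e) = (\<Prod>e\<in>Eu. W e) * (\<Prod>e\<in>Es. W e)"
    proof -
      have "E = Eu \<union> (Es \<union> Ec)" by (auto simp: Es_def Ec_def Eu_def)
      moreover have "Eu \<inter> (Es \<union> Ec) = {}" "Es \<inter> Ec = {}" by (auto simp: Es_def Ec_def Eu_def)
      ultimately have "(\<Prod>e\<in>E. W e) = (\<Prod>e\<in>Eu. W e) * ((\<Prod>e\<in>Es. W e) * (\<Prod>e\<in>Ec. W e))"
        using fin by (simp add: prod.union_disjoint)
      moreover have "(\<Prod>e\<in>Ec. W e) = 1" using W01 by (intro prod.neutral) (force simp: Ec_def)
      ultimately show ?thesis by simp
    qed
    \<comment> \<open>The matching edges are disjoint, so the cell sizes at their ends can be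
      regrouped edge by edge and paired with the number of copies of each edge.\<close>
    have prodV: "(\<Prod>v\<in>V. real n * m (B v)) =
        (\<Prod>e\<in>Es. (real n * m (I e)) * (real n * m (J e))) * (\<Prod>v\<in>V - \<Union>Es. real n * m (B v))"
    proof -
      have "(\<Prod>v\<in>V. real n * m (B v)) = (\<Prod>v\<in>V - \<Union>Es. real n * m (B v)) * (\<Prod>v\<in>\<Union>Es. real n * m (B v))"
        using V EsV by (rule prod.subset_diff[rotated])
      also have "(\<Prod>v\<in>\<Union>Es. real n * m (B v)) = (\<Prod>e\<in>Es. \<Prod>v\<in>e. real n * m (B v))"
      proof -
        have "\<forall>e\<in>Es. finite e" using e2 V finite_subset unfolding Es_def by blast
        moreover have "\<forall>e\<in>Es. \<forall>f\<in>Es. e \<noteq> f \<longrightarrow> e \<inter> f = {}"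
          using dis by (auto simp: pairwise_def disjnt_def)
        ultimately show ?thesis by (subst prod.Union_disjoint) auto
      qed
      also have "\<dots> = (\<Prod>e\<in>Es. (real n * m (I e)) * (real n * m (J e)))"
      proof (rule prod.cong)
        fix e assume "e \<in> Es"
        then have e: "e \<in> E" by (simp add: Es_def)
        have "(\<Prod>v\<in>{fst (edge_ends e), snd (edge_ends e)}. real n * m (B v)) = (real n * m (I e)) * (real n * m (J e))"
          using ends(4)[OF e] by (simp add: I_def J_def)
        then show "(\<Prod>v\<in>e. real n * m (B v)) = (real n * m (I e)) * (real n * m (J e))"
          using ends(3)[OF e] by simp
      qed simp
      finally show ?thesis by (simp add: mult.commute)
    qed
    define P1 P2 P3 where "P1 = (\<Prod>e\<in>Eu. W e)"
      and "P2 = (\<Prod>e\<in>Es. W e * ((real n * m (I e)) * (real n * m (J e))))"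
      and "P3 = (\<Prod>v\<in>V - \<Union>Es. real n * m (B v))"
    have pe: "0 \<le> W e * ((real n * m (I e)) * (real n * m (J e)))" if "e \<in> E" for e
      using W01(1)[OF that] A0[OF IJ(1)[OF that]] A0[OF IJ(2)[OF that]]
      by (intro mult_nonneg_nonneg[of "W e"] mult_nonneg_nonneg[of "real n * m (I e)"]) linarith+
    have pv: "0 \<le> real n * m (B v)" if "v \<in> V" for v
      using A0[OF Bv[OF that]] by linarith
    have P: "0 \<le> P1" "0 \<le> P2" "0 \<le> P3"
      unfolding P1_def P2_def P3_def
      by (rule prod_nonneg, use W01 pe pv in \<open>simp add: Eu_def Es_def\<close>)+
    have total: "(\<Prod>e\<in>E. W e) * (\<Prod>v\<in>V. real n * m (B v)) = P1 * (P2 * P3)"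
      unfolding prodW prodV P1_def P2_def P3_def by (simp add: prod.distrib mult_ac)
    have q_ge: "?c ^ card Eu * P1 = (\<Prod>e\<in>Eu. q e)"
      by (simp add: q_def P1_def prod.distrib)
    have a_ge': "?c ^ card Es * P2 \<le> real (\<Prod>e\<in>Es. a e)"
    proof -
      have "?c ^ card Es * P2 = (\<Prod>e\<in>Es. ?c * (W e * ((real n * m (I e)) * (real n * m (J e)))))"
        by (simp add: P2_def prod.distrib)
      also have "\<dots> \<le> (\<Prod>e\<in>Es. real (a e))"
      proof (rule prod_mono, rule conjI)
        fix e assume e: "e \<in> Es"
        then have "e \<in> E" by (simp add: Es_def)
        from mult_nonneg_nonneg[OF \<theta>(1) pe[OF this]]
        show "0 \<le> ?c * (W e * ((real n * m (I e)) * (real n * m (J e))))" .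
        show "?c * (W e * ((real n * m (I e)) * (real n * m (J e)))) \<le> real (a e)" using a_ge[OF e] .
      qed
      finally show ?thesis by simp
    qed
    have b_ge': "?c ^ card (V - \<Union>Es) * P3 \<le> real (\<Prod>v\<in>V - \<Union>Es. b v)"
    proof -
      have "?c ^ card (V - \<Union>Es) * P3 = (\<Prod>v\<in>V - \<Union>Es. ?c * (real n * m (B v)))"
        by (simp add: P3_def prod.distrib)
      also have "\<dots> \<le> (\<Prod>v\<in>V - \<Union>Es. real (b v))"
      proof (rule prod_mono, rule conjI)
        fix v assume "v \<in> V - \<Union>Es"
        then have v: "v \<in> V" by simp
        show "0 \<le> ?c * (real n * m (B v))" using mult_nonneg_nonneg[OF \<theta>(1) pv[OF v]] .
        show "?c * (real n * m (B v)) \<le> real (b v)" using b_ge[OF v] .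
      qed
      finally show ?thesis by simp
    qed
    have "card Eu + card Es + card (V - \<Union>Es) \<le> card E + card V"
    proof -
      have "card Eu + card Es = card (Eu \<union> Es)"
        using fin by (intro card_Un_disjoint[symmetric]) (auto simp: Eu_def Es_def)
      also have "\<dots> \<le> card E" using fE by (intro card_mono) (auto simp: Eu_def Es_def)
      finally show ?thesis using V card_mono[of V "V - \<Union>Es"] by auto
    qed
    then have "?c ^ (card E + card V) \<le> ?c ^ (card Eu + card Es + card (V - \<Union>Es))"
      using \<theta> by (intro power_decreasing) auto
    then have "?c ^ (card E + card V) * (P1 * (P2 * P3)) \<le>
        ?c ^ (card Eu + card Es + card (V - \<Union>Es)) * (P1 * (P2 * P3))"
      using P by (intro mult_right_mono) auto
    also have "\<dots> = (?c ^ card Eu * P1) * ((?c ^ card Es * P2) * (?c ^ card (V - \<Union>Es) * P3))"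
      by (simp add: power_add mult_ac)
    also have "\<dots> \<le> (\<Prod>e\<in>Eu. q e) * (real (\<Prod>e\<in>Es. a e) * real (\<Prod>v\<in>V - \<Union>Es. b v))"
      unfolding q_ge[symmetric]
      by (intro mult_left_mono mult_mono a_ge' b_ge' mult_nonneg_nonneg zero_le_power of_nat_0_le_iff P \<theta>(1))
    finally have "?c ^ (card E + card V) * (P1 * (P2 * P3)) * real (card S)
      \<le> (\<Prod>e\<in>Eu. q e) * (real (\<Prod>e\<in>Es. a e) * real (\<Prod>v\<in>V - \<Union>Es. b v)) * real (card S)"
      by (intro mult_right_mono) auto
    from order_trans[OF this sum_ineq] show ?thesis
      unfolding total[symmetric] W_def I_def J_def .
  qed
  show ?thesis
    using that[of S \<beta>] sub S0 lnS main unfolding S_def by blast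
qed

end

section \<open>Block graphons\<close>


text \<open>On the union of the pieces the function is a step function, and finite measure of the
  pieces gives integrability. Row integrals, relative entropy and homomorphism densities of block
  graphons are all evaluated through it.\<close>

lemma set_integral_pieces:
  fixes f :: "'a \<Rightarrow> real" and c :: "'i \<Rightarrow> real"
  assumes I: "finite I" and A: "\<And>i. i \<in> I \<Longrightarrow> A i \<in> sets M" "\<And>i. i \<in> I \<Longrightarrow> emeasure M (A i) < \<infinity>"
    and dis: "disjoint_family_on A I" and f: "\<And>i x. i \<in> I \<Longrightarrow> x \<in> A i \<Longrightarrow> f x = c i"
  shows "(LINT x : (\<Union>i\<in>I. A i) | M. f x) = (\<Sum>i\<in>I. measure M (A i) * c i)"
proof -
  have int: "integrable M (\<lambda>x. indicator (A i) x * c i)" if "i \<in> I" for i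
    using A[OF that] by (intro integrable_mult_left) (auto intro: integrable_real_indicator)
  have "(LINT x : (\<Union>i\<in>I. A i) | M. f x) = (\<integral>x. (\<Sum>i\<in>I. indicator (A i) x * c i) \<partial>M)"
    unfolding set_lebesgue_integral_def
  proof (rule Bochner_Integration.integral_cong[OF refl])
    fix x
    have "indicat_real (\<Union>i\<in>I. A i) x = (\<Sum>i\<in>I. indicat_real (A i) x)"
      by (rule indicator_UN_disjoint[OF I dis])
    then have "indicator (\<Union>i\<in>I. A i) x *\<^sub>R f x = (\<Sum>i\<in>I. indicator (A i) x * f x)"
      by (simp add: sum_distrib_right)
    also have "\<dots> = (\<Sum>i\<in>I. indicator (A i) x * c i)"
      using f by (intro sum.cong) (auto simp: indicator_def)
    finally show "indicator (\<Union>i\<in>I. A i) x *\<^sub>R f x = (\<Sum>i\<in>I. indicator (A i) x * c i)" .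
  qed
  also have "\<dots> = (\<Sum>i\<in>I. (\<integral>x. indicator (A i) x * c i \<partial>M))"
    using int by (intro Bochner_Integration.integral_sum)
  also have "\<dots> = (\<Sum>i\<in>I. measure M (A i) * c i)"
    using A by (intro sum.cong) (auto simp: sets.Int_space_eq2)
  finally show ?thesis .
qed

lemma block_graphonD:
  assumes W: "block_graphon W" and i: "i \<in> {1..num W}"
  shows "part W i \<in> sets lborel" "part W i \<subseteq> {0..1}" "emeasure lborel (part W i) < \<infinity>" "part W i \<noteq> {}"
proof -
  show sub: "part W i \<subseteq> {0..1}" "part W i \<noteq> {}" using W i by (auto simp: block_graphon_def)
  have "is_interval (part W i)" using W i by (auto simp: block_graphon_def)
  then show s: "part W i \<in> sets lborel" using real_interval_borel_measurable by simp
  have "emeasure lborel (part W i) \<le> emeasure lborel {0..1::real}"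
    using sub by (intro emeasure_mono) auto
  also have "\<dots> < \<infinity>" by simp
  finally show "emeasure lborel (part W i) < \<infinity>" .
qed

text \<open>The parts are nonempty, so each contains a point at which symmetry and range of
  \<open>fn\<close> transfer to \<open>wt\<close>.\<close>

lemma block_graphon_wt:
  assumes W: "block_graphon W" and ij: "i \<in> {1..num W}" "j \<in> {1..num W}"
  shows "0 \<le> wt W i j" "wt W i j \<le> 1" "wt W i j = wt W j i"
proof -
  obtain x y where xy: "x \<in> part W i" "y \<in> part W j"
    using block_graphonD(4)[OF W] ij by blast
  then have 01: "x \<in> {0..1}" "y \<in> {0..1}" using block_graphonD(2)[OF W] ij by blast+
  have "fn W x y = wt W i j" "fn W y x = wt W j i"
    using W ij xy unfolding block_graphon_def by blast+
  moreover have "fn W x y = fn W y x \<and> fn W x y \<in> {0..1}"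
    using W 01 unfolding block_graphon_def graphon_def by blast
  ultimately show "0 \<le> wt W i j" "wt W i j \<le> 1" "wt W i j = wt W j i" by auto
qed

lemma block_graphon_sum_mS:
  assumes W: "block_graphon W"
  shows "(\<Sum>i=1..num W. mS W i) = 1" "1 \<le> num W"
proof -
  have U: "(\<Union>i\<in>{1..num W}. part W i) = {0..1}" and dis: "disjoint_family_on (part W) {1..num W}"
    using W by (auto simp: block_graphon_def)
  show "1 \<le> num W"
  proof (rule ccontr)
    assume "\<not> ?thesis"
    then have "num W = 0" by simp
    then show False using U by simp
  qed
  have "(LINT x : (\<Union>i\<in>{1..num W}. part W i) | lborel. (1::real)) = (\<Sum>i=1..num W. measure lborel (part W i) * 1)"
    by (rule set_integral_pieces) (use block_graphonD[OF W] dis in auto)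
  then show "(\<Sum>i=1..num W. mS W i) = 1" unfolding U by (simp add: mS_def set_lebesgue_integral_def)
qed

lemma block_graphon_row:
  assumes W: "block_graphon W" and x: "i \<in> {1..num W}" "x \<in> part W i"
  shows "(LINT y : {0..1} | lborel. fn W x y) = (\<Sum>j=1..num W. wt W i j * mS W j)"
proof -
  have U: "(\<Union>i\<in>{1..num W}. part W i) = {0..1}" and dis: "disjoint_family_on (part W) {1..num W}"
    using W by (auto simp: block_graphon_def)
  have "(LINT y : (\<Union>i\<in>{1..num W}. part W i) | lborel. fn W x y)
      = (\<Sum>j=1..num W. measure lborel (part W j) * wt W i j)"
  proof (rule set_integral_pieces)
    show "fn W x y = wt W i j" if "j \<in> {1..num W}" "y \<in> part W j" for j y
      using W x that unfolding block_graphon_def by blast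
  qed (use block_graphonD[OF W] dis in auto)
  then show ?thesis unfolding U by (simp add: mS_def mult.commute)
qed

lemma block_graphon_ent:
  assumes W: "block_graphon W"
  shows "graphon_ent p (fn W) = (\<Sum>i=1..num W. \<Sum>j=1..num W. mS W i * mS W j * rel_ent p (wt W i j))"
proof -
  have U: "(\<Union>i\<in>{1..num W}. part W i) = {0..1}" and dis: "disjoint_family_on (part W) {1..num W}"
    using W by (auto simp: block_graphon_def)
  let ?J = "{1..num W}"
  have UU: "(\<Union>z\<in>?J \<times> ?J. part W (fst z) \<times> part W (snd z)) = {0..1} \<times> {0..1}"
    unfolding U[symmetric] by auto
  have prod: "part W i \<times> part W j \<in> sets lborel \<and>
      emeasure lborel (part W i \<times> part W j) = emeasure lborel (part W i) * emeasure lborel (part W j)"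
    if "i \<in> ?J" "j \<in> ?J" for i j
    unfolding lborel_prod[symmetric]
    using block_graphonD(1)[OF W] that by (auto intro!: lborel.emeasure_pair_measure_Times)
  have "(LINT z : (\<Union>z\<in>?J \<times> ?J. part W (fst z) \<times> part W (snd z)) | lborel. rel_ent p (fn W (fst z) (snd z)))
     = (\<Sum>z\<in>?J \<times> ?J. measure lborel (part W (fst z) \<times> part W (snd z)) * rel_ent p (wt W (fst z) (snd z)))"
  proof (rule set_integral_pieces)
    show "emeasure lborel (part W (fst z) \<times> part W (snd z)) < \<infinity>" if "z \<in> ?J \<times> ?J" for z
      using prod[of "fst z" "snd z"] block_graphonD(3)[OF W] that by (auto simp: ennreal_mult_less_top)
    show "disjoint_family_on (\<lambda>z. part W (fst z) \<times> part W (snd z)) (?J \<times> ?J)"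
      using dis unfolding disjoint_family_on_def by fastforce
    show "rel_ent p (fn W (fst x) (snd x)) = rel_ent p (wt W (fst z) (snd z))"
      if "z \<in> ?J \<times> ?J" "x \<in> part W (fst z) \<times> part W (snd z)" for z x
    proof -
      have "fst z \<in> ?J" "snd z \<in> ?J" "fst x \<in> part W (fst z)" "snd x \<in> part W (snd z)" using that by auto
      then have "fn W (fst x) (snd x) = wt W (fst z) (snd z)" using W unfolding block_graphon_def by blast
      then show ?thesis by simp
    qed
  qed (use prod in auto)
  also have "\<dots> = (\<Sum>z\<in>?J \<times> ?J. mS W (fst z) * mS W (snd z) * rel_ent p (wt W (fst z) (snd z)))"
    using prod by (intro sum.cong) (auto simp: mS_def measure_def enn2real_mult)
  also have "\<dots> = (\<Sum>i=1..num W. \<Sum>j=1..num W. mS W i * mS W j * rel_ent p (wt W i j))"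
    by (simp add: sum.cartesian_product case_prod_unfold)
  finally show ?thesis unfolding graphon_ent_def UU .
qed

text \<open>Closed form of Hom_B(K,W): on the box belonging to B the integrand is constant and the
  volume factorises.\<close>

definition block_hom :: "'v set \<Rightarrow> 'v set set \<Rightarrow> block_data \<Rightarrow> ('v \<Rightarrow> nat) \<Rightarrow> real" where
  "block_hom V E W B =
    (\<Prod>e\<in>E. wt W (src B e) (tgt B e)) * (\<Prod>v\<in>V. mS W (B v))"

text \<open>Stated for an arbitrary set of K-blocks, so that a single box and the whole cube are
  both instances.\<close>

lemma hom_density_blocks:
  fixes V :: "'v set"
  assumes W: "block_graphon W" and VE: "simple_graph V E" and \<B>: "\<B> \<subseteq> V \<rightarrow>\<^sub>E {1..num W}"
  shows "(LINT x : (\<Union>B\<in>\<B>. \<Pi>\<^sub>E v\<in>V. part W (B v)) | Pi\<^sub>M V (\<lambda>_. lborel). hom_weight E (fn W) x)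
    = (\<Sum>B\<in>\<B>. block_hom V E W B)"
proof -
  interpret product_sigma_finite "\<lambda>_ :: 'v. lborel :: real measure" ..
  let ?M = "Pi\<^sub>M V (\<lambda>_. lborel :: real measure)"
  have V: "finite V" and e2: "\<And>e. e \<in> E \<Longrightarrow> e \<subseteq> V \<and> card e = 2"
    using VE by (auto simp: simple_graph_def)
  have dis: "part W i \<inter> part W j = {}" if "i \<in> {1..num W}" "j \<in> {1..num W}" "i \<noteq> j" for i j
    using W that unfolding block_graphon_def disjoint_family_on_def by blast
  have BJ: "B v \<in> {1..num W}" if "B \<in> \<B>" "v \<in> V" for B v using \<B> that by blast
  have em: "emeasure ?M (\<Pi>\<^sub>E v\<in>V. part W (B v)) = (\<Prod>v\<in>V. emeasure lborel (part W (B v)))" if "B \<in> \<B>" for B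
    using V block_graphonD(1)[OF W BJ[OF that]] by (intro emeasure_PiM) auto
  have fin: "finite \<B>" using \<B> V by (rule finite_subset[OF _ finite_PiE]) auto
  have "(LINT x : (\<Union>B\<in>\<B>. \<Pi>\<^sub>E v\<in>V. part W (B v)) | ?M. hom_weight E (fn W) x)
    = (\<Sum>B\<in>\<B>. measure ?M (\<Pi>\<^sub>E v\<in>V. part W (B v)) *
        (\<Prod>e\<in>E. wt W (src B e) (tgt B e)))"
  proof (rule set_integral_pieces[OF fin])
    show "(\<Pi>\<^sub>E v\<in>V. part W (B v)) \<in> sets ?M" if "B \<in> \<B>" for B
      using V block_graphonD(1)[OF W BJ[OF that]] by (intro sets_PiM_I_finite) auto
    show "emeasure ?M (\<Pi>\<^sub>E v\<in>V. part W (B v)) < \<infinity>" if "B \<in> \<B>" for B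
    proof -
      have "(\<Prod>v\<in>V. emeasure lborel (part W (B v))) < top"
        using block_graphonD(3)[OF W BJ[OF that]] ennreal_prod_eq_top[where I = V and f = "\<lambda>v. emeasure lborel (part W (B v))"]
        by (auto simp: less_top[symmetric])
      then show ?thesis using em[OF that] by simp
    qed
    show "disjoint_family_on (\<lambda>B. \<Pi>\<^sub>E v\<in>V. part W (B v)) \<B>"
      unfolding disjoint_family_on_def
    proof (intro ballI impI)
      fix B B' assume B: "B \<in> \<B>" "B' \<in> \<B>" "B \<noteq> B'"
      then have "\<exists>v\<in>V. B v \<noteq> B' v" using \<B> PiE_ext by (metis subsetD)
      then obtain v where v: "v \<in> V" "B v \<noteq> B' v" by blast
      then have "part W (B v) \<inter> part W (B' v) = {}" using dis BJ B by blast
      then show "(\<Pi>\<^sub>E v\<in>V. part W (B v)) \<inter> (\<Pi>\<^sub>E v\<in>V. part W (B' v)) = {}"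
        using v(1) by (auto simp: PiE_def Pi_def)
    qed
    show "hom_weight E (fn W) x = (\<Prod>e\<in>E. wt W (src B e) (tgt B e))"
      if B: "B \<in> \<B>" and x: "x \<in> (\<Pi>\<^sub>E v\<in>V. part W (B v))" for B x
      unfolding hom_weight_def
    proof (rule prod.cong[OF refl])
      fix e assume e: "e \<in> E"
      then have "{fst (edge_ends e), snd (edge_ends e)} \<subseteq> V" using edge_ends e2 by metis
      then have uv: "fst (edge_ends e) \<in> V" "snd (edge_ends e) \<in> V" by auto
      then have "x (fst (edge_ends e)) \<in> part W (src B e)"
        "x (snd (edge_ends e)) \<in> part W (tgt B e)" using x by auto
      then show "fn W (x (fst (edge_ends e))) (x (snd (edge_ends e))) = wt W (src B e) (tgt B e)"
        using W BJ[OF B uv(1)] BJ[OF B uv(2)] unfolding block_graphon_def by blast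
    qed
  qed
  also have "\<dots> = (\<Sum>B\<in>\<B>. block_hom V E W B)"
  proof (rule sum.cong[OF refl])
    fix B assume B: "B \<in> \<B>"
    have "enn2real (\<Prod>v\<in>V. emeasure lborel (part W (B v))) = (\<Prod>v\<in>V. mS W (B v))"
      unfolding mS_def measure_def by (induction V rule: infinite_finite_induct) (auto simp: enn2real_mult)
    then have "measure ?M (\<Pi>\<^sub>E v\<in>V. part W (B v)) = (\<Prod>v\<in>V. mS W (B v))"
      using em[OF B] by (simp add: measure_def)
    then show "measure ?M (\<Pi>\<^sub>E v\<in>V. part W (B v)) * (\<Prod>e\<in>E. wt W (src B e) (tgt B e))
        = block_hom V E W B"
      by (simp add: block_hom_def)
  qed
  finally show ?thesis .
qed

lemma hom_density_block_eq:
  assumes "block_graphon W" "simple_graph V E" "B \<in> V \<rightarrow>\<^sub>E {1..num W}"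
  shows "hom_density_block V E W B = block_hom V E W B"
  using hom_density_blocks[of W V E "{B}"] assms by (simp add: hom_density_block_def)

lemma hom_density_eq:
  assumes W: "block_graphon W" and VE: "simple_graph V E"
  shows "hom_density V E (fn W) = (\<Sum>B\<in>V \<rightarrow>\<^sub>E {1..num W}. block_hom V E W B)"
proof -
  have U: "(\<Union>i\<in>{1..num W}. part W i) = {0..1}" using W by (auto simp: block_graphon_def)
  have "(\<Union>B\<in>V \<rightarrow>\<^sub>E {1..num W}. \<Pi>\<^sub>E v\<in>V. part W (B v)) = (V \<rightarrow>\<^sub>E {0..1})" (is "?L = ?R")
  proof
    show "?L \<subseteq> ?R"
    proof (intro UN_least PiE_mono)
      fix B v assume "B \<in> V \<rightarrow>\<^sub>E {1..num W}" "v \<in> V"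
      then have "B v \<in> {1..num W}" by blast
      then show "part W (B v) \<subseteq> {0..1}" by (rule block_graphonD(2)[OF W])
    qed
    show "?R \<subseteq> ?L"
    proof
      fix x assume x: "x \<in> ?R"
      have "\<forall>v\<in>V. \<exists>i\<in>{1..num W}. x v \<in> part W i"
      proof
        fix v assume "v \<in> V"
        then have "x v \<in> (\<Union>i\<in>{1..num W}. part W i)" unfolding U using x by blast
        then show "\<exists>i\<in>{1..num W}. x v \<in> part W i" by blast
      qed
      then obtain B where B: "\<forall>v\<in>V. B v \<in> {1..num W} \<and> x v \<in> part W (B v)" unfolding Bex_def by metis
      then have "restrict B V \<in> V \<rightarrow>\<^sub>E {1..num W}" by auto
      moreover have "x \<in> (\<Pi>\<^sub>E v\<in>V. part W (restrict B V v))" using B x by (auto simp: PiE_def Pi_def)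
      ultimately show "x \<in> ?L" by blast
    qed
  qed
  then show ?thesis using hom_density_blocks[OF W VE subset_refl] by (simp add: hom_density_def)
qed

section \<open>Upper tail\<close>


text \<open>Reverse Markov inequality: members of S below the threshold contribute less than
  \<open>(1 - 2 * \<eta>) * \<mu>\<close> each, so an excess of
  \<open>\<eta> * \<mu> * card S\<close> has to come from members above it, and each of these yields
  at most Q.\<close>

lemma prob_ge_of_mean:
  fixes X :: "'a \<Rightarrow> real"
  assumes R: "finite R" and S: "S \<subseteq> R" "0 < card S"
    and X: "\<And>G. G \<in> S \<Longrightarrow> X G \<le> Q" and \<eta>: "0 < \<eta>" "\<eta> < 1/2" and \<mu>: "0 < \<mu>" and Q: "0 < Q"
    and mean: "(1 - \<eta>) * \<mu> * real (card S) \<le> (\<Sum>G\<in>S. X G)"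
  shows "\<eta> * (\<mu> / Q) * (real (card S) / real (card R))
    \<le> measure_pmf.prob (pmf_of_set R) {G. (1 - 2 * \<eta>) * \<mu> \<le> X G}"
proof -
  let ?A = "{G. (1 - 2 * \<eta>) * \<mu> \<le> X G}"
  have fS: "finite S" using S(1) R by (rule finite_subset)
  have R0: "R \<noteq> {}" using S by auto
  then have cR: "0 < real (card R)" using R by (simp add: card_gt_0_iff)
  have "(\<Sum>G\<in>S. X G) = (\<Sum>G\<in>S \<inter> ?A. X G) + (\<Sum>G\<in>S - ?A. X G)"
    using fS by (simp add: sum.Int_Diff)
  also have "\<dots> \<le> (\<Sum>G\<in>S \<inter> ?A. Q) + (\<Sum>G\<in>S - ?A. (1 - 2 * \<eta>) * \<mu>)"
    using X by (intro add_mono sum_mono) auto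
  also have "\<dots> \<le> real (card (S \<inter> ?A)) * Q + real (card S) * ((1 - 2 * \<eta>) * \<mu>)"
    using fS \<eta> \<mu> by (auto intro!: mult_right_mono card_mono)
  finally have 1: "\<eta> * \<mu> * real (card S) \<le> real (card (S \<inter> ?A)) * Q"
    using mean by (simp add: algebra_simps)
  have "real (card (S \<inter> ?A)) \<le> real (card (R \<inter> ?A))"
    using S R by (intro of_nat_mono card_mono) auto
  then have "real (card (S \<inter> ?A)) * Q \<le> real (card (R \<inter> ?A)) * Q" using Q by simp
  with 1 have "\<eta> * \<mu> * real (card S) \<le> real (card (R \<inter> ?A)) * Q" by linarith
  then have "\<eta> * (\<mu> / Q) * real (card S) \<le> real (card (R \<inter> ?A))"
    using Q by (simp add: field_simps)
  then have "\<eta> * (\<mu> / Q) * (real (card S) / real (card R)) \<le> real (card (R \<inter> ?A)) / real (card R)"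
    using divide_right_mono[OF _ less_imp_le[OF cR]] by fastforce
  then show ?thesis using measure_pmf_of_set[OF R0 R, of ?A] by simp
qed

text \<open>Diagonal argument: at each n an almost smallest good threshold is taken. The infimum
  itself may fail to be good or positive; adding 1 / (n + 1) lands strictly above it, and upward
  closure makes the result good.\<close>

lemma ex_vanishing_threshold:
  fixes good :: "real \<Rightarrow> nat \<Rightarrow> bool"
  assumes F: "F \<le> sequentially"
    and ev: "\<And>\<eta>. 0 < \<eta> \<Longrightarrow> eventually (good \<eta>) F"
    and mono: "eventually (\<lambda>n. \<forall>\<eta> \<theta>. 0 < \<eta> \<longrightarrow> \<eta> \<le> \<theta> \<longrightarrow> good \<eta> n \<longrightarrow> good \<theta> n) F"
  shows "\<exists>\<epsilon>. (\<epsilon> \<longlongrightarrow> (0::real)) F \<and> eventually (\<lambda>n. good (\<epsilon> n) n) F"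
proof -
  define A where "A n = {\<eta>. 0 < \<eta> \<and> good \<eta> n}" for n
  define \<epsilon> where "\<epsilon> n = Inf (A n) + 1 / real (Suc n)" for n
  have bdd: "bdd_below (A n)" for n by (rule bdd_belowI[of _ 0]) (auto simp: A_def)
  have ge: "0 \<le> Inf (A n)" if "A n \<noteq> {}" for n
    using that by (intro cInf_greatest) (auto simp: A_def)
  have "(\<epsilon> \<longlongrightarrow> 0) F"
  proof (rule tendstoI)
    fix r :: real assume r: "0 < r"
    have "(\<lambda>n. 1 / real (Suc n)) \<longlonglongrightarrow> 0" by (rule lim_1_over_n[THEN LIMSEQ_Suc])
    then have "eventually (\<lambda>n. dist (1 / real (Suc n)) 0 < r / 2) sequentially"
      using r by (intro tendstoD) auto
    then have "eventually (\<lambda>n. 1 / real (Suc n) < r / 2) F"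
      using F by (auto simp: le_filter_def)
    moreover have "eventually (good (r / 2)) F" using r by (intro ev) simp
    ultimately show "eventually (\<lambda>n. dist (\<epsilon> n) 0 < r) F"
    proof eventually_elim
      case (elim n)
      then have m: "r / 2 \<in> A n" using r by (simp add: A_def)
      then have "Inf (A n) \<le> r / 2" using bdd by (rule cInf_lower)
      moreover have "0 \<le> Inf (A n)" using m ge by blast
      moreover have "0 < 1 / real (Suc n)" by simp
      ultimately show ?case unfolding \<epsilon>_def dist_real_def using elim by linarith
    qed
  qed
  moreover have "eventually (\<lambda>n. good (\<epsilon> n) n) F"
    using ev[of 1, OF zero_less_one] mono
  proof eventually_elim
    case (elim n)
    then have ne: "A n \<noteq> {}" by (auto simp: A_def intro!: exI[of _ 1])
    have "Inf (A n) < \<epsilon> n" by (simp add: \<epsilon>_def)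
    then obtain \<eta> where "\<eta> \<in> A n" "\<eta> < \<epsilon> n" using cInf_lessD[OF ne] by blast
    then show ?case using elim(2) by (auto simp: A_def intro: less_imp_le)
  qed
  ultimately show ?thesis by blast
qed

section \<open>From asymptotic conditions to inequalities at a single n\<close>

lemma eventually_along: "eventually P (along N) \<longleftrightarrow> eventually (\<lambda>n. n \<in> N \<longrightarrow> P n) sequentially"
  by (simp add: eventually_inf_principal)

text \<open>A block is meaningful only along its own set of n. Rewritten as an implication, the
  statement lives on the common filter, where finitely many of them can be combined.\<close>

lemma eventually_along_cong:
  "eventually P (along N') \<Longrightarrow> eventually (\<lambda>n. n \<in> N' \<longrightarrow> P n) (along N)"
  unfolding eventually_along by (erule eventually_mono) simp

lemma ln_over_n_scale:
  assumes "C * (ln (real n) / real n) \<le> x" "0 < real n"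
  shows "C * ln (real n) \<le> real n * x"
  using mult_left_mono[OF assms(1), of "real n"] assms(2) by simp

text \<open>Conditions (9) and (7) give the clauses on important edges and on the matching. For an
  unimportant edge Condition (8) yields p / 2 \<le> w \<le> 2 p and m(S_i) m(S_j) \<ge> I_p(W) / (2
  p). The upper bound on w together with p = o(1) gives w \<Lambda> \<le> 1; the two lower bounds
  multiply to w n m(S_i) m(S_j) \<ge> n I_p(W) / 4, which Condition (4) makes large.\<close>

lemma kblock_eventually:
  fixes V :: "'v set" and E :: "'v set set"
  assumes VE: "simple_graph V E" and W: "\<And>n. n \<in> N \<Longrightarrow> block_graphon (W n)"
    and p0: "\<forall>\<^sub>F n in along N. 0 < p n" and p: "p \<in> o[along N](\<lambda>_. 1)"
    and ent0: "\<forall>\<^sub>F n in along N. 0 \<le> graphon_ent (p n) (fn (W n))"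
    and c4: "cond4 E N p W" and c7: "cond7 V E N p W" and c8: "cond8 V E N p W" and c9: "cond9 N p W"
    and B: "\<not> negligible_Kblock V E N p W B" and \<Lambda>: "0 < \<Lambda>"
  shows "\<forall>\<^sub>F n in along N. n \<in> Kblock_at N W V B \<longrightarrow>
    admissible E \<Lambda> n (num (W n)) (mS (W n)) (wt (W n)) B (\<lambda>e. important N p W (src B e) (tgt B e) n)"
proof -
  define I where "I e = src B e" for e
  define J where "J e = tgt B e" for e
  have V: "finite V" and e2: "\<And>e. e \<in> E \<Longrightarrow> e \<subseteq> V \<and> card e = 2"
    using VE by (auto simp: simple_graph_def)
  have fE: "finite E" using e2 by (intro finite_subset[OF _ finite_Pow_iff[THEN iffD2, OF V]]) auto
  have ends: "e = {fst (edge_ends e), snd (edge_ends e)}" if "e \<in> E" for e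
    using edge_ends e2[OF that] by blast
  have n3: "\<forall>\<^sub>F n in along N. 3 \<le> n \<and> 1 \<le> ln (real n)"
    unfolding eventually_along
  proof (rule eventually_sequentiallyI[of 3], intro impI conjI)
    fix n :: nat assume n: "3 \<le> n"
    then have "exp 1 \<le> real n" using exp_le by linarith
    then show "1 \<le> ln (real n)" using n by (subst ln_ge_iff) auto
  qed
  have mS0: "0 \<le> mS X i" for X i by (simp add: mS_def)
  have imp: "\<forall>\<^sub>F n in along N. important N p W (I e) (J e) n \<longrightarrow> I e < num (W n) \<and> J e < num (W n) \<and>
        \<Lambda> \<le> wt (W n) (I e) (J e) * (real n * mS (W n) (I e))" for e
  proof -
    let ?N = "{n. important N p W (I e) (J e) n}"
    have "(\<lambda>n. wt (W n) (I e) (J e) * mS (W n) (I e)) \<in> \<omega>[along ?N](\<lambda>n. ln (real n) / real n)"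
      using c9 unfolding cond9_def by blast
    then have "\<forall>\<^sub>F n in along ?N. norm (wt (W n) (I e) (J e) * mS (W n) (I e)) \<ge> \<Lambda> * norm (ln (real n) / real n)"
      by (rule landau_omega.smallD[OF _ \<Lambda>])
    then have "\<forall>\<^sub>F n in along N. n \<in> ?N \<longrightarrow>
        norm (wt (W n) (I e) (J e) * mS (W n) (I e)) \<ge> \<Lambda> * norm (ln (real n) / real n)"
      by (rule eventually_along_cong)
    then show ?thesis using n3
    proof eventually_elim
      case (elim n)
      show ?case
      proof (intro impI conjI)
        assume i: "important N p W (I e) (J e) n"
        then have at: "n \<in> N" "1 \<le> I e" "I e < num (W n)" "1 \<le> J e" "J e < num (W n)"
          by (auto simp: important_def inner_at_def)
        then show "I e < num (W n)" "J e < num (W n)" by auto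
        have "0 \<le> wt (W n) (I e) (J e)" using block_graphon_wt(1)[OF W] at by simp
        then have "\<Lambda> * (ln (real n) / real n) \<le> wt (W n) (I e) (J e) * mS (W n) (I e)"
          using elim i mS0[of "W n" "I e"] by (simp add: abs_mult)
        then have "\<Lambda> * ln (real n) \<le> real n * (wt (W n) (I e) (J e) * mS (W n) (I e))"
          using elim by (intro ln_over_n_scale) auto
        moreover have "\<Lambda> * 1 \<le> \<Lambda> * ln (real n)" using elim \<Lambda> by (intro mult_left_mono) auto
        ultimately show "\<Lambda> \<le> wt (W n) (I e) (J e) * (real n * mS (W n) (I e))"
          by (simp add: mult_ac)
      qed
    qed
  qed
  \<comment> \<open>The factor 4 compensates the two halves lost in the lower bounds for w and for
    the product of the block sizes.\<close>
  have ent_big: "\<forall>\<^sub>F n in along N. 4 * \<Lambda> \<le> real n * graphon_ent (p n) (fn (W n))"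
  proof -
    have "\<forall>\<^sub>F n in along N. norm (graphon_ent (p n) (fn (W n))) \<ge> (4 * \<Lambda>) * norm (ln (real n) / real n)"
      using c4 \<Lambda> unfolding cond4_def by (intro landau_omega.smallD) auto
    then show ?thesis using ent0 n3
    proof eventually_elim
      case (elim n)
      then have "4 * \<Lambda> * (ln (real n) / real n) \<le> graphon_ent (p n) (fn (W n))" by simp
      then have "4 * \<Lambda> * ln (real n) \<le> real n * graphon_ent (p n) (fn (W n))"
        using elim by (intro ln_over_n_scale) auto
      moreover have "4 * \<Lambda> * 1 \<le> 4 * \<Lambda> * ln (real n)" using elim \<Lambda> by (intro mult_left_mono) auto
      ultimately show ?case by simp
    qed
  qed
  have p_small: "\<forall>\<^sub>F n in along N. p n * (2 * \<Lambda>) \<le> 1"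
  proof -
    have "\<forall>\<^sub>F n in along N. norm (p n) \<le> (1 / (2 * \<Lambda>)) * norm (1::real)"
      using p \<Lambda> by (intro landau_o.smallD) auto
    then show ?thesis by (rule eventually_mono) (use \<Lambda> in \<open>auto simp: field_simps abs_le_iff\<close>)
  qed
  have unimp: "\<forall>\<^sub>F n in along N. n \<in> Kblock_at N W V B \<longrightarrow> \<not> important N p W (I e) (J e) n \<longrightarrow>
      wt (W n) (I e) (J e) * \<Lambda> \<le> 1 \<and>
        \<Lambda> \<le> wt (W n) (I e) (J e) * (real n * mS (W n) (I e) * mS (W n) (J e))" if e: "e \<in> E" for e
  proof -
    define i j where "i = I e" and "j = J e"
    let ?N = "{n \<in> Kblock_at N W V B. \<not> important N p W i j n}"
    have "{fst (edge_ends e), snd (edge_ends e)} \<in> E" using e ends by metis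
    then obtain \<epsilon> where \<epsilon>: "(\<epsilon> \<longlongrightarrow> 0) (along ?N)"
      and big: "\<forall>\<^sub>F n in along ?N. mS (W n) i * mS (W n) j
          \<ge> (1 + \<epsilon> n) * (inverse (p n) * graphon_ent (p n) (fn (W n)))"
      and wp: "(\<lambda>n. wt (W n) i j - p n) \<in> o[along ?N](p)"
      using c8 B unfolding cond8_def Let_def I_def J_def i_def j_def by blast
    have "\<forall>\<^sub>F n in along ?N. norm (wt (W n) i j - p n) \<le> (1/2) * norm (p n)"
      using wp by (rule landau_o.smallD) simp
    moreover have "\<forall>\<^sub>F n in along ?N. - (1/2) < \<epsilon> n"
      using \<epsilon> by (rule order_tendstoD) simp
    ultimately have "\<forall>\<^sub>F n in along ?N. norm (wt (W n) i j - p n) \<le> (1/2) * norm (p n) \<and> - (1/2) < \<epsilon> n \<and>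
        mS (W n) i * mS (W n) j \<ge> (1 + \<epsilon> n) * (inverse (p n) * graphon_ent (p n) (fn (W n)))"
      using big by eventually_elim auto
    then have "\<forall>\<^sub>F n in along N. n \<in> ?N \<longrightarrow> norm (wt (W n) i j - p n) \<le> (1/2) * norm (p n) \<and> - (1/2) < \<epsilon> n \<and>
        mS (W n) i * mS (W n) j \<ge> (1 + \<epsilon> n) * (inverse (p n) * graphon_ent (p n) (fn (W n)))"
      by (rule eventually_along_cong)
    then show ?thesis using ent_big p_small ent0 p0
    proof eventually_elim
      case (elim n)
      show ?case
      proof (intro impI)
        assume "n \<in> Kblock_at N W V B" "\<not> important N p W (I e) (J e) n"
        then have "n \<in> ?N" by (simp add: i_def j_def)
        with elim have a: "\<bar>wt (W n) i j - p n\<bar> \<le> (1/2) * \<bar>p n\<bar>" "- (1/2) < \<epsilon> n"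
          "(1 + \<epsilon> n) * (inverse (p n) * graphon_ent (p n) (fn (W n))) \<le> mS (W n) i * mS (W n) j" by auto
        define H where "H = graphon_ent (p n) (fn (W n))"
        have pn: "0 < p n" using elim by simp
        have w1: "p n / 2 \<le> wt (W n) i j" "wt (W n) i j \<le> 2 * p n" using abs_le_D1[OF a(1)] abs_le_D2[OF a(1)] pn by auto
        have H0: "0 \<le> H" using elim by (simp add: H_def)
        have "wt (W n) i j * \<Lambda> \<le> 2 * p n * \<Lambda>" using w1 \<Lambda> by (intro mult_right_mono) auto
        also have "\<dots> \<le> 1" using elim by (simp add: mult_ac)
        finally have 1: "wt (W n) i j * \<Lambda> \<le> 1" .
        have "(1/2) * (inverse (p n) * H) \<le> (1 + \<epsilon> n) * (inverse (p n) * H)"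
          using a(2) pn H0 by (intro mult_right_mono) auto
        then have mm: "(1/2) * (inverse (p n) * H) \<le> mS (W n) i * mS (W n) j" using order_trans[OF _ a(3)[folded H_def]] by blast
        have "\<Lambda> \<le> real n * H / 4" using elim by (simp add: H_def)
        also have "\<dots> = (p n / 2) * (real n * ((1/2) * (inverse (p n) * H)))" using pn by (simp add: field_simps)
        also have "\<dots> \<le> wt (W n) i j * (real n * (mS (W n) i * mS (W n) j))"
          by (rule mult_mono[OF w1(1) mult_left_mono[OF mm]]) (use w1 pn H0 in auto)
        finally show "wt (W n) (I e) (J e) * \<Lambda> \<le> 1 \<and>
            \<Lambda> \<le> wt (W n) (I e) (J e) * (real n * mS (W n) (I e) * mS (W n) (J e))"
          using 1 by (simp add: i_def j_def mult_ac)
      qed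
    qed
  qed
  have dis: "\<forall>\<^sub>F n in along N. n \<in> Kblock_at N W V B \<longrightarrow>
      pairwise disjnt {e \<in> E. important N p W (I e) (J e) n \<and> wt (W n) (I e) (J e) < 1}"
  proof -
    have "\<forall>\<^sub>F n in along (Kblock_at N W V B).
        pairwise disjnt {e \<in> E. \<exists>u v. e = {u, v} \<and> somewhat_important N p W (B u) (B v) n}"
      using c7 B unfolding cond7_def by blast
    then have "\<forall>\<^sub>F n in along N. n \<in> Kblock_at N W V B \<longrightarrow>
        pairwise disjnt {e \<in> E. \<exists>u v. e = {u, v} \<and> somewhat_important N p W (B u) (B v) n}"
      by (rule eventually_along_cong)
    then show ?thesis
    proof (rule eventually_mono, intro impI)
      fix n assume "n \<in> Kblock_at N W V B \<longrightarrow>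
        pairwise disjnt {e \<in> E. \<exists>u v. e = {u, v} \<and> somewhat_important N p W (B u) (B v) n}"
        and "n \<in> Kblock_at N W V B"
      then have "pairwise disjnt {e \<in> E. \<exists>u v. e = {u, v} \<and> somewhat_important N p W (B u) (B v) n}" by blast
      then show "pairwise disjnt {e \<in> E. important N p W (I e) (J e) n \<and> wt (W n) (I e) (J e) < 1}"
      proof (rule pairwise_subset, intro subsetI)
        fix e assume "e \<in> {e \<in> E. important N p W (I e) (J e) n \<and> wt (W n) (I e) (J e) < 1}"
        then have "e \<in> E" "somewhat_important N p W (src B e) (tgt B e) n"
          by (auto simp: somewhat_important_def I_def J_def)
        then show "e \<in> {e \<in> E. \<exists>u v. e = {u, v} \<and> somewhat_important N p W (B u) (B v) n}"
          using ends by blast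
      qed
    qed
  qed
  have "\<forall>\<^sub>F n in along N. \<forall>e\<in>E. important N p W (I e) (J e) n \<longrightarrow> I e < num (W n) \<and> J e < num (W n) \<and>
        \<Lambda> \<le> wt (W n) (I e) (J e) * (real n * mS (W n) (I e))"
    using fE imp by (intro eventually_ball_finite) auto
  moreover have "\<forall>\<^sub>F n in along N. \<forall>e\<in>E. n \<in> Kblock_at N W V B \<longrightarrow> \<not> important N p W (I e) (J e) n \<longrightarrow>
      wt (W n) (I e) (J e) * \<Lambda> \<le> 1 \<and>
        \<Lambda> \<le> wt (W n) (I e) (J e) * (real n * mS (W n) (I e) * mS (W n) (J e))"
    using fE unimp by (intro eventually_ball_finite) auto
  ultimately show ?thesis using dis
    by eventually_elim (unfold admissible_def I_def J_def, blast)
qed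

text \<open>The set \<P> will hold the non-negligible K-blocks. The others number at most
  \<open>K0 ^ card V\<close>, and \<kappa> is small enough that they carry at most the fraction
  \<eta> / 2 of Hom(K,W); the first moment loses another \<eta> / 2 on the rest. The mean then gives
  a probability of at least \<eta> Hom(K,W) times the proportion of S among all regular graphs, and
  the last hypothesis says that every logarithmic loss fits into \<eta> I_p(W) n^2.\<close>

lemma upper_tail_at:
  fixes V :: "'v set" and E :: "'v set set" and X :: block_data and \<eta> \<delta> \<kappa> \<Lambda> q :: real and \<P> :: "('v \<Rightarrow> nat) set"
  assumes VE: "simple_graph V E" and X: "block_graphon X"
    and bw: "block_weights (mS X) (wt X) n (num X) d q"
    and K0: "num X \<le> K0"
    and \<eta>: "0 < \<eta>" "\<eta> < 1/2" and \<delta>: "0 < \<delta>" "\<delta> \<le> 1/10" "1 - \<eta> / 2 \<le> (1 - 5 * \<delta>) ^ (card E + card V)"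
    and \<Lambda>: "400 * (real (card V + card E) + 2) * (real K0 + 1)\<^sup>2 \<le> \<delta> * \<Lambda>"
    and mL: "\<And>i. i \<in> {1..num X} \<Longrightarrow> \<Lambda> \<le> real n * mS X i"
    and \<P>: "\<And>B. B \<in> V \<rightarrow>\<^sub>E {1..num X} \<Longrightarrow> B \<notin> \<P> \<Longrightarrow> block_hom V E X B \<le> \<kappa> * q ^ card E"
    and \<kappa>: "0 \<le> \<kappa>" "2 * real (K0 ^ card V) * \<kappa> \<le> \<eta>"
    and imp: "\<And>B. B \<in> V \<rightarrow>\<^sub>E {1..num X} \<Longrightarrow> B \<in> \<P> \<Longrightarrow>
      \<exists>imp. admissible E \<Lambda> n (num X) (mS X) (wt X) B imp"
    and hom: "q ^ card E \<le> hom_density V E (fn X)"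
    and big: "(900 * real K0 ^ 4 + real (card E) + ln (1 / \<eta>)) * (real n * ln (real n))
      \<le> \<eta> * (graphon_ent q (fn X) * (real n)\<^sup>2)"
  shows "let P = measure_pmf.prob (random_regular_graph n d)
      {G. real (hom_count V E {1..n} G) \<ge> (1 - 2 * \<eta>) * hom_density V E (fn X) * real n ^ card V}
    in P > 0 \<and> - ln P \<le> (1/2 + 2 * \<eta>) * graphon_ent q (fn X) * (real n)\<^sup>2"
proof -
  interpret block_weights "mS X" "wt X" n "num X" d q by (rule bw)
  let ?J = "{1..num X}"
  define h where "h = hom_density V E (fn X)"
  have V: "finite V" using VE by (simp add: simple_graph_def)
  have n0: "0 < real n" using n by simp
  have ln1: "1 \<le> ln (real n)"
  proof -
    have "exp 1 \<le> real n" using exp_le n by linarith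
    then show ?thesis using n0 by (subst ln_ge_iff) auto
  qed
  have ent: "ent = graphon_ent q (fn X)"
    by (simp add: ent_def block_graphon_ent[OF X])
  have \<Lambda>': "400 * (real (card V + card E) + 2) * (real (num X) + 1)\<^sup>2 \<le> \<delta> * \<Lambda>"
  proof -
    have "400 * (real (card V + card E) + 2) * (real (num X) + 1)\<^sup>2
        \<le> 400 * (real (card V + card E) + 2) * (real K0 + 1)\<^sup>2"
      using K0 by (intro mult_left_mono power_mono) auto
    then show ?thesis using \<Lambda> by linarith
  qed
  obtain S \<beta> where S: "S \<subseteq> regular_graphs n d" "0 < card S"
    and lnS: "ln (real (card (regular_graphs n d))) - ln (real (card S))
      \<le> (1/2) * ent * (real n)\<^sup>2 + 900 * real (num X) ^ 4 * (real n * ln (real n))"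
    and main: "\<And>B imp. B ` V \<subseteq> ?J \<Longrightarrow> admissible E \<Lambda> n (num X) (mS X) (wt X) B imp \<Longrightarrow>
      (1 - 5 * \<delta>) ^ (card E + card V) *
        ((\<Prod>e\<in>E. wt X (src B e) (tgt B e)) * (\<Prod>v\<in>V. real n * mS X (B v))) *
        real (card S) \<le> (\<Sum>G\<in>S. real (card (bhoms {1..n} \<beta> G V E B)))"
    by (rule kblock_first_moment[OF VE \<delta>(1,2) \<Lambda>' mL]) blast+
  let ?c = "(1 - 5 * \<delta>) ^ (card E + card V)"
  have kb: "?c * block_hom V E X B * real n ^ card V * real (card S)
      \<le> (\<Sum>G\<in>S. real (card (bhoms {1..n} \<beta> G V E B)))" if B: "B \<in> V \<rightarrow>\<^sub>E ?J" "B \<in> \<P>" for B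
  proof -
    have BV: "B ` V \<subseteq> ?J" using B by auto
    obtain imp where "admissible E \<Lambda> n (num X) (mS X) (wt X) B imp" using imp[OF B] by blast
    note main[OF BV this]
    moreover have "(\<Prod>v\<in>V. real n * mS X (B v)) = real n ^ card V * (\<Prod>v\<in>V. mS X (B v))"
      by (simp add: prod.distrib)
    ultimately show ?thesis by (simp add: block_hom_def mult_ac)
  qed
  have fB: "finite (V \<rightarrow>\<^sub>E ?J)" using V by (intro finite_PiE) auto
  have bh0: "0 \<le> block_hom V E X B" if "B \<in> V \<rightarrow>\<^sub>E ?J" for B
    unfolding block_hom_def
  proof (intro mult_nonneg_nonneg prod_nonneg)
    fix e assume e: "e \<in> E"
    then have "e \<subseteq> V" "card e = 2" using VE by (auto simp: simple_graph_def)
    then have "{fst (edge_ends e), snd (edge_ends e)} \<subseteq> V" using edge_ends by metis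
    then have "src B e \<in> ?J" "tgt B e \<in> ?J" using that by auto
    then show "0 \<le> wt X (src B e) (tgt B e)" by (rule block_graphon_wt(1)[OF X])
  qed (simp add: mS_def)
  have q0: "0 < q ^ card E" using p by simp
  then have h0: "0 < h" using hom h_def by linarith
  let ?Q = "(V \<rightarrow>\<^sub>E ?J) \<inter> \<P>"
  have c0: "0 \<le> ?c" "?c \<ge> 1 - \<eta> / 2" using \<delta> by auto
  have part: "(1 - \<eta> / 2) * h \<le> (\<Sum>B\<in>?Q. block_hom V E X B)"
  proof -
    have "h = (\<Sum>B\<in>?Q. block_hom V E X B) + (\<Sum>B\<in>(V \<rightarrow>\<^sub>E ?J) - \<P>. block_hom V E X B)"
      unfolding h_def hom_density_eq[OF X VE] using fB by (rule sum.Int_Diff)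
    moreover have "(\<Sum>B\<in>(V \<rightarrow>\<^sub>E ?J) - \<P>. block_hom V E X B) \<le> real (K0 ^ card V) * (\<kappa> * q ^ card E)"
    proof -
      have "(\<Sum>B\<in>(V \<rightarrow>\<^sub>E ?J) - \<P>. block_hom V E X B) \<le> (\<Sum>B\<in>(V \<rightarrow>\<^sub>E ?J) - \<P>. \<kappa> * q ^ card E)"
        using \<P> by (intro sum_mono) auto
      also have "\<dots> = real (card ((V \<rightarrow>\<^sub>E ?J) - \<P>)) * (\<kappa> * q ^ card E)" by simp
      also have "\<dots> \<le> real (K0 ^ card V) * (\<kappa> * q ^ card E)"
      proof (rule mult_right_mono)
        have "card ((V \<rightarrow>\<^sub>E ?J) - \<P>) \<le> card (V \<rightarrow>\<^sub>E ?J)" using fB by (intro card_mono) auto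
        also have "\<dots> = num X ^ card V" using V by (simp add: card_PiE)
        also have "\<dots> \<le> K0 ^ card V" using K0 by (rule power_mono) simp
        finally show "real (card ((V \<rightarrow>\<^sub>E ?J) - \<P>)) \<le> real (K0 ^ card V)" by (rule of_nat_mono)
      qed (use \<kappa> q0 in simp)
      finally show ?thesis .
    qed
    moreover have "real (K0 ^ card V) * (\<kappa> * q ^ card E) \<le> (\<eta> / 2) * h"
    proof -
      have "real (K0 ^ card V) * \<kappa> * q ^ card E \<le> (\<eta> / 2) * h"
        using \<kappa> hom q0 \<eta> by (intro mult_mono) (auto simp: h_def)
      then show ?thesis by (simp add: mult.assoc)
    qed
    ultimately show ?thesis by (simp add: algebra_simps)
  qed
  define \<mu> where "\<mu> = h * real n ^ card V"
  have \<mu>0: "0 < \<mu>" using h0 n0 by (simp add: \<mu>_def)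
  have mean: "(1 - \<eta>) * \<mu> * real (card S) \<le> (\<Sum>G\<in>S. real (hom_count V E {1..n} G))"
  proof -
    have nS: "0 \<le> real n ^ card V * real (card S)" by simp
    have "1 - \<eta> \<le> (1 - \<eta> / 2) * (1 - \<eta> / 2)" by (simp add: algebra_simps)
    then have "(1 - \<eta>) * h \<le> (1 - \<eta> / 2) * (1 - \<eta> / 2) * h" using h0 by (intro mult_right_mono) auto
    also have "\<dots> \<le> ?c * (\<Sum>B\<in>?Q. block_hom V E X B)"
      unfolding mult.assoc using part c0 \<eta> h0 by (intro mult_mono) auto
    finally have "(1 - \<eta>) * h * (real n ^ card V * real (card S))
        \<le> ?c * (\<Sum>B\<in>?Q. block_hom V E X B) * (real n ^ card V * real (card S))"
      using nS by (rule mult_right_mono)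
    also have "\<dots> = (\<Sum>B\<in>?Q. ?c * block_hom V E X B * real n ^ card V * real (card S))"
      by (simp add: sum_distrib_left sum_distrib_right mult_ac)
    also have "\<dots> \<le> (\<Sum>B\<in>?Q. \<Sum>G\<in>S. real (card (bhoms {1..n} \<beta> G V E B)))"
      using kb by (intro sum_mono) auto
    also have "\<dots> \<le> (\<Sum>B\<in>V \<rightarrow>\<^sub>E ?J. \<Sum>G\<in>S. real (card (bhoms {1..n} \<beta> G V E B)))"
      using fB by (intro sum_mono2 sum_nonneg) auto
    also have "\<dots> = (\<Sum>G\<in>S. \<Sum>B\<in>V \<rightarrow>\<^sub>E ?J. real (card (bhoms {1..n} \<beta> G V E B)))" by (rule sum.swap)
    also have "\<dots> \<le> (\<Sum>G\<in>S. real (hom_count V E {1..n} G))"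
    proof (rule sum_mono)
      fix G
      have "(\<Sum>B\<in>V \<rightarrow>\<^sub>E ?J. card (bhoms {1..n} \<beta> G V E B)) \<le> hom_count V E {1..n} G"
        using V by (intro sum_bhoms_le_hom_count) auto
      then show "(\<Sum>B\<in>V \<rightarrow>\<^sub>E ?J. real (card (bhoms {1..n} \<beta> G V E B))) \<le> real (hom_count V E {1..n} G)"
        by (metis of_nat_le_iff of_nat_sum)
    qed
    finally show ?thesis by (simp add: \<mu>_def mult_ac)
  qed
  have count: "real (hom_count V E {1..n} G) \<le> real n ^ card V" for G
  proof -
    have "hom_count V E {1..n} G \<le> card (V \<rightarrow>\<^sub>E {1..n})"
      unfolding hom_count_def using V by (intro card_mono finite_PiE) auto
    also have "\<dots> = n ^ card V" using V by (simp add: card_PiE)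
    finally show ?thesis by (metis of_nat_le_iff of_nat_power)
  qed
  define R where "R = regular_graphs n d"
  have R: "finite R" unfolding R_def using card_regular_le_choose[OF ev] by blast
  define P where "P = measure_pmf.prob (random_regular_graph n d)
      {G. real (hom_count V E {1..n} G) \<ge> (1 - 2 * \<eta>) * h * real n ^ card V}"
  have cR: "0 < real (card R)"
    using S R card_mono[of R S] unfolding R_def by (simp add: order_less_le_trans)
  have nV: "0 < real n ^ card V" using n0 by simp
  have "\<eta> * (\<mu> / real n ^ card V) * (real (card S) / real (card R)) \<le> P"
    unfolding P_def random_regular_graph_def R_def[symmetric] mult.assoc[of "1 - 2 * \<eta>"] \<mu>_def[symmetric]
    using R S count \<eta> \<mu>0 nV mean unfolding R_def[symmetric] by (intro prob_ge_of_mean) auto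
  then have P: "\<eta> * h * (real (card S) / real (card R)) \<le> P"
    using n0 by (simp add: \<mu>_def)
  have cS: "0 < real (card S)" using S by simp
  have lhs0: "0 < \<eta> * h * (real (card S) / real (card R))"
    using \<eta> h0 cR cS by (intro mult_pos_pos divide_pos_pos)
  then have P0: "0 < P" using P by linarith
  have "ln (\<eta> * h * (real (card S) / real (card R))) \<le> ln P"
    using P lhs0 P0 by (subst ln_le_cancel_iff) auto
  moreover have "ln (\<eta> * h * (real (card S) / real (card R)))
      = ln \<eta> + ln h + (ln (real (card S)) - ln (real (card R)))"
    using \<eta> h0 cR cS by (simp add: ln_mult ln_div)
  \<comment> \<open>The mean is only polynomially small relative to n^v(K): d is a positive integer,
    so q \<ge> 1 / n, and h is at least q to the power e(K).\<close>
  moreover have "ln h \<ge> - (real (card E) * ln (real n))"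
  proof -
    have "1 / real n \<le> q"
    proof -
      have "0 < real d" using d p n0 by simp
      then have "1 \<le> real d" by simp
      then show ?thesis using d n0 by (simp add: field_simps)
    qed
    then have "(1 / real n) ^ card E \<le> q ^ card E" using n0 by (intro power_mono) auto
    then have "(1 / real n) ^ card E \<le> h" using hom by (simp add: h_def)
    then have "ln ((1 / real n) ^ card E) \<le> ln h" using n0 h0 by (subst ln_le_cancel_iff) auto
    moreover have "ln ((1 / real n) ^ card E) = - (real (card E) * ln (real n))"
      using n0 by (simp add: ln_realpow ln_div)
    ultimately show ?thesis by simp
  qed
  moreover have "ln (1 / \<eta>) = - ln \<eta>" using \<eta> by (simp add: ln_div)
  ultimately have 1: "- ln P \<le> ln (real (card R)) - ln (real (card S)) + real (card E) * ln (real n) + ln (1 / \<eta>)"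
    by linarith
  define l where "l = real n * ln (real n)"
  have "1 * ln (real n) \<le> l" unfolding l_def using n ln1 by (intro mult_right_mono) auto
  then have l: "ln (real n) \<le> l" "1 \<le> l" using ln1 by linarith+
  have 2: "real (card E) * ln (real n) \<le> real (card E) * l" using l by (intro mult_left_mono) auto
  have "0 \<le> ln (1 / \<eta>)" using \<eta> by simp
  then have 3: "ln (1 / \<eta>) * 1 \<le> ln (1 / \<eta>) * l" using l by (intro mult_left_mono) auto
  have "900 * real (num X) ^ 4 \<le> 900 * real K0 ^ 4" using K0 by (intro mult_left_mono power_mono) auto
  then have 4: "900 * real (num X) ^ 4 * l \<le> 900 * real K0 ^ 4 * l" using l by (intro mult_right_mono) auto
  have 5: "(900 * real K0 ^ 4 + real (card E) + ln (1 / \<eta>)) * l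
      = 900 * real K0 ^ 4 * l + real (card E) * l + ln (1 / \<eta>) * l" by (simp add: algebra_simps)
  have l0: "0 \<le> (900 * real K0 ^ 4 + real (card E) + ln (1 / \<eta>)) * l"
    using l \<open>0 \<le> ln (1 / \<eta>)\<close> by (intro mult_nonneg_nonneg add_nonneg_nonneg) auto
  have "- ln P \<le> (1/2) * ent * (real n)\<^sup>2 + \<eta> * (graphon_ent q (fn X) * (real n)\<^sup>2)"
    using 1 2 3 4 5 lnS big unfolding l_def[symmetric] R_def[symmetric] by linarith
  \<comment> \<open>The slack is doubled only to let the same parameter 2 \<eta> appear in the event
    and in the exponent.\<close>
  also have "\<dots> \<le> (1/2) * ent * (real n)\<^sup>2 + 2 * (\<eta> * (graphon_ent q (fn X) * (real n)\<^sup>2))"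
    using l0 big unfolding l_def[symmetric] by linarith
  also have "\<dots> = (1/2 + 2 * \<eta>) * graphon_ent q (fn X) * (real n)\<^sup>2"
    unfolding ent by (simp add: algebra_simps)
  finally have "- ln P \<le> (1/2 + 2 * \<eta>) * graphon_ent q (fn X) * (real n)\<^sup>2" .
  then show ?thesis using P0 unfolding Let_def P_def h_def by blast
qed


theorem theorem2p19:
  fixes V :: "'v set" and E :: "'v set set"
    and N :: "nat set" and d :: "nat \<Rightarrow> nat" and p :: "nat \<Rightarrow> real"
    and W :: "nat \<Rightarrow> block_data"
  assumes "simple_graph V E"
    and "infinite N"
    and "\<And>n. n \<in> N \<Longrightarrow> d n > 0 \<and> even (d n * n)"
    and "\<And>n. p n = real (d n) / real n"
    and "p \<in> \<omega>[along N](\<lambda>n. ln (ln (real n)) / real n)"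
    and "p \<in> o[along N](\<lambda>_. 1)"
    and "\<And>n. n \<in> N \<Longrightarrow> block_graphon (W n)"
    and "(\<lambda>n. real (num (W n))) \<in> O[along N](\<lambda>_. 1)"
    and "cond1 N p W"
    and "cond2 N p W"
    and "cond3 V E N p W"
    and "cond4 E N p W"
    and "cond5 N W"
    and "cond6 N p W"
    and "cond7 V E N p W"
    and "cond8 V E N p W"
    and "cond9 N p W"
    and "cond10 V E N p W"
  shows "\<exists>\<epsilon> \<delta> :: nat \<Rightarrow> real. (\<epsilon> \<longlongrightarrow> 0) (along N) \<and> (\<delta> \<longlongrightarrow> 0) (along N) \<and>
    (\<forall>\<^sub>F n in along N.
       let P = measure_pmf.prob (random_regular_graph n (d n))
                 {G. real (hom_count V E {1..n} G)
                       \<ge> (1 - \<epsilon> n) * hom_density V E (fn (W n)) * real n ^ card V}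
       in P > 0 \<and> - ln P \<le> (1 / 2 + \<delta> n) * graphon_ent (p n) (fn (W n)) * (real n)\<^sup>2)"
proof -
  note VE = assms(1) and d = assms(3) and p_def = assms(4) and p1 = assms(6) and W = assms(7)
  define h where "h n = hom_density V E (fn (W n))" for n
  define H where "H n = graphon_ent (p n) (fn (W n))" for n
  define prob where "prob \<eta> n = measure_pmf.prob (random_regular_graph n (d n))
      {G. real (hom_count V E {1..n} G) \<ge> (1 - \<eta>) * h n * real n ^ card V}" for \<eta> n
  \<comment> \<open>One parameter governs both the event and the exponent. Increasing it enlarges
    the event and weakens the bound, so \<open>good\<close> is upward closed and the diagonal
    argument yields one vanishing sequence for both places.\<close>
  define good where "good \<eta> n \<longleftrightarrow> prob \<eta> n > 0 \<and> - ln (prob \<eta> n) \<le> (1/2 + \<eta>) * H n * (real n)\<^sup>2"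
    for \<eta> n
  have V: "finite V" using VE by (simp add: simple_graph_def)
  have basic: "\<forall>\<^sub>F n in along N. n \<in> N \<and> 3 \<le> n"
    unfolding eventually_along by (rule eventually_sequentiallyI[of 3]) simp
  have p_small: "\<forall>\<^sub>F n in along N. p n \<le> 1/4"
  proof -
    have "\<forall>\<^sub>F n in along N. norm (p n) \<le> (1/4) * norm (1::real)"
      using p1 by (rule landau_o.smallD) simp
    then show ?thesis by (rule eventually_mono) (auto simp: abs_le_iff)
  qed
  have p_pos: "\<forall>\<^sub>F n in along N. 0 < p n"
    using basic by (rule eventually_mono) (use d in \<open>auto simp: p_def\<close>)
  have H0: "\<forall>\<^sub>F n in along N. 0 \<le> H n"
    using basic p_small p_pos
  proof eventually_elim
    case (elim n)
    then have Wn: "block_graphon (W n)" using W by blast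
    have "0 \<le> rel_ent (p n) (wt (W n) i j)" if "i \<in> {1..num (W n)}" "j \<in> {1..num (W n)}" for i j
      using elim block_graphon_wt[OF Wn that] by (intro rel_ent_nonneg) auto
    then show ?case unfolding H_def block_graphon_ent[OF Wn]
      by (intro sum_nonneg mult_nonneg_nonneg) (auto simp: mS_def)
  qed
  \<comment> \<open>From Condition (3). It allows K-blocks of weight o(p^e(K)) to be dropped against
    Hom(K,W).\<close>
  have h_ge: "\<forall>\<^sub>F n in along N. p n ^ card E \<le> h n"
  proof -
    obtain c where c: "0 < c" and ev: "\<forall>\<^sub>F n in along N. (1 + c) * p n ^ card E \<le> h n"
      using assms(11) unfolding cond3_def h_def by blast
    show ?thesis using ev p_pos
    proof eventually_elim
      case (elim n)
      then have "1 * p n ^ card E \<le> (1 + c) * p n ^ card E" using c by (intro mult_right_mono) auto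
      then show ?case using elim(1) by linarith
    qed
  qed
  have mono: "\<forall>\<^sub>F n in along N. \<forall>\<eta> \<theta>. 0 < \<eta> \<longrightarrow> \<eta> \<le> \<theta> \<longrightarrow> good \<eta> n \<longrightarrow> good \<theta> n"
    using H0 h_ge p_pos
  proof eventually_elim
    case (elim n)
    show ?case
    proof (intro allI impI)
      fix \<eta> \<theta> :: real assume \<eta>: "0 < \<eta>" "\<eta> \<le> \<theta>" and g: "good \<eta> n"
      have "0 \<le> p n ^ card E" using elim by simp
      then have h0: "0 \<le> h n" using elim by linarith
      have "(1 - \<theta>) * h n * real n ^ card V \<le> (1 - \<eta>) * h n * real n ^ card V"
        using \<eta> h0 by (intro mult_right_mono) auto
      then have le: "prob \<eta> n \<le> prob \<theta> n"
        unfolding prob_def by (intro measure_pmf.finite_measure_mono) auto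
      then have pos: "0 < prob \<theta> n" using g by (auto simp: good_def)
      have "- ln (prob \<theta> n) \<le> - ln (prob \<eta> n)"
        using le g by (simp add: good_def)
      also have "\<dots> \<le> (1/2 + \<eta>) * H n * (real n)\<^sup>2" using g by (simp add: good_def)
      also have "\<dots> \<le> (1/2 + \<theta>) * H n * (real n)\<^sup>2"
        using \<eta> elim by (intro mult_right_mono) auto
      finally show "good \<theta> n" using pos by (simp add: good_def)
    qed
  qed
  obtain K0 where K0: "\<forall>\<^sub>F n in along N. num (W n) \<le> K0"
  proof -
    obtain c where c: "\<forall>\<^sub>F n in along N. norm (real (num (W n))) \<le> c * norm (1::real)"
      using landau_o.bigE[OF assms(8)] by blast
    have "\<forall>\<^sub>F n in along N. num (W n) \<le> nat \<lceil>c\<rceil>"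
      using c by (rule eventually_mono) (simp, linarith)
    then show ?thesis by (rule that)
  qed
  have ev: "\<forall>\<^sub>F n in along N. good \<eta> n" if \<eta>: "0 < \<eta>" for \<eta>
  proof -
    \<comment> \<open>The estimate at a single n is run with \<theta> < 1/2 and yields
      \<open>good (2 * \<theta>)\<close>; halving the minimum ensures 2 \<theta> \<le>
      \<eta>.\<close>
    define \<theta> where "\<theta> = min \<eta> (1/2) / 2"
    have \<theta>: "0 < \<theta>" "\<theta> < 1/2" "2 * \<theta> \<le> \<eta>" using \<eta> by (auto simp: \<theta>_def)
    define s where "s = real (card E + card V) + 1"
    have s: "1 \<le> s" by (simp add: s_def)
    \<comment> \<open>Chosen so that 5 \<delta> times the number e(K) + v(K) of lost factors is at
      most \<theta> / 2 in Bernoulli's inequality.\<close>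
    define \<delta> where "\<delta> = \<theta> / (10 * s)"
    have \<delta>: "0 < \<delta>" "\<delta> \<le> 1/10"
      using \<theta> s by (auto simp: \<delta>_def field_simps)
    have \<delta>3: "1 - \<theta> / 2 \<le> (1 - 5 * \<delta>) ^ (card E + card V)"
    proof -
      have "real (card E + card V) * (5 * \<delta>) \<le> s * (5 * \<delta>)"
        using \<delta> by (intro mult_right_mono) (auto simp: s_def)
      also have "\<dots> = \<theta> / 2" using s by (simp add: \<delta>_def)
      finally have "1 - \<theta> / 2 \<le> 1 + real (card E + card V) * (- (5 * \<delta>))" by simp
      also have "\<dots> \<le> (1 + (- (5 * \<delta>))) ^ (card E + card V)"
        using \<delta> by (intro Bernoulli_inequality) auto
      finally show ?thesis by simp
    qed
    define \<Lambda> where "\<Lambda> = 400 * (real (card V + card E) + 2) * (real K0 + 1)\<^sup>2 / \<delta>"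
    have \<Lambda>: "400 * (real (card V + card E) + 2) * (real K0 + 1)\<^sup>2 \<le> \<delta> * \<Lambda>"
      using \<delta> by (simp add: \<Lambda>_def)
    have \<Lambda>2: "2 \<le> \<Lambda>"
    proof -
      have "(400 * 2) * 1 \<le> 400 * (real (card V + card E) + 2) * (real K0 + 1)\<^sup>2"
        by (intro mult_mono) auto
      moreover have "\<delta> * 2 \<le> 1" using \<delta> by simp
      ultimately have "\<delta> * 2 \<le> \<delta> * \<Lambda>" using \<Lambda> by linarith
      then show ?thesis using \<delta> by simp
    qed
    \<comment> \<open>All negligible K-blocks together then weigh at most \<theta> / 2 times p^e(K).
      The added 1 keeps the denominator positive.\<close>
    define \<kappa> where "\<kappa> = \<theta> / (2 * (real (K0 ^ card V) + 1))"
    have KV: "0 < 2 * (real (K0 ^ card V) + 1)" by (simp add: add_nonneg_pos)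
    have \<kappa>: "0 < \<kappa>" "2 * real (K0 ^ card V) * \<kappa> \<le> \<theta>"
    proof -
      show k0: "0 < \<kappa>" using \<theta> KV unfolding \<kappa>_def by (intro divide_pos_pos)
      have "2 * real (K0 ^ card V) * \<kappa> \<le> 2 * (real (K0 ^ card V) + 1) * \<kappa>"
        using k0 by (intro mult_right_mono) auto
      also have "\<dots> = \<theta>" using KV by (simp add: \<kappa>_def del: of_nat_power)
      finally show "2 * real (K0 ^ card V) * \<kappa> \<le> \<theta>" .
    qed
    \<comment> \<open>\<theta> C is the sum of all errors in units of n ln n: counting the graphs,
      the e(K) ln n lost through Hom(K,W), and the fraction \<theta> of the mean.\<close>
    define C where "C = (900 * real K0 ^ 4 + real (card E) + ln (1 / \<theta>)) / \<theta>"
    have C0: "0 \<le> C" using \<theta> by (auto simp: C_def intro!: divide_nonneg_nonneg add_nonneg_nonneg)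
    have big: "\<forall>\<^sub>F n in along N. (900 * real K0 ^ 4 + real (card E) + ln (1 / \<theta>)) * (real n * ln (real n))
        \<le> \<theta> * (H n * (real n)\<^sup>2)"
    proof -
      have "\<forall>\<^sub>F n in along N. norm (H n) \<ge> (C + 1) * norm (ln (real n) / real n)"
        using assms(12) C0 unfolding cond4_def H_def by (intro landau_omega.smallD) auto
      then show ?thesis using H0 basic
      proof eventually_elim
        case (elim n)
        have l0: "0 \<le> ln (real n) / real n" using elim by simp
        have "C * (ln (real n) / real n) \<le> (C + 1) * (ln (real n) / real n)"
          using l0 by (intro mult_right_mono) auto
        then have "C * (ln (real n) / real n) \<le> H n" using elim l0 by simp
        then have "\<theta> * (C * (ln (real n) / real n)) * (real n)\<^sup>2 \<le> \<theta> * H n * (real n)\<^sup>2"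
          using \<theta> by (intro mult_right_mono mult_left_mono) auto
        moreover have "\<theta> * (C * (ln (real n) / real n)) * (real n)\<^sup>2 = (\<theta> * C) * (real n * ln (real n))"
          using elim by (simp add: power2_eq_square)
        moreover have "\<theta> * C = 900 * real K0 ^ 4 + real (card E) + ln (1 / \<theta>)" using \<theta> by (simp add: C_def)
        ultimately show ?case by (simp add: mult.assoc)
      qed
    qed
    have mL: "\<forall>\<^sub>F n in along N. \<forall>i\<in>{1..K0}. n \<in> index_at N W i \<longrightarrow> \<Lambda> \<le> real n * mS (W n) i"
    proof (rule eventually_ball_finite, simp, rule ballI)
      fix i
      have "(\<lambda>n. mS (W n) i) \<in> \<omega>[along (index_at N W i)](\<lambda>n. 1 / real n)"
        using assms(13) by (simp add: cond5_def)
      then have "\<forall>\<^sub>F n in along (index_at N W i). norm (mS (W n) i) \<ge> \<Lambda> * norm (1 / real n)"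
        using \<Lambda>2 by (intro landau_omega.smallD) auto
      then have "\<forall>\<^sub>F n in along N. n \<in> index_at N W i \<longrightarrow> norm (mS (W n) i) \<ge> \<Lambda> * norm (1 / real n)"
        by (rule eventually_along_cong)
      then show "\<forall>\<^sub>F n in along N. n \<in> index_at N W i \<longrightarrow> \<Lambda> \<le> real n * mS (W n) i"
        using basic
      proof eventually_elim
        case (elim n)
        then show ?case by (auto simp: mS_def field_simps)
      qed
    qed
    \<comment> \<open>Negligibility concerns the whole sequence, so K-blocks are sorted once and for
      all and not separately at each n.\<close>
    define \<P> where "\<P> = {B. \<not> negligible_Kblock V E N p W B}"
    define Q where "Q n B \<longleftrightarrow> (B \<notin> \<P> \<longrightarrow> block_hom V E (W n) B \<le> \<kappa> * p n ^ card E) \<and>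
      (B \<in> \<P> \<longrightarrow> (\<exists>imp. admissible E \<Lambda> n (num (W n)) (mS (W n)) (wt (W n)) B imp))" for n B
    \<comment> \<open>There are only finitely many maps into \<open>{1..K0}\<close>, so the
      threshold in n can be taken uniform over all K-blocks.\<close>
    have blocks: "\<forall>\<^sub>F n in along N. \<forall>B\<in>V \<rightarrow>\<^sub>E {1..K0}. n \<in> Kblock_at N W V B \<longrightarrow> Q n B"
    proof (rule eventually_ball_finite)
      show "finite (V \<rightarrow>\<^sub>E {1..K0})" using V by (intro finite_PiE) auto
      show "\<forall>B\<in>V \<rightarrow>\<^sub>E {1..K0}. \<forall>\<^sub>F n in along N. n \<in> Kblock_at N W V B \<longrightarrow> Q n B"
      proof
        fix B assume BE: "B \<in> V \<rightarrow>\<^sub>E {1..K0}"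
        show "\<forall>\<^sub>F n in along N. n \<in> Kblock_at N W V B \<longrightarrow> Q n B"
        proof (cases "B \<in> \<P>")
          case True
          then have nn: "\<not> negligible_Kblock V E N p W B" by (simp add: \<P>_def)
          have ent0: "\<forall>\<^sub>F n in along N. 0 \<le> graphon_ent (p n) (fn (W n))" using H0 by (simp add: H_def)
          have \<Lambda>0: "0 < \<Lambda>" using \<Lambda>2 by simp
          note ev = kblock_eventually[OF VE W p_pos p1 ent0 assms(12) assms(15) assms(16) assms(17) nn \<Lambda>0]
          show ?thesis
          proof (rule eventually_mono[OF ev], goal_cases)
            case (1 n)
            then show ?case .
          next
            case (2 n)
            show ?case
            proof
              assume "n \<in> Kblock_at N W V B"
              from mp[OF 2 this] show "Q n B" using True unfolding Q_def by blast
            qed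
          qed
        next
          case False
          then have "(\<lambda>n. hom_density_block V E (W n) B) \<in> o[along (Kblock_at N W V B)](\<lambda>n. p n ^ card E)"
            by (simp add: \<P>_def negligible_Kblock_def)
          then have "\<forall>\<^sub>F n in along (Kblock_at N W V B).
              norm (hom_density_block V E (W n) B) \<le> \<kappa> * norm (p n ^ card E)"
            using \<kappa>(1) by (rule landau_o.smallD)
          then have "\<forall>\<^sub>F n in along N. n \<in> Kblock_at N W V B \<longrightarrow>
              norm (hom_density_block V E (W n) B) \<le> \<kappa> * norm (p n ^ card E)"
            by (rule eventually_along_cong)
          then show ?thesis using basic p_pos
          proof eventually_elim
            case (elim n)
            show ?case
            proof
              assume at: "n \<in> Kblock_at N W V B"
              then have "B \<in> V \<rightarrow>\<^sub>E {1..num (W n)}" using BE by (auto simp: Kblock_at_def PiE_def)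
              then have "hom_density_block V E (W n) B = block_hom V E (W n) B"
                using elim W VE by (intro hom_density_block_eq) auto
              then show "Q n B" using False elim at by (simp add: Q_def abs_le_iff)
            qed
          qed
        qed
      qed
    qed
    have rows: "\<forall>\<^sub>F n in along N. \<forall>x\<in>{0..1}. (LINT y : {0..1} | lborel. fn (W n) x y) = p n"
      using assms(9) by (simp add: cond1_def)
    have last: "\<forall>\<^sub>F n in along N. mS (W n) (num (W n)) \<ge> 1 - p n"
      using assms(10) by (simp add: cond2_def)
    have "\<forall>\<^sub>F n in along N. good (2 * \<theta>) n"
      using basic p_small p_pos h_ge K0 big mL blocks rows last
    proof eventually_elim
      case (elim n)
      then have nN: "n \<in> N" "3 \<le> n" by auto
      have X: "block_graphon (W n)" using W nN by blast
      have mLn: "\<Lambda> \<le> real n * mS (W n) i" if "i \<in> {1..num (W n)}" for i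
        using elim that nN by (auto simp: index_at_def)
      have bw: "block_weights (mS (W n)) (wt (W n)) n (num (W n)) (d n) (p n)"
      proof
        show "1 \<le> num (W n)" "(\<Sum>i = 1..num (W n). mS (W n) i) = 1"
          using block_graphon_sum_mS[OF X] by auto
        show "2 \<le> real n * mS (W n) i" if "i \<in> {1..num (W n)}" for i
          using mLn[OF that] \<Lambda>2 by linarith
        show "0 \<le> wt (W n) i j \<and> wt (W n) i j \<le> 1 \<and> wt (W n) i j = wt (W n) j i"
          if "i \<in> {1..num (W n)}" "j \<in> {1..num (W n)}" for i j
          using block_graphon_wt[OF X that] by auto
        show "(\<Sum>j = 1..num (W n). wt (W n) i j * mS (W n) j) = p n" if i: "i \<in> {1..num (W n)}" for i
        proof -
          \<comment> \<open>Any point of the nonempty interval turns regularity at that point into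
            the row sum of the block.\<close>
          obtain x where x: "x \<in> part (W n) i" using block_graphonD(4)[OF X i] by blast
          then have "x \<in> {0..1}" using block_graphonD(2)[OF X i] by blast
          then show ?thesis using block_graphon_row[OF X i x] elim by simp
        qed
        show "real (d n) = p n * real n" using nN by (simp add: p_def)
        show "even (d n * n)" using d nN by blast
      qed (use elim in auto)
      have B: "Q n B" if "B \<in> V \<rightarrow>\<^sub>E {1..num (W n)}" for B
      proof -
        have "B \<in> V \<rightarrow>\<^sub>E {1..K0}" using that elim PiE_mono[of V "\<lambda>_. {1..num (W n)}" "\<lambda>_. {1..K0}"] by auto
        moreover have "n \<in> Kblock_at N W V B" using that nN by (auto simp: Kblock_at_def)
        ultimately show ?thesis using elim by blast
      qed
      show ?case
        unfolding good_def prob_def h_def H_def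
        by (rule upper_tail_at[where \<P> = \<P> and \<kappa> = \<kappa>, OF VE X bw _ \<theta>(1,2) \<delta> \<delta>3 \<Lambda> mLn, unfolded Let_def])
          (use elim B \<kappa> in \<open>auto simp: Q_def h_def H_def\<close>)
    qed
    then show ?thesis using mono
    proof eventually_elim
      case (elim n)
      show ?case using elim(2)[rule_format, of "2 * \<theta>" \<eta>] elim(1) \<theta> by simp
    qed
  qed
  have "along N \<le> sequentially" by simp
  from ex_vanishing_threshold[OF this ev mono]
  obtain \<epsilon> where "(\<epsilon> \<longlongrightarrow> 0) (along N)" "\<forall>\<^sub>F n in along N. good (\<epsilon> n) n" by blast
  then show ?thesis
    unfolding good_def prob_def h_def H_def Let_def by blast
qed

end
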